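(* Let $\mathcal F$ be a $\Delta$-field of characteristic $0$, where $\Delta=\{\delta_1,\ldots,\delta_m\}$, $m>1$, let $u_1,\ldots,u_n$ be a set of $\Delta$-indeterminates over $\mathcal F$, and let $\mathcal G$ be a $\Delta$-field with $\mathcal F\subsetneq\mathcal G\subseteq\mathcal F\langle u_1,\ldots,u_n\rangle$. Then a necessary and sufficient condition for $\mathcal G$ to have a Lüroth generator (i.e. an element $v\in\mathcal G$ with $\mathcal G=\mathcal F\langle v\rangle$) is that the differential dimension polynomial of $\mathbf u=(u_1,\ldots,u_n)$ over $\mathcal G$ is of the form $$\omega_{\mathbf u/\mathcal G}(t)=n\binom{t+m}{m}-\binom{t+m-s}{m}$$ for some $s\in\mathbb N$.
   Context: A $\Delta$-field is a field endowed with a finite set $\Delta=\{\delta_1,\ldots,\delta_m\}$ of pairwise commuting derivations; a $\Delta$-subfield is a subfield closed under the $\delta_i$, with the induced derivations. $\mathbb N$ includes $0$. $\Theta=\{\delta_1^{e_1}\cdots\delta_m^{e_m}: e_i\in\mathbb N\}$, and $\mathrm{ord}(\delta_1^{e_1}\cdots\delta_m^{e_m})=\sum_i e_i$. Elements $u_1,\ldots,u_n$ of a $\Delta$-extension field of $\mathcal F$ are $\Delta$-indeterminates over $\mathcal F$ if the family $(\theta u_j)_{\theta\in\Theta,\,1\le j\le n}$ is algebraically independent over $\mathcal F$. $\mathcal F\langle a_1,\ldots,a_k\rangle$ denotes the $\Delta$-field generated over $\mathcal F$ by $a_1,\ldots,a_k$, i.e. $\mathcal F(\theta a_j:\theta\in\Theta,\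 1\le j\le k)$. For $t\in\mathbb N$, $u_j^{[t]}=\{\theta(u_j):\theta\in\Theta,\ \mathrm{ord}(\theta)\le t\}$. The differential dimension polynomial (Kolchin polynomial) $\omega_{\mathbf u/\mathcal G}(t)\in\mathbb Q[t]$ is the unique polynomial such that, for all sufficiently large $t\in\mathbb N$, $\omega_{\mathbf u/\mathcal G}(t)$ equals the transcendence degree of $\mathcal G(u_1^{[t]},\ldots,u_n^{[t]})$ over $\mathcal G$ (it exists by a theorem of Kolchin). Binomial coefficients $\binom{t+m-s}{m}$ are regarded as polynomials in $t$. *)

theory Defs
  imports
    Complex_Main
    "HOL-Library.Poly_Mapping"
    "HOL-Computational_Algebra.Polynomial"
begin

text \<open>
  The ambient \<open>\<Delta>\<close>-extension field is a whole type of class \<^class>\<open>field_char_0\<close>; the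
  \<open>\<Delta>\<close>-fields \<open>F\<close>, \<open>G\<close> are subsets of it.  The derivations are \<open>\<delta> i\<close> for \<open>i < m\<close>
  and the tuple is \<open>u j\<close> for \<open>j < n\<close>; values at other indices are irrelevant.
\<close>

definition is_subfield :: "'a::field set \<Rightarrow> bool" where
  "is_subfield K \<longleftrightarrow> 0 \<in> K \<and> 1 \<in> K \<and>
     (\<forall>x\<in>K. \<forall>y\<in>K. x + y \<in> K \<and> x * y \<in> K) \<and> (\<forall>x\<in>K. - x \<in> K \<and> inverse x \<in> K)"

definition field_gen :: "'a::field set \<Rightarrow> 'a set" where
  "field_gen S = \<Inter>{K. is_subfield K \<and> S \<subseteq> K}"

definition algebraic_over :: "'a::field set \<Rightarrow> 'a \<Rightarrow> bool" where
  "algebraic_over K x \<longleftrightarrow> (\<exists>p. p \<noteq> 0 \<and> (\<forall>i. coeff p i \<in> K) \<and> poly p x = 0)"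

text \<open>Multivariate polynomials in variables indexed by \<open>'i\<close> are finitely supported maps from
  exponent vectors to coefficients.\<close>

definition mpoly_eval :: "(('i \<Rightarrow>\<^sub>0 nat) \<Rightarrow>\<^sub>0 'a::field) \<Rightarrow> ('i \<Rightarrow> 'a) \<Rightarrow> 'a" where
  "mpoly_eval p x = (\<Sum>e\<in>Poly_Mapping.keys p.
     Poly_Mapping.lookup p e * (\<Prod>i\<in>Poly_Mapping.keys e. x i ^ Poly_Mapping.lookup e i))"

text \<open>Independence of the \<^emph>\<open>family\<close> \<open>(x i)\<close> for \<open>i \<in> I\<close>; in particular \<open>x\<close> is then injective
  on \<open>I\<close>.\<close>

definition alg_independent :: "'a::field set \<Rightarrow> 'i set \<Rightarrow> ('i \<Rightarrow> 'a) \<Rightarrow> bool" where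
  "alg_independent K I x \<longleftrightarrow>
     (\<forall>p. (\<forall>e. Poly_Mapping.lookup p e \<in> K) \<and>
       (\<forall>e\<in>Poly_Mapping.keys p. Poly_Mapping.keys e \<subseteq> I) \<and> mpoly_eval p x = 0 \<longrightarrow> p = 0)"

definition transcendence_basis :: "'a::field set \<Rightarrow> 'a set \<Rightarrow> 'a set \<Rightarrow> bool" where
  "transcendence_basis K L B \<longleftrightarrow>
     B \<subseteq> L \<and> alg_independent K B (\<lambda>b. b) \<and> (\<forall>x\<in>L. algebraic_over (field_gen (K \<union> B)) x)"

text \<open>Transcendence degree of \<open>L\<close> over \<open>K\<close>.  As with \<^const>\<open>card\<close>, an infinite degree yields
  \<open>0\<close>; below it is only used for finitely generated extensions.\<close>

definition trdeg :: "'a::field set \<Rightarrow> 'a set \<Rightarrow> nat" where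
  "trdeg K L = card (SOME B. transcendence_basis K L B)"

definition derivation :: "('a::field \<Rightarrow> 'a) \<Rightarrow> bool" where
  "derivation d \<longleftrightarrow> (\<forall>x y. d (x + y) = d x + d y) \<and> (\<forall>x y. d (x * y) = d x * y + x * d y)"

definition commuting_derivations :: "nat \<Rightarrow> (nat \<Rightarrow> 'a::field \<Rightarrow> 'a) \<Rightarrow> bool" where
  "commuting_derivations m \<delta> \<longleftrightarrow>
     (\<forall>i<m. derivation (\<delta> i)) \<and> (\<forall>i<m. \<forall>j<m. \<forall>x. \<delta> i (\<delta> j x) = \<delta> j (\<delta> i x))"

definition delta_subfield :: "nat \<Rightarrow> (nat \<Rightarrow> 'a::field \<Rightarrow> 'a) \<Rightarrow> 'a set \<Rightarrow> bool" where
  "delta_subfield m \<delta> K \<longleftrightarrow> is_subfield K \<and> (\<forall>i<m. \<forall>x\<in>K. \<delta> i x \<in> K)"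

text \<open>A derivative operator is represented by its exponent vector \<open>e\<close>, supported on \<open>{..<m}\<close>.\<close>

definition Theta :: "nat \<Rightarrow> (nat \<Rightarrow> nat) set" where
  "Theta m = {e. \<forall>i\<ge>m. e i = 0}"

definition theta_ord :: "nat \<Rightarrow> (nat \<Rightarrow> nat) \<Rightarrow> nat" where
  "theta_ord m e = (\<Sum>i<m. e i)"

primrec theta_app :: "(nat \<Rightarrow> 'a \<Rightarrow> 'a) \<Rightarrow> nat \<Rightarrow> (nat \<Rightarrow> nat) \<Rightarrow> 'a \<Rightarrow> 'a" where
  "theta_app \<delta> 0 e x = x"
| "theta_app \<delta> (Suc k) e x = theta_app \<delta> k e ((\<delta> k ^^ e k) x)"

definition delta_indeterminates ::
    "nat \<Rightarrow> (nat \<Rightarrow> 'a::field \<Rightarrow> 'a) \<Rightarrow> 'a set \<Rightarrow> nat \<Rightarrow> (nat \<Rightarrow> 'a) \<Rightarrow> bool" where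
  "delta_indeterminates m \<delta> F n u \<longleftrightarrow>
     alg_independent F (Theta m \<times> {..<n}) (\<lambda>(e, j). theta_app \<delta> m e (u j))"

definition delta_gen :: "nat \<Rightarrow> (nat \<Rightarrow> 'a::field \<Rightarrow> 'a) \<Rightarrow> 'a set \<Rightarrow> 'a set \<Rightarrow> 'a set" where
  "delta_gen m \<delta> F A = field_gen (F \<union> {theta_app \<delta> m e a |e a. e \<in> Theta m \<and> a \<in> A})"

definition jet :: "nat \<Rightarrow> (nat \<Rightarrow> 'a::field \<Rightarrow> 'a) \<Rightarrow> nat \<Rightarrow> 'a \<Rightarrow> 'a set" where
  "jet m \<delta> t a = {theta_app \<delta> m e a |e. e \<in> Theta m \<and> theta_ord m e \<le> t}"

text \<open>The relation ``\<open>w\<close> is the differential dimension polynomial of \<open>u 0, \<dots>, u (n - 1)\<close>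
  over \<open>G\<close>''. Such a \<open>w\<close> exists by a theorem of Kolchin; uniqueness is shown below.\<close>

definition is_kolchin_polynomial ::
    "nat \<Rightarrow> (nat \<Rightarrow> 'a::field \<Rightarrow> 'a) \<Rightarrow> 'a set \<Rightarrow> nat \<Rightarrow> (nat \<Rightarrow> 'a) \<Rightarrow> rat poly \<Rightarrow> bool" where
  "is_kolchin_polynomial m \<delta> G n u w \<longleftrightarrow>
     (\<forall>\<^sub>F t in sequentially.
        poly w (of_nat t) = of_nat (trdeg G (field_gen (G \<union> (\<Union>j<n. jet m \<delta> t (u j))))))"

lemma is_kolchin_polynomial_unique:
  assumes "is_kolchin_polynomial m \<delta> G n u w" "is_kolchin_polynomial m \<delta> G n u w'"
  shows "w = w'"
proof -
  have "\<forall>\<^sub>F t in sequentially. poly (w - w') (of_nat t) = 0"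
    using assms unfolding is_kolchin_polynomial_def by eventually_elim simp
  then obtain N where N: "\<And>t. t \<ge> N \<Longrightarrow> poly (w - w') (of_nat t) = 0"
    unfolding eventually_sequentially by blast
  have "infinite ((of_nat :: nat \<Rightarrow> rat) ` {N..})"
    by (subst finite_image_iff) (auto simp: infinite_Ici inj_on_def)
  moreover have "(of_nat :: nat \<Rightarrow> rat) ` {N..} \<subseteq> {x. poly (w - w') x = 0}"
    using N by blast
  ultimately have "infinite {x. poly (w - w') x = 0}"
    using finite_subset by blast
  then show ?thesis
    using poly_roots_finite[of "w - w'"] by auto
qed

text \<open>The polynomial \<open>binomial(t + c, m)\<close> in the variable \<open>t\<close>.\<close>

definition binomial_poly :: "rat \<Rightarrow> nat \<Rightarrow> rat poly" where
  "binomial_poly c m = smult (1 / fact m) (\<Prod>i<m. [:c - of_nat i, 1:])"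

lemma poly_binomial_poly: "poly (binomial_poly c m) t = (t + c) gchoose m"
  by (simp add: binomial_poly_def gbinomial_prod_rev poly_prod atLeast0LessThan algebra_simps)

end

theory Submission
  imports Defs "HOL-Computational_Algebra.Polynomial_Factorial" "HOL-Library.FuncSet"
begin

text \<open>
  Let \<open>x\<^sub>\<eta>\<close> be the derivatives of the \<open>u j\<close>, ordered by an orderly ranking, and call \<open>\<eta>\<close> a leader
  over \<open>G\<close> if \<open>x\<^sub>\<eta>\<close> is algebraic over \<open>G\<close> and the lower derivatives. The leaders form a set \<open>E\<close> stable
  under derivation, and the transcendence degree defining the Kolchin polynomial at \<open>t\<close> is the number of
  derivatives of order at most \<open>t\<close> outside \<open>E\<close>. So the Kolchin polynomial has the required shape if
  and only if \<open>E\<close> consists of all derivatives of a single \<open>\<eta>0\<close> of order \<open>s\<close>.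

  If \<open>G = F\<langle>v\<rangle>\<close>, then \<open>\<eta>0\<close> is the leader of \<open>v\<close>. Conversely, let \<open>X\<close> be the field generated over \<open>F\<close> by
  the \<open>x\<^sub>\<zeta>\<close> with \<open>\<zeta> \<le> \<eta>0\<close>. A linear relation over \<open>G\<close> with minimal support between elements of \<open>X\<close> has, after
  normalisation, coefficients in \<open>X\<close>: otherwise one differentiates it partially with respect to the
  highest derivative in the coefficients and obtains a shorter relation. Hence \<open>X\<close> and \<open>G\<close> are linearly
  disjoint over \<open>G0 = G \<inter> X\<close>, which has transcendence degree 1 over \<open>F\<close>. By the theorem of
  Lueroth and Gordan \<open>G0 = F(v)\<close>, and linear disjointness yields \<open>G = F\<langle>v\<rangle>\<close>.
\<close>

subsection \<open>Subfields\<close>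

text \<open>The obstacle is that a partial derivative does not preserve \<open>G\<close>, so
  differentiating the coefficients of a relation over \<open>G\<close> leads outside
  \<open>G\<close>. The count of leaders repairs this. Elements of \<open>G\<close> of order at most
  \<open>t\<close> that are algebraically independent over \<open>F\<close> are at most as many as
  the leaders of order at most \<open>t\<close>. Since the leaders are the derivatives of one
  \<open>\<eta>0\<close>, the coefficients and their derivatives have room for about one independent
  element per operator. So for some operator all differentiated coefficients depend algebraically on
  a single one, which makes the partial derivatives proportional over \<open>G\<close>.

  That \<open>G0\<close> is larger than \<open>F\<close> follows from linear disjointness, applied
  to the equation of the derivative at \<open>\<eta>0\<close>. In the last step, leaders above
  \<open>\<eta>0\<close> are rational over \<open>F\<langle>v\<rangle>\<close> and lower
  derivatives, and non-leaders drop out because they are transcendental over \<open>G\<close>. What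
  is left lies in a compositum, where coefficients can be compared.\<close>

lemma is_subfieldI:
  assumes "0 \<in> K" "1 \<in> K" "\<And>x y. x \<in> K \<Longrightarrow> y \<in> K \<Longrightarrow> x + y \<in> K"
    "\<And>x y. x \<in> K \<Longrightarrow> y \<in> K \<Longrightarrow> x * y \<in> K" "\<And>x. x \<in> K \<Longrightarrow> - x \<in> K"
    "\<And>x. x \<in> K \<Longrightarrow> x \<noteq> 0 \<Longrightarrow> inverse x \<in> K"
  shows "is_subfield K"
  using assms unfolding is_subfield_def by (metis inverse_zero)

lemma subfield_closed:
  assumes "is_subfield K"
  shows subfield_0: "0 \<in> K" and subfield_1: "1 \<in> K"
    and subfield_add: "x \<in> K \<Longrightarrow> y \<in> K \<Longrightarrow> x + y \<in> K"
    and subfield_mult: "x \<in> K \<Longrightarrow> y \<in> K \<Longrightarrow> x * y \<in> K"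
    and subfield_uminus: "x \<in> K \<Longrightarrow> - x \<in> K"
    and subfield_inverse: "x \<in> K \<Longrightarrow> inverse x \<in> K"
    and subfield_diff: "x \<in> K \<Longrightarrow> y \<in> K \<Longrightarrow> x - y \<in> K"
    and subfield_divide: "x \<in> K \<Longrightarrow> y \<in> K \<Longrightarrow> x / y \<in> K"
    and subfield_power: "x \<in> K \<Longrightarrow> x ^ n \<in> K"
    and subfield_of_nat: "of_nat n \<in> K"
    and subfield_sum: "(\<And>i. i \<in> I \<Longrightarrow> f i \<in> K) \<Longrightarrow> sum f I \<in> K"
    and subfield_prod: "(\<And>i. i \<in> I \<Longrightarrow> f i \<in> K) \<Longrightarrow> prod f I \<in> K"
proof -
  show 0: "0 \<in> K" and 1: "1 \<in> K"
    and a: "\<And>x y. x \<in> K \<Longrightarrow> y \<in> K \<Longrightarrow> x + y \<in> K"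
    and m: "\<And>x y. x \<in> K \<Longrightarrow> y \<in> K \<Longrightarrow> x * y \<in> K"
    and u: "\<And>x. x \<in> K \<Longrightarrow> - x \<in> K"
    and i: "\<And>x. x \<in> K \<Longrightarrow> inverse x \<in> K"
    using assms unfolding is_subfield_def by auto
  show "x \<in> K \<Longrightarrow> y \<in> K \<Longrightarrow> x - y \<in> K" using a[OF _ u] by fastforce
  show "x \<in> K \<Longrightarrow> y \<in> K \<Longrightarrow> x / y \<in> K" using m[OF _ i] by (simp add: divide_inverse)
  show "x \<in> K \<Longrightarrow> x ^ n \<in> K" by (induction n) (auto intro: 1 m)
  show "of_nat n \<in> K" by (induction n) (auto intro: 0 1 a)
  show "(\<And>i. i \<in> I \<Longrightarrow> f i \<in> K) \<Longrightarrow> sum f I \<in> K"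
    by (induction I rule: infinite_finite_induct) (auto intro: 0 a)
  show "(\<And>i. i \<in> I \<Longrightarrow> f i \<in> K) \<Longrightarrow> prod f I \<in> K"
    by (induction I rule: infinite_finite_induct) (auto intro: 1 m)
qed

lemma subfield_Inter: "(\<And>K. K \<in> A \<Longrightarrow> is_subfield K) \<Longrightarrow> is_subfield (\<Inter>A)"
  unfolding is_subfield_def by blast

lemma subfield_Int: "is_subfield K \<Longrightarrow> is_subfield L \<Longrightarrow> is_subfield (K \<inter> L)"
  unfolding is_subfield_def by blast

lemma subfield_field_gen [simp, intro]: "is_subfield (field_gen S)"
  unfolding field_gen_def by (rule subfield_Inter) blast

lemma field_gen_superset: "S \<subseteq> field_gen S"
  unfolding field_gen_def by blast

lemma field_gen_incl: "x \<in> S \<Longrightarrow> x \<in> field_gen S"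
  using field_gen_superset by blast

lemma field_gen_least: "is_subfield K \<Longrightarrow> S \<subseteq> K \<Longrightarrow> field_gen S \<subseteq> K"
  unfolding field_gen_def by blast

lemma field_gen_mono: "S \<subseteq> T \<Longrightarrow> field_gen S \<subseteq> field_gen T"
  by (meson field_gen_least field_gen_superset order_trans subfield_field_gen)

lemma field_gen_subfield [simp]: "is_subfield K \<Longrightarrow> field_gen K = K"
  using field_gen_least[of K K] field_gen_superset[of K] by blast

lemma field_gen_Un_field_gen: "field_gen (field_gen S \<union> T) = field_gen (S \<union> T)"
proof
  show "field_gen (field_gen S \<union> T) \<subseteq> field_gen (S \<union> T)"
    using field_gen_mono[of S "S \<union> T"] field_gen_superset[of "S \<union> T"]
    by (intro field_gen_least) auto
  show "field_gen (S \<union> T) \<subseteq> field_gen (field_gen S \<union> T)"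
    using field_gen_superset[of S] by (intro field_gen_mono) auto
qed

lemma field_gen_finitary:
  assumes "x \<in> field_gen S"
  obtains S0 where "finite S0" "S0 \<subseteq> S" "x \<in> field_gen S0"
proof -
  define K where "K = {x. \<exists>S0. finite S0 \<and> S0 \<subseteq> S \<and> x \<in> field_gen S0}"
  have two: "\<exists>S0. finite S0 \<and> S0 \<subseteq> S \<and> x \<in> field_gen S0 \<and> y \<in> field_gen S0"
    if xy: "x \<in> K" "y \<in> K" for x y
  proof -
    obtain A B where AB: "finite A" "A \<subseteq> S" "x \<in> field_gen A" "finite B" "B \<subseteq> S" "y \<in> field_gen B"
      using xy unfolding K_def by blast
    then show ?thesis
      using field_gen_mono[of A "A \<union> B"] field_gen_mono[of B "A \<union> B"]
      by (intro exI[of _ "A \<union> B"]) auto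
  qed
  have "is_subfield K"
  proof (rule is_subfieldI)
    show "0 \<in> K" "1 \<in> K"
      unfolding K_def by (auto intro!: exI[of _ "{}"] subfield_0 subfield_1)
    show "x + y \<in> K" "x * y \<in> K" if "x \<in> K" "y \<in> K" for x y
      using two[OF that] unfolding K_def
      by (auto intro: subfield_add[OF subfield_field_gen] subfield_mult[OF subfield_field_gen])
    show "- x \<in> K" "inverse x \<in> K" if "x \<in> K" for x
      using that unfolding K_def
      by (auto intro: subfield_uminus[OF subfield_field_gen] subfield_inverse[OF subfield_field_gen])
  qed
  moreover have "S \<subseteq> K"
  proof
    fix s assume "s \<in> S"
    then show "s \<in> K" unfolding K_def
      by (auto intro!: exI[of _ "{s}"] field_gen_incl)
  qed
  ultimately have "x \<in> K" using field_gen_least assms by blast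
  then show ?thesis using that unfolding K_def by blast
qed

lemma subfield_fractions:
  assumes "1 \<in> S" "0 \<in> S" "\<And>x y. x \<in> S \<Longrightarrow> y \<in> S \<Longrightarrow> x + y \<in> S"
    "\<And>x y. x \<in> S \<Longrightarrow> y \<in> S \<Longrightarrow> x * y \<in> S" "\<And>x. x \<in> S \<Longrightarrow> - x \<in> S"
  shows "is_subfield {p / q |p q. p \<in> S \<and> q \<in> S \<and> q \<noteq> (0::'a::field)}" (is "is_subfield ?K")
proof (rule is_subfieldI)
  show "0 \<in> ?K" using assms(1,2) by (intro CollectI exI[of _ 0] exI[of _ 1]) auto
  show "1 \<in> ?K" using assms(1) by (intro CollectI exI[of _ 1]) auto
next
  fix x y assume "x \<in> ?K" "y \<in> ?K"
  then obtain p q r s where *: "x = p / q" "y = r / s" "q \<noteq> 0" "s \<noteq> 0"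
    "p \<in> S" "q \<in> S" "r \<in> S" "s \<in> S" by blast
  then have eq: "x + y = (p * s + r * q) / (q * s)" "x * y = (p * r) / (q * s)"
    by (simp_all add: add_frac_eq)
  have mem: "p * s + r * q \<in> S" "p * r \<in> S" "q * s \<in> S" "q * s \<noteq> 0"
    using * assms(3,4) by auto
  show "x + y \<in> ?K" unfolding eq using mem by blast
  show "x * y \<in> ?K" unfolding eq using mem by blast
next
  fix x assume "x \<in> ?K"
  then obtain p q where *: "x = p / q" "q \<noteq> 0" "p \<in> S" "q \<in> S" by blast
  then have "- x = (- p) / q" by simp
  then show "- x \<in> ?K" using * assms(5) by blast
  show "inverse x \<in> ?K" if "x \<noteq> 0"
  proof -
    have "p \<noteq> 0" "inverse x = q / p" using * that by auto
    then show ?thesis using * by blast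
  qed
qed

lemma field_gen_fractions:
  assumes "1 \<in> S" "0 \<in> S" "\<And>x y. x \<in> S \<Longrightarrow> y \<in> S \<Longrightarrow> x + y \<in> S"
    "\<And>x y. x \<in> S \<Longrightarrow> y \<in> S \<Longrightarrow> x * y \<in> S" "\<And>x. x \<in> S \<Longrightarrow> - x \<in> S"
    and "A \<subseteq> S" "x \<in> field_gen A"
  obtains p q where "p \<in> S" "q \<in> S" "q \<noteq> (0::'a::field)" "x = p / q"
proof -
  have "s \<in> {p / q |p q. p \<in> S \<and> q \<in> S \<and> q \<noteq> 0}" if "s \<in> A" for s
    using assms(1) assms(6) that by (intro CollectI exI[of _ s] exI[of _ 1]) auto
  then have "A \<subseteq> {p / q |p q. p \<in> S \<and> q \<in> S \<and> q \<noteq> 0}" by (rule subsetI)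
  with subfield_fractions[OF assms(1-5)] have "field_gen A \<subseteq> {p / q |p q. p \<in> S \<and> q \<in> S \<and> q \<noteq> 0}"
    by (rule field_gen_least)
  then show ?thesis using assms(7) that by blast
qed

text \<open>Each numerator is multiplied by the denominators of the other indices. Asking of
  \<open>S\<close> only closure under products lets the lemma serve values of polynomials in one or
  several variables and composita alike.\<close>

lemma common_denominator:
  fixes z :: "'i \<Rightarrow> 'a::field"
  assumes "1 \<in> S" "\<And>x y. x \<in> S \<Longrightarrow> y \<in> S \<Longrightarrow> x * y \<in> S" and "finite I"
    and "\<And>i. i \<in> I \<Longrightarrow> \<exists>p\<in>S. \<exists>q\<in>S. q \<noteq> 0 \<and> z i = p / q"
  obtains p q where "\<And>i. i \<in> I \<Longrightarrow> p i \<in> S" "q \<in> S" "q \<noteq> 0" "\<And>i. i \<in> I \<Longrightarrow> z i = p i / q"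
proof -
  have "\<exists>p q. p \<in> S \<and> q \<in> S \<and> q \<noteq> 0 \<and> z i = p / q" if "i \<in> I" for i using assms(4)[OF that] by blast
  then obtain p q where pq: "p i \<in> S" "q i \<in> S" "q i \<noteq> 0" "z i = p i / q i" if "i \<in> I" for i
    by metis
  have prodS: "(\<And>i. i \<in> J \<Longrightarrow> q i \<in> S) \<Longrightarrow> prod q J \<in> S" for J
    by (induction J rule: infinite_finite_induct) (auto intro: assms(1,2))
  show ?thesis
  proof (rule that[of "\<lambda>i. p i * prod q (I - {i})" "prod q I"])
    show "p i * prod q (I - {i}) \<in> S" if "i \<in> I" for i
      using that pq by (intro assms(2) prodS) auto
    show "prod q I \<in> S" using pq by (intro prodS)
    show "prod q I \<noteq> 0" using pq \<open>finite I\<close> by simp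
    fix i assume i: "i \<in> I"
    have "prod q (I - {i}) \<noteq> 0" using pq \<open>finite I\<close> by simp
    moreover have "prod q I = q i * prod q (I - {i})" using \<open>finite I\<close> i by (rule prod.remove)
    ultimately show "z i = p i * prod q (I - {i}) / prod q I"
      using pq(4)[OF i] by simp
  qed
qed

subsection \<open>Polynomials over a subfield\<close>

definition polys_over :: "'a::field set \<Rightarrow> 'a poly set" where
  "polys_over K = {p. \<forall>i. coeff p i \<in> K}"

lemma polys_overD: "p \<in> polys_over K \<Longrightarrow> coeff p i \<in> K"
  by (simp add: polys_over_def)

lemma polys_over_mono: "K \<subseteq> L \<Longrightarrow> polys_over K \<subseteq> polys_over L"
  by (auto simp: polys_over_def)

lemma polys_over_closed:
  assumes K: "is_subfield K"
  shows polys_over_0: "0 \<in> polys_over K" and polys_over_1: "1 \<in> polys_over K"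
    and polys_over_const: "c \<in> K \<Longrightarrow> [:c:] \<in> polys_over K"
    and polys_over_X: "[:0, 1:] \<in> polys_over K"
    and polys_over_pCons: "c \<in> K \<Longrightarrow> p \<in> polys_over K \<Longrightarrow> pCons c p \<in> polys_over K"
    and polys_over_add: "p \<in> polys_over K \<Longrightarrow> q \<in> polys_over K \<Longrightarrow> p + q \<in> polys_over K"
    and polys_over_diff: "p \<in> polys_over K \<Longrightarrow> q \<in> polys_over K \<Longrightarrow> p - q \<in> polys_over K"
    and polys_over_uminus: "p \<in> polys_over K \<Longrightarrow> - p \<in> polys_over K"
    and polys_over_smult: "c \<in> K \<Longrightarrow> p \<in> polys_over K \<Longrightarrow> smult c p \<in> polys_over K"
    and polys_over_monom: "c \<in> K \<Longrightarrow> monom c n \<in> polys_over K"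
    and polys_over_mult: "p \<in> polys_over K \<Longrightarrow> q \<in> polys_over K \<Longrightarrow> p * q \<in> polys_over K"
    and polys_over_sum: "(\<And>i. i \<in> I \<Longrightarrow> f i \<in> polys_over K) \<Longrightarrow> sum f I \<in> polys_over K"
    and polys_over_prod: "(\<And>i. i \<in> I \<Longrightarrow> f i \<in> polys_over K) \<Longrightarrow> prod f I \<in> polys_over K"
    and polys_over_pderiv: "p \<in> polys_over K \<Longrightarrow> pderiv p \<in> polys_over K"
    and polys_over_poly: "p \<in> polys_over K \<Longrightarrow> x \<in> K \<Longrightarrow> poly p x \<in> K"
proof -
  note c = subfield_0[OF K] subfield_1[OF K] subfield_add[OF K] subfield_mult[OF K]
    subfield_uminus[OF K] subfield_diff[OF K] subfield_sum[OF K] subfield_of_nat[OF K] subfield_power[OF K]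
  show 0: "0 \<in> polys_over K" and 1: "1 \<in> polys_over K"
    by (auto simp: polys_over_def coeff_pCons c one_pCons split: nat.split)
  show pC: "c \<in> K \<Longrightarrow> p \<in> polys_over K \<Longrightarrow> pCons c p \<in> polys_over K" for c p
    by (auto simp: polys_over_def coeff_pCons c split: nat.split)
  show C: "c \<in> K \<Longrightarrow> [:c:] \<in> polys_over K" for c using pC 0 by blast
  show "[:0, 1:] \<in> polys_over K" using C pC c by blast
  show A: "p \<in> polys_over K \<Longrightarrow> q \<in> polys_over K \<Longrightarrow> p + q \<in> polys_over K" for p q
    by (auto simp: polys_over_def c)
  show "p \<in> polys_over K \<Longrightarrow> q \<in> polys_over K \<Longrightarrow> p - q \<in> polys_over K"
    by (auto simp: polys_over_def c)
  show "p \<in> polys_over K \<Longrightarrow> - p \<in> polys_over K"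
    by (auto simp: polys_over_def c)
  show "c \<in> K \<Longrightarrow> p \<in> polys_over K \<Longrightarrow> smult c p \<in> polys_over K"
    by (auto simp: polys_over_def c)
  show "c \<in> K \<Longrightarrow> monom c n \<in> polys_over K"
    by (auto simp: polys_over_def c)
  show M: "p \<in> polys_over K \<Longrightarrow> q \<in> polys_over K \<Longrightarrow> p * q \<in> polys_over K" for p q
    by (auto simp: polys_over_def coeff_mult intro!: c)
  show "(\<And>i. i \<in> I \<Longrightarrow> f i \<in> polys_over K) \<Longrightarrow> sum f I \<in> polys_over K"
    by (induction I rule: infinite_finite_induct) (auto intro: 0 A)
  show "(\<And>i. i \<in> I \<Longrightarrow> f i \<in> polys_over K) \<Longrightarrow> prod f I \<in> polys_over K"
    by (induction I rule: infinite_finite_induct) (auto intro: 1 M)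
  show "p \<in> polys_over K \<Longrightarrow> pderiv p \<in> polys_over K"
    by (auto simp: polys_over_def coeff_pderiv simp del: of_nat_Suc intro!: c)
  show "p \<in> polys_over K \<Longrightarrow> x \<in> K \<Longrightarrow> poly p x \<in> K"
    by (auto simp: polys_over_def poly_altdef intro!: c)
qed

lemma algebraic_over_iff:
  "algebraic_over K x \<longleftrightarrow> (\<exists>p\<in>polys_over K. p \<noteq> 0 \<and> poly p x = 0)"
  unfolding algebraic_over_def polys_over_def by auto

lemma field_gen_simple:
  assumes K: "is_subfield K" and "z \<in> field_gen (insert x K)"
  obtains p q where "p \<in> polys_over K" "q \<in> polys_over K" "poly q x \<noteq> 0" "z = poly p x / poly q x"
proof -
  define S where "S = (\<lambda>p. poly p x) ` polys_over K"
  have S: "poly p x \<in> S" if "p \<in> polys_over K" for p using that by (auto simp: S_def)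
  have SE: "\<exists>p\<in>polys_over K. s = poly p x" if "s \<in> S" for s using that by (auto simp: S_def)
  note pK = polys_over_closed[OF K]
  have "\<exists>p\<in>S. \<exists>q\<in>S. q \<noteq> 0 \<and> z = p / q"
  proof (rule field_gen_fractions[OF _ _ _ _ _ _ assms(2), of S])
    show "1 \<in> S" "0 \<in> S" using S[OF pK(1)] S[OF pK(2)] by auto
    show "a + b \<in> S" "a * b \<in> S" if "a \<in> S" "b \<in> S" for a b
      using SE[OF that(1)] SE[OF that(2)] S pK(6) pK(11) by (metis poly_add, metis poly_mult)
    show "- a \<in> S" if "a \<in> S" for a using SE[OF that] S pK(8) by (metis poly_minus)
    show "insert x K \<subseteq> S" using S[OF pK(4)] S[OF pK(3)] by auto
  qed blast
  then show ?thesis using that unfolding S_def by blast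
qed

lemma field_gen_simple_common:
  assumes K: "is_subfield K" and "finite I" "\<And>i. i \<in> I \<Longrightarrow> z i \<in> field_gen (insert x K)"
  obtains p q where "\<And>i. i \<in> I \<Longrightarrow> p i \<in> polys_over K" "q \<in> polys_over K" "poly q x \<noteq> 0"
    "\<And>i. i \<in> I \<Longrightarrow> z i = poly (p i) x / poly q x"
proof -
  let ?S = "(\<lambda>p. poly p x) ` polys_over K"
  have one: "1 \<in> ?S" using polys_over_1[OF K] by (intro image_eqI[of _ _ 1]) auto
  have mult: "a * b \<in> ?S" if ab: "a \<in> ?S" "b \<in> ?S" for a b
  proof -
    obtain p q where "a = poly p x" "b = poly q x" "p \<in> polys_over K" "q \<in> polys_over K" using ab by blast
    then show ?thesis using polys_over_mult[OF K] by (intro image_eqI[of _ _ "p * q"]) auto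
  qed
  have fr: "\<exists>p\<in>?S. \<exists>q\<in>?S. q \<noteq> 0 \<and> z i = p / q" if i: "i \<in> I" for i
  proof -
    obtain p q where "p \<in> polys_over K" "q \<in> polys_over K" "poly q x \<noteq> 0" "z i = poly p x / poly q x"
      using field_gen_simple[OF K assms(3)[OF i]] by metis
    then show ?thesis by (intro bexI[of _ "poly p x"] bexI[of _ "poly q x"]) auto
  qed
  show ?thesis
  proof (rule common_denominator[OF one mult assms(2), of z])
    show "\<exists>p\<in>?S. \<exists>q\<in>?S. q \<noteq> 0 \<and> z i = p / q" if "i \<in> I" for i using fr[OF that] .
    fix p q assume pq: "\<And>i. i \<in> I \<Longrightarrow> p i \<in> ?S" "q \<in> ?S" "q \<noteq> 0" "\<And>i. i \<in> I \<Longrightarrow> z i = p i / q"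
    have "\<forall>i\<in>I. \<exists>f. f \<in> polys_over K \<and> p i = poly f x" using pq(1) by blast
    then obtain f where f: "\<forall>i\<in>I. f i \<in> polys_over K \<and> p i = poly (f i) x" by (rule bchoice[THEN exE])
    obtain g where "g \<in> polys_over K" "q = poly g x" using pq(2) by blast
    then show thesis using that[of f g] f pq(3,4) by simp
  qed
qed

subsection \<open>Linear dependence over a subfield\<close>

text \<open>A property of the indexed family, so repeated values make it dependent. It is meant for
  finite \<open>I\<close>; over an infinite index set the sum is \<open>0\<close> by
  convention.\<close>

definition lin_dep :: "'a::field set \<Rightarrow> 'i set \<Rightarrow> ('i \<Rightarrow> 'a) \<Rightarrow> bool" where
  "lin_dep K I f \<longleftrightarrow> (\<exists>c. (\<forall>i\<in>I. c i \<in> K) \<and> (\<exists>i\<in>I. c i \<noteq> 0) \<and> (\<Sum>i\<in>I. c i * f i) = 0)"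

definition lin_span :: "'a::field set \<Rightarrow> 'i set \<Rightarrow> ('i \<Rightarrow> 'a) \<Rightarrow> 'a set" where
  "lin_span K I f = {\<Sum>i\<in>I. c i * f i |c. \<forall>i\<in>I. c i \<in> K}"

lemma lin_spanI: "(\<And>i. i \<in> I \<Longrightarrow> c i \<in> K) \<Longrightarrow> (\<Sum>i\<in>I. c i * f i) \<in> lin_span K I f"
  unfolding lin_span_def by blast

lemma lin_spanE:
  assumes "x \<in> lin_span K I f"
  obtains c where "\<And>i. i \<in> I \<Longrightarrow> c i \<in> K" "x = (\<Sum>i\<in>I. c i * f i)"
  using assms unfolding lin_span_def by blast

lemma lin_span_closed:
  assumes K: "is_subfield K"
  shows lin_span_0: "0 \<in> lin_span K I f"
    and lin_span_add: "x \<in> lin_span K I f \<Longrightarrow> y \<in> lin_span K I f \<Longrightarrow> x + y \<in> lin_span K I f"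
    and lin_span_scale: "a \<in> K \<Longrightarrow> x \<in> lin_span K I f \<Longrightarrow> a * x \<in> lin_span K I f"
    and lin_span_uminus: "x \<in> lin_span K I f \<Longrightarrow> - x \<in> lin_span K I f"
    and lin_span_sum: "(\<And>j. j \<in> J \<Longrightarrow> g j \<in> lin_span K I f) \<Longrightarrow> sum g J \<in> lin_span K I f"
proof -
  show 0: "0 \<in> lin_span K I f"
    using lin_spanI[of I "\<lambda>_. 0" K f] subfield_0[OF K] by simp
  show A: "x \<in> lin_span K I f \<Longrightarrow> y \<in> lin_span K I f \<Longrightarrow> x + y \<in> lin_span K I f" for x y
  proof (elim lin_spanE)
    fix c d assume "\<And>i. i \<in> I \<Longrightarrow> c i \<in> K" "\<And>i. i \<in> I \<Longrightarrow> d i \<in> K"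
      "x = (\<Sum>i\<in>I. c i * f i)" "y = (\<Sum>i\<in>I. d i * f i)"
    then show ?thesis
      using lin_spanI[of I "\<lambda>i. c i + d i" K f] subfield_add[OF K]
      by (simp add: sum.distrib algebra_simps)
  qed
  show S: "a \<in> K \<Longrightarrow> x \<in> lin_span K I f \<Longrightarrow> a * x \<in> lin_span K I f" for a x
  proof (elim lin_spanE)
    fix c assume "a \<in> K" "\<And>i. i \<in> I \<Longrightarrow> c i \<in> K" "x = (\<Sum>i\<in>I. c i * f i)"
    then show ?thesis
      using lin_spanI[of I "\<lambda>i. a * c i" K f] subfield_mult[OF K]
      by (simp add: sum_distrib_left algebra_simps)
  qed
  show "x \<in> lin_span K I f \<Longrightarrow> - x \<in> lin_span K I f"
    using S[of "-1" x] subfield_uminus[OF K subfield_1[OF K]] by simp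
  show "(\<And>j. j \<in> J \<Longrightarrow> g j \<in> lin_span K I f) \<Longrightarrow> sum g J \<in> lin_span K I f"
    by (induction J rule: infinite_finite_induct) (auto intro: 0 A)
qed

lemma lin_span_base:
  assumes K: "is_subfield K" and "finite I" "i \<in> I"
  shows "f i \<in> lin_span K I f"
proof -
  have "f i = (\<Sum>j\<in>I. (if j = i then 1 else 0) * f j)"
    using assms by (simp add: if_distrib[of "\<lambda>a. a * _"] cong: if_cong)
  also have "\<dots> \<in> lin_span K I f"
    by (rule lin_spanI) (auto intro: subfield_0[OF K] subfield_1[OF K])
  finally show ?thesis .
qed

lemma lin_span_trans:
  assumes L: "is_subfield L" and "K \<subseteq> L" "finite J" "x \<in> lin_span K I f"
    and "\<And>i. i \<in> I \<Longrightarrow> f i \<in> lin_span L J g"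
  shows "x \<in> lin_span L J g"
proof -
  obtain c where c: "\<And>i. i \<in> I \<Longrightarrow> c i \<in> K" "x = (\<Sum>i\<in>I. c i * f i)"
    using lin_spanE[OF assms(4)] by metis
  show ?thesis unfolding c(2)
    using c(1) assms by (intro lin_span_sum[OF L] lin_span_scale[OF L]) auto
qed

text \<open>Gaussian elimination: a pivot \<open>f i0\<close> that involves \<open>g j\<close> is
  subtracted from the other vectors, which leaves one vector and one generator fewer.\<close>

lemma lin_dep_pigeonhole:
  assumes K: "is_subfield K"
  shows "finite J \<Longrightarrow> finite I \<Longrightarrow> card J < card I \<Longrightarrow> (\<And>i. i \<in> I \<Longrightarrow> f i \<in> lin_span K J g)
    \<Longrightarrow> lin_dep K I f"
proof (induction J arbitrary: I f rule: finite_induct)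
  case empty
  then have "I \<noteq> {}" "\<And>i. i \<in> I \<Longrightarrow> f i = 0" by (auto simp: lin_span_def)
  then show ?case unfolding lin_dep_def
    using subfield_1[OF K] by (intro exI[of _ "\<lambda>_. 1"]) auto
next
  case (insert j J)
  have "\<exists>c. (\<forall>k\<in>insert j J. c k \<in> K) \<and> f i = (\<Sum>k\<in>insert j J. c k * g k)" if "i \<in> I" for i
    using lin_spanE[OF insert.prems(3)[OF that]] by metis
  then obtain c where c: "\<And>i k. i \<in> I \<Longrightarrow> k \<in> insert j J \<Longrightarrow> c i k \<in> K"
    "\<And>i. i \<in> I \<Longrightarrow> f i = (\<Sum>k\<in>insert j J. c i k * g k)" by metis
  have c2: "f i = c i j * g j + (\<Sum>k\<in>J. c i k * g k)" if "i \<in> I" for i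
    using c(2)[OF that] insert.hyps by simp
  show ?case
  proof (cases "\<exists>i\<in>I. c i j \<noteq> 0")
    case False
    then have "f i \<in> lin_span K J g" if "i \<in> I" for i
      using c2[OF that] that c(1) lin_spanI[of J "c i" K g] by auto
    then show ?thesis using insert.IH[of I f] insert.prems insert.hyps by simp
  next
    case True
    then obtain i0 where i0: "i0 \<in> I" "c i0 j \<noteq> 0" by blast
    define I' where "I' = I - {i0}"
    define r where "r i = c i j / c i0 j" for i
    have rK: "r i \<in> K" if "i \<in> I" for i
      using that i0 c(1) unfolding r_def by (intro subfield_divide[OF K]) auto
    have "f i - r i * f i0 \<in> lin_span K J g" if "i \<in> I'" for i
    proof -
      have i: "i \<in> I" using that I'_def by auto
      have "f i - r i * f i0 = (\<Sum>k\<in>J. c i k * g k) - r i * (\<Sum>k\<in>J. c i0 k * g k)"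
        using i0 unfolding c2[OF i] c2[OF i0(1)] r_def by (simp add: field_simps)
      also have "\<dots> = (\<Sum>k\<in>J. (c i k - r i * c i0 k) * g k)"
        by (simp add: sum_subtractf sum_distrib_left algebra_simps)
      also have "\<dots> \<in> lin_span K J g"
        using c(1) i i0 rK[OF i]
        by (intro lin_spanI subfield_diff[OF K] subfield_mult[OF K]) auto
      finally show ?thesis .
    qed
    moreover have "finite I'" "card J < card I'"
      using insert.prems insert.hyps i0 unfolding I'_def by auto
    ultimately have "lin_dep K I' (\<lambda>i. f i - r i * f i0)" by (intro insert.IH)
    then obtain a where a: "\<forall>i\<in>I'. a i \<in> K" "\<exists>i\<in>I'. a i \<noteq> 0"
      "(\<Sum>i\<in>I'. a i * (f i - r i * f i0)) = 0" unfolding lin_dep_def by blast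
    \<comment> \<open>The relation between the reduced vectors is expanded; all multiples of the
      pivot are collected in the coefficient at \<open>i0\<close>.\<close>
    define b where "b i = (if i = i0 then - (\<Sum>i\<in>I'. a i * r i) else a i)" for i
    have "(\<Sum>i\<in>I. b i * f i) = b i0 * f i0 + (\<Sum>i\<in>I'. b i * f i)"
      using i0 insert.prems(1) unfolding I'_def by (simp add: sum.remove)
    also have "(\<Sum>i\<in>I'. b i * f i) = (\<Sum>i\<in>I'. a i * f i)"
      by (intro sum.cong) (auto simp: b_def I'_def)
    also have "b i0 * f i0 + (\<Sum>i\<in>I'. a i * f i) = (\<Sum>i\<in>I'. a i * (f i - r i * f i0))"
      by (simp add: b_def sum_subtractf sum_distrib_right sum_distrib_left algebra_simps)
    finally have "(\<Sum>i\<in>I. b i * f i) = 0" using a(3) by simp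
    moreover have "b i \<in> K" if "i \<in> I" for i
    proof (cases "i = i0")
      case True
      then show ?thesis using a(1) rK unfolding b_def I'_def
        by (auto intro!: subfield_uminus[OF K] subfield_sum[OF K] subfield_mult[OF K])
    qed (use that a(1) in \<open>auto simp: b_def I'_def\<close>)
    moreover have "\<exists>i\<in>I. b i \<noteq> 0" using a(2) unfolding b_def I'_def by auto
    ultimately show ?thesis unfolding lin_dep_def by blast
  qed
qed

lemma lin_dep_solve:
  assumes K: "is_subfield K" and "finite I" "lin_dep K (insert i0 I) f" "\<not> lin_dep K I f" "i0 \<notin> I"
  shows "f i0 \<in> lin_span K I f"
proof -
  obtain c where c: "\<forall>i\<in>insert i0 I. c i \<in> K" "\<exists>i\<in>insert i0 I. c i \<noteq> 0"
    "(\<Sum>i\<in>insert i0 I. c i * f i) = 0" using assms(3) unfolding lin_dep_def by blast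
  have s: "c i0 * f i0 + (\<Sum>i\<in>I. c i * f i) = 0" using c(3) assms by simp
  have "c i0 \<noteq> 0"
  proof
    assume "c i0 = 0"
    then show False using s c assms(4) unfolding lin_dep_def by auto
  qed
  then have "f i0 = (\<Sum>i\<in>I. (- c i / c i0) * f i)"
    using s by (simp add: sum_negf field_simps sum_divide_distrib[symmetric] add_eq_0_iff)
  also have "\<dots> \<in> lin_span K I f"
    using c by (intro lin_spanI subfield_divide[OF K] subfield_uminus[OF K]) auto
  finally show ?thesis .
qed

lemma lin_dep_mono:
  assumes "lin_dep K J f" "J \<subseteq> I" "finite I" "is_subfield L" "K \<subseteq> L"
  shows "lin_dep L I f"
proof -
  obtain c where c: "\<forall>i\<in>J. c i \<in> K" "\<exists>i\<in>J. c i \<noteq> 0" "(\<Sum>i\<in>J. c i * f i) = 0"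
    using assms(1) unfolding lin_dep_def by blast
  have "(\<Sum>i\<in>I. (if i \<in> J then c i else 0) * f i) = (\<Sum>i\<in>J. c i * f i)"
    using assms by (intro sum.mono_neutral_cong_right) auto
  then show ?thesis unfolding lin_dep_def
    using c assms subfield_0[OF assms(4)]
    by (intro exI[of _ "\<lambda>i. if i \<in> J then c i else 0"]) auto
qed

lemma lin_basis_exists:
  assumes K: "is_subfield K" and "finite I"
  obtains J where "J \<subseteq> I" "\<not> lin_dep K J f" "\<And>i. i \<in> I \<Longrightarrow> f i \<in> lin_span K J f"
proof -
  define P where "P J \<longleftrightarrow> J \<subseteq> I \<and> \<not> lin_dep K J f" for J
  have "\<exists>J. P J \<and> (\<forall>J'. P J' \<longrightarrow> card J' \<le> card J)"
  proof (rule ex_has_greatest_nat[where k = "{}" and b = "Suc (card I)"])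
    show "\<forall>J. P J \<longrightarrow> card J < Suc (card I)"
      using assms(2) card_mono unfolding P_def less_Suc_eq_le by blast
    show "P {}" by (simp add: lin_dep_def P_def)
  qed
  then obtain J where J: "J \<subseteq> I" "\<not> lin_dep K J f"
    "\<And>J'. J' \<subseteq> I \<Longrightarrow> \<not> lin_dep K J' f \<Longrightarrow> card J' \<le> card J" unfolding P_def by blast
  have fin: "finite J" using J(1) assms(2) finite_subset by blast
  show ?thesis
  proof (rule that[OF J(1,2)])
    fix i assume i: "i \<in> I"
    show "f i \<in> lin_span K J f"
    proof (cases "i \<in> J")
      case True
      then show ?thesis using lin_span_base[OF K fin] by blast
    next
      case False
      then have "lin_dep K (insert i J) f"
        using J(3)[of "insert i J"] J(1) i fin by (auto)
      then show ?thesis using lin_dep_solve[OF K fin] J(2) False by blast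
    qed
  qed
qed

subsection \<open>The relative algebraic closure\<close>

definition acl :: "'a::field set \<Rightarrow> 'a set" where
  "acl K = {x. algebraic_over K x}"

lemma acl_mono: "K \<subseteq> L \<Longrightarrow> acl K \<subseteq> acl L"
  unfolding acl_def algebraic_over_def by blast

lemma acl_superset:
  assumes K: "is_subfield K" shows "K \<subseteq> acl K"
proof
  fix x assume "x \<in> K"
  then have "[:-x, 1:] \<in> polys_over K" "[:-x, 1:] \<noteq> 0" "poly [:-x, 1:] x = 0"
    by (auto intro!: polys_over_pCons[OF K] polys_over_const[OF K] subfield_uminus[OF K] subfield_1[OF K])
  then show "x \<in> acl K" unfolding acl_def algebraic_over_iff by blast
qed

text \<open>Algebraic elements are those which stabilise a non-zero finite-dimensional space.\<close>

definition stabilises :: "'a::field set \<Rightarrow> 'a set \<Rightarrow> 'a \<Rightarrow> bool" where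
  "stabilises K B x \<longleftrightarrow> (\<forall>b\<in>B. x * b \<in> lin_span K B (\<lambda>b. b))"

lemma stabilises_span:
  assumes K: "is_subfield K" and "stabilises K B x" "y \<in> lin_span K B (\<lambda>b. b)"
  shows "x * y \<in> lin_span K B (\<lambda>b. b)"
proof -
  obtain c where c: "\<And>i. i \<in> B \<Longrightarrow> c i \<in> K" "y = (\<Sum>i\<in>B. c i * i)"
    using lin_spanE[OF assms(3)] by metis
  have "x * y = (\<Sum>i\<in>B. c i * (x * i))" by (simp add: c(2) sum_distrib_left algebra_simps)
  also have "\<dots> \<in> lin_span K B (\<lambda>b. b)"
    using assms(2) c(1) unfolding stabilises_def
    by (intro lin_span_sum[OF K] lin_span_scale[OF K, of "c _"]) auto
  finally show ?thesis .
qed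

lemma stabilises_ring:
  assumes K: "is_subfield K" and B: "finite B"
  shows stabilises_add: "stabilises K B x \<Longrightarrow> stabilises K B y \<Longrightarrow> stabilises K B (x + y)"
    and stabilises_mult: "stabilises K B x \<Longrightarrow> stabilises K B y \<Longrightarrow> stabilises K B (x * y)"
    and stabilises_uminus: "stabilises K B x \<Longrightarrow> stabilises K B (- x)"
proof -
  show "stabilises K B x \<Longrightarrow> stabilises K B y \<Longrightarrow> stabilises K B (x + y)"
    unfolding stabilises_def by (auto simp: distrib_right intro: lin_span_add[OF K])
  show "stabilises K B (x * y)" if "stabilises K B x" "stabilises K B y"
    using stabilises_span[OF K that(1)] that(2) unfolding stabilises_def[of K B y]
    by (auto simp: stabilises_def mult.assoc)
  show "stabilises K B x \<Longrightarrow> stabilises K B (- x)"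
    unfolding stabilises_def by (auto intro: lin_span_uminus[OF K])
qed

text \<open>The \<open>card B + 1\<close> elements \<open>x ^ i * b0\<close> lie in a space spanned
  by \<open>card B\<close> vectors. A dependency between them is an equation for \<open>x\<close>
  once \<open>b0\<close> is cancelled.\<close>

lemma stabilises_imp_acl:
  assumes K: "is_subfield K" and B: "finite B" "b0 \<in> B" "b0 \<noteq> 0" and st: "stabilises K B x"
  shows "x \<in> acl K"
proof -
  have "x ^ i * b0 \<in> lin_span K B (\<lambda>b. b)" for i
    by (induction i) (use stabilises_span[OF K st] lin_span_base[OF K B(1,2), of "\<lambda>b. b"] in \<open>auto simp: mult.assoc\<close>)
  then have "lin_dep K {..card B} (\<lambda>i. x ^ i * b0)"
    using B(1) by (intro lin_dep_pigeonhole[OF K, of B _ _ "\<lambda>b. b"]) auto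
  then obtain c where c: "\<forall>i\<le>card B. c i \<in> K" "\<exists>i\<le>card B. c i \<noteq> 0"
    "(\<Sum>i\<le>card B. c i * (x ^ i * b0)) = 0" unfolding lin_dep_def by auto
  define p where "p = (\<Sum>i\<le>card B. monom (c i) i)"
  have "p \<in> polys_over K" unfolding p_def
    using c(1) by (intro polys_over_sum[OF K] polys_over_monom[OF K]) auto
  moreover have "poly p x * b0 = 0"
    using c(3) by (simp add: p_def poly_sum poly_monom sum_distrib_right mult.assoc)
  moreover have "p \<noteq> 0"
  proof -
    obtain i where i: "i \<le> card B" "c i \<noteq> 0" using c(2) by blast
    have "coeff p i = c i" using i by (simp add: p_def coeff_sum)
    then show ?thesis using i by auto
  qed
  ultimately show ?thesis using B(3) unfolding acl_def algebraic_over_iff by auto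
qed

lemma monic_stabilises:
  assumes K: "is_subfield K" and "p \<in> polys_over K" "lead_coeff p = 1" "poly p x = 0"
  shows "x ^ degree p \<in> lin_span K {..<degree p} (\<lambda>i. x ^ i)"
proof -
  have "0 = (\<Sum>i\<le>degree p. coeff p i * x ^ i)" using assms(4) by (simp add: poly_altdef)
  also have "\<dots> = x ^ degree p + (\<Sum>i<degree p. coeff p i * x ^ i)"
    using assms(3) by (simp add: lessThan_Suc_atMost[symmetric])
  finally have "x ^ degree p = - (\<Sum>i<degree p. coeff p i * x ^ i)" by (simp add: add_eq_0_iff2)
  also have "\<dots> \<in> lin_span K {..<degree p} (\<lambda>i. x ^ i)"
    using polys_overD[OF assms(2)] by (intro lin_span_uminus[OF K] lin_spanI)
  finally show ?thesis .
qed

lemma algebraic_monic: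
  assumes K: "is_subfield K" and "x \<in> acl K"
  obtains p where "p \<in> polys_over K" "lead_coeff p = 1" "poly p x = 0" "degree p > 0"
proof -
  obtain p where p: "p \<in> polys_over K" "p \<noteq> 0" "poly p x = 0"
    using assms unfolding acl_def algebraic_over_iff by blast
  let ?q = "smult (inverse (lead_coeff p)) p"
  have q: "?q \<in> polys_over K" "lead_coeff ?q = 1" "poly ?q x = 0"
    using p by (auto intro!: polys_over_smult[OF K] subfield_inverse[OF K] polys_overD)
  have "degree ?q > 0"
  proof (rule ccontr)
    assume "\<not> degree ?q > 0"
    then obtain c where c: "?q = [:c:]" by (metis degree_eq_zeroE neq0_conv)
    then show False using q(2,3) unfolding c by simp
  qed
  then show ?thesis using that q by blast
qed

lemma stabilises_times:
  assumes K: "is_subfield K" and B: "finite B" "finite C" and st: "stabilises K B x"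
  shows "stabilises K ((\<lambda>(b, c). b * c) ` (B \<times> C)) x"
  unfolding stabilises_def
proof
  fix y assume "y \<in> (\<lambda>(b, c). b * c) ` (B \<times> C)"
  then obtain b c where bc: "b \<in> B" "c \<in> C" "y = b * c" by auto
  have "x * b \<in> lin_span K B (\<lambda>b. b)" using st bc(1) unfolding stabilises_def by blast
  then obtain k where k: "\<And>i. i \<in> B \<Longrightarrow> k i \<in> K" "x * b = (\<Sum>i\<in>B. k i * i)"
    by (rule lin_spanE) blast
  have "x * y = (\<Sum>i\<in>B. k i * (i * c))"
    using k(2) by (simp add: bc(3) mult.assoc[symmetric] sum_distrib_right)
  also have "\<dots> \<in> lin_span K ((\<lambda>(b, c). b * c) ` (B \<times> C)) (\<lambda>b. b)"
    using k(1) bc B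
    by (intro lin_span_sum[OF K] lin_span_scale[OF K] lin_span_base[OF K, of _ _ "\<lambda>b. b"]) auto
  finally show "x * y \<in> lin_span K ((\<lambda>(b, c). b * c) ` (B \<times> C)) (\<lambda>b. b)" .
qed

text \<open>The powers of \<open>x\<close> below the degree of a monic equation will do:
  multiplication by \<open>x\<close> leaves this list only at the top power, which the equation
  rewrites.\<close>

lemma acl_stabilises:
  assumes K: "is_subfield K" and "x \<in> acl K"
  obtains B where "finite B" "1 \<in> B" "stabilises K B x"
proof -
  obtain p where p: "p \<in> polys_over K" "lead_coeff p = 1" "poly p x = 0" "degree p > 0"
    using algebraic_monic[OF assms] by metis
  let ?B = "(\<lambda>i. x ^ i) ` {..<degree p}"
  have "x * x ^ i \<in> lin_span K ?B (\<lambda>b. b)" if i: "i < degree p" for i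
  proof (cases "Suc i < degree p")
    case True
    then have "x ^ Suc i \<in> ?B" by blast
    then show ?thesis using lin_span_base[OF K, of ?B "x ^ Suc i" "\<lambda>b. b"] by auto
  next
    case False
    then have "x * x ^ i = x ^ degree p" using i by (metis Suc_lessI power_Suc)
    then show ?thesis
      using lin_span_trans[OF K order_refl _ monic_stabilises[OF K p(1-3)], of ?B "\<lambda>b. b"]
        lin_span_base[OF K, of ?B _ "\<lambda>b. b"] by auto
  qed
  then have "stabilises K ?B x" unfolding stabilises_def by blast
  moreover have "1 \<in> ?B" using p(4) by (metis imageI lessThan_iff power_0)
  ultimately show ?thesis using that by blast
qed

text \<open>The products of two spanning sets span a space stable under whatever stabilises either
  factor, so one space serves finitely many algebraic elements at once. Containing \<open>1\<close>
  keeps it non-zero.\<close>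

lemma acl_stabilises_finite:
  assumes K: "is_subfield K"
  shows "finite S \<Longrightarrow> S \<subseteq> acl K \<Longrightarrow> \<exists>B. finite B \<and> 1 \<in> B \<and> (\<forall>x\<in>S. stabilises K B x)"
proof (induction S rule: finite_induct)
  case empty
  then show ?case by auto
next
  case (insert x S)
  then obtain B where B: "finite B" "1 \<in> B" "\<forall>x\<in>S. stabilises K B x" by auto
  obtain C where C: "finite C" "1 \<in> C" "stabilises K C x"
    using acl_stabilises[OF K] insert.prems by (metis insert_subset)
  let ?P = "(\<lambda>(b, c). b * c) ` (B \<times> C)"
  have "?P = (\<lambda>(b, c). b * c) ` (C \<times> B)"
    by (auto simp: image_iff mult.commute) (metis mult.commute)+
  then have "stabilises K ?P x" using stabilises_times[OF K C(1) B(1) C(3)] by simp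
  moreover have "\<forall>x\<in>S. stabilises K ?P x" using stabilises_times[OF K B(1) C(1)] B(3) by blast
  moreover have "1 \<in> ?P" using B(2) C(2) by (auto intro!: image_eqI[of _ _ "(1, 1)"])
  ultimately show ?case using B(1) C(1) by (intro exI[of _ ?P]) auto
qed

text \<open>Sums and products act on a common stable space, so no equation for them has to be
  written down; an inverse is a root of the reversed polynomial.\<close>

lemma subfield_acl:
  assumes K: "is_subfield K" shows "is_subfield (acl K)"
proof (rule is_subfieldI)
  show "0 \<in> acl K" "1 \<in> acl K"
    using acl_superset[OF K] subfield_0[OF K] subfield_1[OF K] by auto
next
  fix x y assume "x \<in> acl K" "y \<in> acl K"
  then obtain B where B: "finite B" "1 \<in> B" "stabilises K B x" "stabilises K B y"
    using acl_stabilises_finite[OF K, of "{x, y}"] by auto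
  show "x + y \<in> acl K" "x * y \<in> acl K"
    using stabilises_imp_acl[OF K B(1,2)] B stabilises_add[OF K B(1)] stabilises_mult[OF K B(1)]
    by auto
next
  fix x assume x: "x \<in> acl K"
  then obtain B where B: "finite B" "1 \<in> B" "stabilises K B x"
    using acl_stabilises_finite[OF K, of "{x}"] by auto
  show "- x \<in> acl K"
    using stabilises_imp_acl[OF K B(1,2)] B stabilises_uminus[OF K B(1)] by auto
  show "inverse x \<in> acl K" if "x \<noteq> 0"
  proof -
    obtain p where p: "p \<in> polys_over K" "p \<noteq> 0" "poly p x = 0"
      using x unfolding acl_def algebraic_over_iff by blast
    have "poly (reflect_poly p) (inverse x) = 0"
      using that p by (simp add: poly_reflect_poly_nz)
    moreover have "reflect_poly p \<in> polys_over K"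
      using p subfield_0[OF K] by (auto simp: polys_over_def coeff_reflect_poly)
    moreover have "reflect_poly p \<noteq> 0" using p(2) by simp
    ultimately show ?thesis unfolding acl_def algebraic_over_iff by blast
  qed
qed

text \<open>Let \<open>B\<close> span a space over \<open>K\<close> that is stable under the
  coefficients of a monic equation of \<open>x\<close> over \<open>acl K\<close>. Then the products
  of \<open>B\<close> with the powers of \<open>x\<close> below the degree span a space over
  \<open>K\<close> that is stable under \<open>x\<close>.\<close>

lemma acl_acl:
  assumes K: "is_subfield K" shows "acl (acl K) = acl K"
proof
  show "acl K \<subseteq> acl (acl K)" using acl_superset subfield_acl[OF K] by blast
  show "acl (acl K) \<subseteq> acl K"
  proof
    fix x assume "x \<in> acl (acl K)"
    then obtain p where p: "p \<in> polys_over (acl K)" "lead_coeff p = 1" "poly p x = 0" "degree p > 0"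
      using algebraic_monic[OF subfield_acl[OF K]] by metis
    define d where "d = degree p"
    have "coeff p ` {..d} \<subseteq> acl K" using p(1) by (auto simp: polys_over_def)
    then obtain B where B: "finite B" "1 \<in> B" "\<And>i. i \<le> d \<Longrightarrow> stabilises K B (coeff p i)"
      using acl_stabilises_finite[OF K, of "coeff p ` {..d}"] by auto
    let ?C = "(\<lambda>i. x ^ i) ` {..<d}"
    let ?P = "(\<lambda>(b, c). b * c) ` (B \<times> ?C)"
    have mem: "b * x ^ i \<in> lin_span K ?P (\<lambda>b. b)" if "b \<in> B" "i < d" for b i
      using lin_span_base[OF K, of ?P "b * x ^ i" "\<lambda>b. b"] that B(1) by auto
    have "stabilises K ?P x"
      unfolding stabilises_def
    proof
      fix y assume "y \<in> ?P"
      then obtain b i where bi: "b \<in> B" "i < d" "y = b * x ^ i" by auto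
      show "x * y \<in> lin_span K ?P (\<lambda>b. b)"
      proof (cases "Suc i < d")
        case True
        then show ?thesis using mem[OF bi(1) True] by (simp add: bi(3) algebra_simps)
      next
        case False
        then have d: "d = Suc i" using bi by simp
        have "0 = (\<Sum>j\<le>d. coeff p j * x ^ j)" using p(3) by (simp add: poly_altdef d_def)
        also have "\<dots> = x ^ d + (\<Sum>j<d. coeff p j * x ^ j)"
          using p(2) by (simp add: d_def lessThan_Suc_atMost[symmetric])
        finally have "x ^ d = - (\<Sum>j<d. coeff p j * x ^ j)" by (simp add: add_eq_0_iff2)
        moreover have "x * y = b * x ^ d" using d by (simp add: bi(3) algebra_simps)
        ultimately have "x * y = - (\<Sum>j<d. (coeff p j * b) * x ^ j)"
          by (simp add: sum_distrib_left algebra_simps)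
        also have "\<dots> \<in> lin_span K ?P (\<lambda>b. b)"
        proof (intro lin_span_uminus[OF K] lin_span_sum[OF K])
          fix j assume "j \<in> {..<d}"
          then have "coeff p j * b \<in> lin_span K B (\<lambda>b. b)"
            using B(3)[of j] bi(1) unfolding stabilises_def by auto
          then obtain k where k: "\<And>i. i \<in> B \<Longrightarrow> k i \<in> K" "coeff p j * b = (\<Sum>i\<in>B. k i * i)"
            by (rule lin_spanE) blast
          have "(coeff p j * b) * x ^ j = (\<Sum>i\<in>B. k i * (i * x ^ j))"
            unfolding k(2) by (simp add: sum_distrib_right mult.assoc)
          also have "\<dots> \<in> lin_span K ?P (\<lambda>b. b)"
            using k(1) mem \<open>j \<in> {..<d}\<close>
            by (intro lin_span_sum[OF K] lin_span_scale[OF K, of "k _"]) auto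
          finally show "(coeff p j * b) * x ^ j \<in> lin_span K ?P (\<lambda>b. b)" .
        qed
        finally show ?thesis .
      qed
    qed
    moreover have "1 \<in> ?P" using B(2) p(4) by (auto simp: d_def intro!: image_eqI[of _ _ "(1, x ^ 0)"])
    ultimately show "x \<in> acl K" using stabilises_imp_acl[OF K, of ?P 1 x] B(1) by auto
  qed
qed

lemma acl_imp_poly_inverse:
  assumes K: "is_subfield K" and "z \<in> acl K" "z \<noteq> 0"
  obtains p where "p \<in> polys_over K" "inverse z = poly p z"
proof -
  obtain p where p: "p \<in> polys_over K" "p \<noteq> 0" "poly p z = 0"
    using assms unfolding acl_def algebraic_over_iff by blast
  \<comment> \<open>Factors of the variable are divided out of an equation for \<open>z\<close>,
    which is possible since \<open>z \<noteq> 0\<close>. The constant term can then be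
    inverted.\<close>
  have "\<exists>p\<in>polys_over K. poly p z = 0 \<and> coeff p 0 \<noteq> 0"
    using p
  proof (induction p)
    case 0
    then show ?case by simp
  next
    case (pCons a p)
    show ?case
    proof (cases "a = 0")
      case True
      then have "p \<noteq> 0" "poly p z = 0" using pCons.prems assms(3) by auto
      moreover have "p \<in> polys_over K"
        using pCons.prems(1) unfolding polys_over_def by (auto simp: coeff_pCons split: nat.splits)
      ultimately show ?thesis using pCons.IH by blast
    qed (use pCons.prems in \<open>auto intro!: bexI[of _ "pCons a p"]\<close>)
  qed
  then obtain p where p: "p \<in> polys_over K" "poly p z = 0" "coeff p 0 \<noteq> 0" by blast
  obtain a r where r: "p = pCons a r" by (cases p)
  have rK: "r \<in> polys_over K" "a \<in> K"
    using p(1) unfolding r polys_over_def by (auto simp: coeff_pCons split: nat.splits)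
  have "a + z * poly r z = 0" "a \<noteq> 0" using p r by auto
  then have "inverse z = poly (smult (- inverse a) r) z"
    using assms(3) by (simp add: field_simps add_eq_0_iff)
  then show ?thesis
    using that rK by (blast intro: polys_over_smult[OF K] subfield_uminus[OF K] subfield_inverse[OF K])
qed

text \<open>The inverse of the denominator is a polynomial in the denominator and hence in
  \<open>x\<close>. Having polynomials instead of fractions permits division with remainder in the
  proof of \<open>luroth\<close>.\<close>

lemma field_gen_algebraic_simple:
  assumes K: "is_subfield K" and x: "x \<in> acl K" and "z \<in> field_gen (insert x K)"
  obtains p where "p \<in> polys_over K" "z = poly p x"
proof -
  obtain p q where pq: "p \<in> polys_over K" "q \<in> polys_over K" "poly q x \<noteq> 0" "z = poly p x / poly q x"
    using field_gen_simple[OF K assms(3)] by metis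
  have "poly q x \<in> acl K"
    using polys_over_poly[OF subfield_acl[OF K] _ x] polys_over_mono[OF acl_superset[OF K]] pq(2) by blast
  then obtain r where r: "r \<in> polys_over K" "inverse (poly q x) = poly r (poly q x)"
    using acl_imp_poly_inverse[OF K] pq(3) by metis
  have "pcompose r q \<in> polys_over K"
    using r(1)
  proof (induction r)
    case (pCons a r)
    then have "a \<in> K" "r \<in> polys_over K"
      unfolding polys_over_def by (auto simp: coeff_pCons split: nat.splits)
    then show ?case using pCons pq(2)
      by (auto simp: pcompose_pCons intro!: polys_over_add[OF K] polys_over_mult[OF K] polys_over_const[OF K])
  qed (auto intro: polys_over_0[OF K])
  moreover have "z = poly (p * pcompose r q) x"
    using pq(4) r(2) by (simp add: poly_pcompose divide_inverse)
  ultimately show ?thesis using that polys_over_mult[OF K pq(1)] by blast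
qed

text \<open>Algebraic closure relative to the ambient type. By \<open>cl_superset\<close>,
  \<open>cl_least\<close>, \<open>cl_finitary\<close> and \<open>cl_exchange\<close> it is a matroid
  closure, and the dimension counts below rest on these laws.\<close>

definition cl :: "'a::field set \<Rightarrow> 'a set" where
  "cl S = acl (field_gen S)"

lemma subfield_cl [simp, intro]: "is_subfield (cl S)"
  unfolding cl_def by (rule subfield_acl) blast

lemma field_gen_subset_cl: "field_gen S \<subseteq> cl S"
  unfolding cl_def by (rule acl_superset) blast

lemma cl_superset: "S \<subseteq> cl S"
  using field_gen_subset_cl field_gen_superset by blast

lemma cl_mono: "S \<subseteq> T \<Longrightarrow> cl S \<subseteq> cl T"
  unfolding cl_def by (intro acl_mono field_gen_mono)

lemma cl_incl: "x \<in> S \<Longrightarrow> x \<in> cl S"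
  using cl_superset by blast

lemma cl_least: "S \<subseteq> cl T \<Longrightarrow> cl S \<subseteq> cl T"
proof -
  assume "S \<subseteq> cl T"
  then have "field_gen S \<subseteq> cl T" by (intro field_gen_least) auto
  then have "cl S \<subseteq> acl (cl T)" unfolding cl_def[of S] by (rule acl_mono)
  also have "\<dots> = cl T" unfolding cl_def by (rule acl_acl) blast
  finally show ?thesis .
qed

lemma cl_finitary:
  assumes "x \<in> cl S"
  obtains S0 where "finite S0" "S0 \<subseteq> S" "x \<in> cl S0"
proof -
  obtain p where p: "p \<in> polys_over (field_gen S)" "p \<noteq> 0" "poly p x = 0"
    using assms unfolding cl_def acl_def algebraic_over_iff by blast
  have "\<exists>A. finite A \<and> A \<subseteq> S \<and> coeff p i \<in> field_gen A" for i
    using field_gen_finitary[OF polys_overD[OF p(1)]] by metis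
  then obtain A where A: "\<And>i. finite (A i)" "\<And>i. A i \<subseteq> S" "\<And>i. coeff p i \<in> field_gen (A i)" by metis
  let ?A = "\<Union>i\<le>degree p. A i"
  have "coeff p i \<in> field_gen ?A" for i
  proof (cases "i \<le> degree p")
    case True
    then show ?thesis using A(3)[of i] field_gen_mono[of "A i" ?A] by auto
  qed (simp add: coeff_eq_0 subfield_0)
  then have "p \<in> polys_over (field_gen ?A)" by (simp add: polys_over_def)
  then have "x \<in> cl ?A" using p(2,3) unfolding cl_def acl_def algebraic_over_iff by blast
  then show ?thesis using that[of ?A] A by auto
qed

text \<open>An equation of \<open>y\<close> over \<open>K(x)\<close>, with denominators cleared, is
  a polynomial relation between \<open>x\<close> and \<open>y\<close>; it is reordered by powers of
  \<open>x\<close> and read as an equation of \<open>x\<close> over \<open>K(y)\<close>.\<close>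

lemma cl_exchange:
  assumes "y \<in> cl (insert x S)" "y \<notin> cl S"
  shows "x \<in> cl (insert y S)"
proof -
  define K where "K = field_gen S"
  have K: "is_subfield K" unfolding K_def by blast
  have ins: "field_gen (insert z S) = field_gen (insert z K)" for z
    using field_gen_Un_field_gen[of S "{z}"] unfolding K_def by (simp add: insert_commute)
  obtain p where p: "p \<in> polys_over (field_gen (insert x K))" "p \<noteq> 0" "poly p y = 0"
    using assms(1) unfolding cl_def ins acl_def algebraic_over_iff by blast
  define d where "d = degree p"
  obtain a q where a: "\<And>i. i \<in> {..d} \<Longrightarrow> a i \<in> polys_over K" "q \<in> polys_over K" "poly q x \<noteq> 0"
    "\<And>i. i \<in> {..d} \<Longrightarrow> coeff p i = poly (a i) x / poly q x"
    using field_gen_simple_common[OF K, of "{..d}" "coeff p" x] polys_overD[OF p(1)]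
    by (metis finite_atMost)
  define e where "e = Max (degree ` a ` {..d})"
  have ae: "degree (a i) \<le> e" if "i \<le> d" for i using that unfolding e_def by auto
  define b where "b j = (\<Sum>i\<le>d. monom (coeff (a i) j) i)" for j
  have bK: "b j \<in> polys_over K" for j
    unfolding b_def using a(1) by (intro polys_over_sum[OF K] polys_over_monom[OF K] polys_overD) auto
  have "0 = poly q x * poly p y" using p(3) by simp
  also have "\<dots> = (\<Sum>i\<le>d. poly q x * coeff p i * y ^ i)"
    by (simp add: poly_altdef[of p] d_def sum_distrib_left algebra_simps)
  also have "\<dots> = (\<Sum>i\<le>d. poly (a i) x * y ^ i)"
    using a(3,4) by (intro sum.cong) auto
  also have "\<dots> = (\<Sum>i\<le>d. \<Sum>j\<le>e. coeff (a i) j * x ^ j * y ^ i)"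
  proof (intro sum.cong refl)
    fix i assume "i \<in> {..d}"
    then have "poly (a i) x = (\<Sum>j\<le>e. coeff (a i) j * x ^ j)"
      using ae[of i] by (subst poly_altdef, intro sum.mono_neutral_left) (auto simp: coeff_eq_0)
    then show "poly (a i) x * y ^ i = (\<Sum>j\<le>e. coeff (a i) j * x ^ j * y ^ i)"
      by (simp add: sum_distrib_right)
  qed
  also have "\<dots> = (\<Sum>j\<le>e. \<Sum>i\<le>d. coeff (a i) j * x ^ j * y ^ i)" by (rule sum.swap)
  also have "\<dots> = (\<Sum>j\<le>e. poly (b j) y * x ^ j)"
    by (intro sum.cong refl) (simp add: b_def poly_sum poly_monom sum_distrib_right sum_distrib_left algebra_simps)
  finally have rel: "(\<Sum>j\<le>e. poly (b j) y * x ^ j) = 0" by simp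
  \<comment> \<open>The reordered equation is non-trivial: \<open>y\<close> is transcendental over
    \<open>K\<close>, so if all its coefficients vanished, the polynomials \<open>b j\<close> would
    vanish, and with them \<open>p\<close>.\<close>
  have "\<exists>j\<le>e. poly (b j) y \<noteq> 0"
  proof (rule ccontr)
    assume "\<not> ?thesis"
    then have "b j = 0" if "j \<le> e" for j
      using that bK[of j] assms(2) unfolding cl_def acl_def algebraic_over_iff K_def by blast
    moreover have "coeff (b j) i = coeff (a i) j" if "i \<le> d" for i j
      using that by (simp add: b_def coeff_sum)
    ultimately have "coeff (a i) j = 0" if "i \<le> d" for i j
      using that ae[OF that] by (cases "j \<le> e") (metis coeff_0, simp add: coeff_eq_0)
    then have "coeff p i = 0" if "i \<le> d" for i
      using a(4)[of i] that by (simp add: poly_altdef)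
    then show False using p(2) unfolding d_def by (metis leading_coeff_0_iff order_refl)
  qed
  then obtain j where j: "j \<le> e" "poly (b j) y \<noteq> 0" by blast
  define r where "r = (\<Sum>j\<le>e. monom (poly (b j) y) j)"
  have L: "is_subfield (field_gen (insert y K))" by blast
  have "b j \<in> polys_over (field_gen (insert y K))" for j
    using bK[of j] field_gen_superset[of "insert y K"] polys_over_mono by blast
  then have "r \<in> polys_over (field_gen (insert y K))"
    unfolding r_def
    by (intro polys_over_sum[OF L] polys_over_monom[OF L] polys_over_poly[OF L] field_gen_incl) auto
  moreover have "poly r x = 0" using rel by (simp add: r_def poly_sum poly_monom)
  moreover have "coeff r j = poly (b j) y" using j(1) by (simp add: r_def coeff_sum)
  then have "r \<noteq> 0" using j by auto
  ultimately show ?thesis unfolding cl_def ins acl_def algebraic_over_iff by blast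
qed

subsection \<open>Algebraic independence of sets\<close>

text \<open>Independence in the matroid, for sets rather than families;
  \<open>alg_independent_iff_indep\<close> links it to the definition by vanishing
  polynomials.\<close>

definition indep :: "'a::field set \<Rightarrow> 'a set \<Rightarrow> bool" where
  "indep K S \<longleftrightarrow> (\<forall>x\<in>S. x \<notin> cl (K \<union> (S - {x})))"

lemma indep_empty [simp]: "indep K {}"
  by (simp add: indep_def)

lemma indep_subset: "indep K S \<Longrightarrow> T \<subseteq> S \<Longrightarrow> indep K T"
  unfolding indep_def using cl_mono[of "K \<union> (T - {_})" "K \<union> (S - {_})"] by blast

text \<open>If an old element became dependent through \<open>x\<close>, the exchange law would put
  \<open>x\<close> into the closure of \<open>K\<close> and \<open>S\<close>.\<close>

lemma indep_insert:
  assumes "indep K S" "x \<notin> cl (K \<union> S)"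
  shows "indep K (insert x S)"
  unfolding indep_def
proof
  fix y assume y: "y \<in> insert x S"
  have xS: "x \<notin> S" using assms(2) cl_superset by blast
  show "y \<notin> cl (K \<union> (insert x S - {y}))"
  proof (cases "y = x")
    case True
    then have "insert x S - {y} = S" using xS by auto
    then show ?thesis using assms(2) True by simp
  next
    case False
    then have yS: "y \<in> S" using y by simp
    have eq: "K \<union> (insert x S - {y}) = insert x (K \<union> (S - {y}))" using False by auto
    show ?thesis
    proof
      assume "y \<in> cl (K \<union> (insert x S - {y}))"
      then have "x \<in> cl (insert y (K \<union> (S - {y})))"
        using cl_exchange[of y x] assms(1) yS unfolding eq indep_def by blast
      moreover have "insert y (K \<union> (S - {y})) = K \<union> S" using yS by auto
      ultimately show False using assms(2) by simp
    qed
  qed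
qed

lemma indep_finitary:
  assumes "\<And>T. finite T \<Longrightarrow> T \<subseteq> S \<Longrightarrow> indep K T"
  shows "indep K S"
  unfolding indep_def
proof (intro ballI notI)
  fix x assume x: "x \<in> S" "x \<in> cl (K \<union> (S - {x}))"
  then obtain A where A: "finite A" "A \<subseteq> K \<union> (S - {x})" "x \<in> cl A" by (metis cl_finitary)
  have "indep K (insert x (A \<inter> (S - {x})))" using A x by (intro assms) auto
  moreover have "A \<subseteq> K \<union> (insert x (A \<inter> (S - {x})) - {x})" using A(2) by auto
  ultimately show False using A(3) cl_mono unfolding indep_def by blast
qed

text \<open>A triangular criterion: each element need only avoid the closure of those of smaller
  rank. The elements are adjoined by increasing rank, so that natural-number ranks give a plain
  induction.\<close>

lemma indep_ranked:
  fixes r :: "'i \<Rightarrow> nat"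
  assumes r: "inj_on r I" and x: "\<And>i. i \<in> I \<Longrightarrow> x i \<notin> cl (K \<union> x ` {j \<in> I. r j < r i})"
  shows "indep K (x ` I)" "inj_on x I"
proof -
  show inj: "inj_on x I"
  proof (rule inj_onI)
    have *: "x i \<noteq> x j" if "i \<in> I" "j \<in> I" "r i < r j" for i j
      using x[OF that(2)] that cl_incl[of "x i" "K \<union> x ` {i \<in> I. r i < r j}"] by auto
    fix i j assume ij: "i \<in> I" "j \<in> I" "x i = x j"
    then show "i = j" using *[of i j] *[of j i] inj_onD[OF r] by (metis linorder_neqE_nat)
  qed
  show "indep K (x ` I)"
  proof (rule indep_finitary)
    fix T assume T: "finite T" "T \<subseteq> x ` I"

    have ind: "indep K (x ` {i \<in> I. r i < k})" for k
    proof (induction k)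
      case (Suc k)
      show ?case
      proof (cases "\<exists>i\<in>I. r i = k")
        case True
        then obtain i where i: "i \<in> I" "r i = k" by blast
        then have "{j \<in> I. r j < Suc k} = insert i {j \<in> I. r j < k}"
          using inj_onD[OF r] by (auto simp: less_Suc_eq)
        then show ?thesis using indep_insert[OF Suc x[OF i(1), unfolded i(2)]] by simp
      next
        case False
        then have "{j \<in> I. r j < Suc k} = {j \<in> I. r j < k}" by (auto simp: less_Suc_eq)
        then show ?thesis using Suc by simp
      qed
    qed simp
    obtain J where J: "J \<subseteq> I" "finite J" "T = x ` J" using T by (meson finite_subset_image)
    have "J \<subseteq> {i \<in> I. r i < Suc (Max (r ` J))}" using J by (auto simp: less_Suc_eq_le)
    then show "indep K T" using indep_subset[OF ind] J(3) by blast
  qed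
qed

text \<open>\<open>K\<close> and \<open>Z\<close> lie in the closure of \<open>L\<close>, so an
  element of \<open>B\<close> that depends on them and on the rest of \<open>B\<close> would depend
  on the rest of \<open>B\<close> already over \<open>L\<close>.\<close>

lemma indep_Un:
  assumes "indep K Z" "indep L B" "K \<subseteq> cl L" "Z \<subseteq> cl L" "finite B"
  shows "indep K (Z \<union> B)" "Z \<inter> B = {}"
proof -
  have notin: "b \<notin> cl (K \<union> (Z \<union> B'))" if "insert b B' \<subseteq> B" "b \<notin> B'" for b B'
  proof
    assume b: "b \<in> cl (K \<union> (Z \<union> B'))"
    have "K \<union> (Z \<union> B') \<subseteq> cl (L \<union> (B - {b}))"
      using assms(3,4) that cl_mono[of L "L \<union> (B - {b})"] cl_superset[of "L \<union> (B - {b})"] by blast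
    then have "b \<in> cl (L \<union> (B - {b}))" using b cl_least by blast
    then show False using assms(2) that unfolding indep_def by blast
  qed
  then show "Z \<inter> B = {}" using cl_superset[of "K \<union> (Z \<union> {})"] by blast
  have "B' \<subseteq> B \<Longrightarrow> indep K (Z \<union> B')" if "finite B'" for B'
    using that
  proof (induction B' rule: finite_induct)
    case (insert b B')
    then show ?case using indep_insert[of K "Z \<union> B'" b] notin[of b B'] by auto
  qed (simp add: assms(1))
  then show "indep K (Z \<union> B)" using assms(5) by blast
qed

text \<open>A generator \<open>t\<close> is moved into the base field, which is why \<open>K\<close>
  varies in the induction. Either \<open>S\<close> stays independent over the larger field, or some
  \<open>s\<close> can be exchanged for \<open>t\<close>, and \<open>S\<close> without
  \<open>s\<close> is independent there.\<close>

lemma steinitz: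
  assumes "finite T"
  shows "finite S \<Longrightarrow> indep K S \<Longrightarrow> S \<subseteq> cl (K \<union> T) \<Longrightarrow> card S \<le> card T"
  using assms
proof (induction T arbitrary: S K rule: finite_induct)
  case empty
  have "S = {}"
  proof (rule ccontr)
    assume "S \<noteq> {}"
    then obtain x where x: "x \<in> S" by blast
    then have "x \<in> cl (K \<union> (S - {x}))" using empty.prems(3) cl_mono[of "K \<union> {}" "K \<union> (S - {x})"] by blast
    then show False using empty.prems(2) x unfolding indep_def by blast
  qed
  then show ?case by simp
next
  case (insert t T)
  show ?case
  proof (cases "indep (insert t K) S")
    case True
    moreover have "insert t K \<union> T = K \<union> insert t T" by auto
    ultimately have "card S \<le> card T" using insert.IH[of S "insert t K"] insert.prems by simp
    then show ?thesis using insert.hyps by simp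
  next
    case False
    then obtain s where s: "s \<in> S" "s \<in> cl (insert t K \<union> (S - {s}))" unfolding indep_def by blast
    have eq: "insert t K \<union> (S - {s}) = insert t (K \<union> (S - {s}))" by auto
    have "t \<in> cl (insert s (K \<union> (S - {s})))"
      using cl_exchange[of s t "K \<union> (S - {s})"] s insert.prems(2) unfolding eq indep_def by blast
    moreover have "insert s (K \<union> (S - {s})) = K \<union> S" using s by auto
    ultimately have t: "t \<in> cl (K \<union> S)" by simp
    have ind: "indep (insert t K) (S - {s})"
      unfolding indep_def
    proof (intro ballI notI)
      fix x assume x: "x \<in> S - {s}" "x \<in> cl (insert t K \<union> (S - {s} - {x}))"
      have eq: "insert t K \<union> (S - {s} - {x}) = insert t (K \<union> (S - {s} - {x}))" by auto
      have "x \<notin> cl (K \<union> (S - {s} - {x}))"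
        using insert.prems(2) x cl_mono[of "K \<union> (S - {s} - {x})" "K \<union> (S - {x})"]
        unfolding indep_def by blast
      then have "t \<in> cl (insert x (K \<union> (S - {s} - {x})))" using cl_exchange x(2) unfolding eq by blast
      moreover have "insert x (K \<union> (S - {s} - {x})) = K \<union> (S - {s})" using x by auto
      ultimately have "insert t (K \<union> (S - {s})) \<subseteq> cl (K \<union> (S - {s}))"
        using cl_superset[of "K \<union> (S - {s})"] by auto
      then have "s \<in> cl (K \<union> (S - {s}))" using cl_least s(2)
        by (metis (no_types, lifting) Un_insert_left subsetD)
      then show False using insert.prems(2) s(1) unfolding indep_def by blast
    qed
    have "insert t K \<union> T = K \<union> insert t T" by auto
    then have "card (S - {s}) \<le> card T" using insert.IH[OF _ ind] insert.prems by auto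
    then show ?thesis using insert.hyps insert.prems(1) s(1) by simp
  qed
qed

text \<open>\<open>C\<close> is not assumed finite, since it will be the basis chosen by
  \<open>SOME\<close> in \<open>trdeg\<close>; an infinite one would contain a finite independent
  set larger than \<open>B\<close>.\<close>

lemma indep_cl_card_eq:
  assumes "finite B" "indep K B" "indep K C" "B \<subseteq> cl (K \<union> C)" "C \<subseteq> cl (K \<union> B)"
  shows "card C = card B"
proof -
  have "finite C"
  proof (rule ccontr)
    assume "infinite C"
    then obtain C' where C': "C' \<subseteq> C" "finite C'" "card C' = Suc (card B)"
      using infinite_arbitrarily_large by metis
    then show False
      using steinitz[OF assms(1) C'(2) indep_subset[OF assms(3) C'(1)]] assms(5) by auto
  qed
  then show ?thesis
    using steinitz[OF assms(1) \<open>finite C\<close> assms(3,5)] steinitz[OF \<open>finite C\<close> assms(1,2,4)] by simp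
qed

subsection \<open>Algebraic independence of families and transcendence degree\<close>

definition mono_eval :: "('i \<Rightarrow>\<^sub>0 nat) \<Rightarrow> ('i \<Rightarrow> 'a::field) \<Rightarrow> 'a" where
  "mono_eval e x = (\<Prod>i\<in>Poly_Mapping.keys e. x i ^ Poly_Mapping.lookup e i)"

lemma mono_eval_superset:
  assumes "finite A" "Poly_Mapping.keys e \<subseteq> A"
  shows "mono_eval e x = (\<Prod>i\<in>A. x i ^ Poly_Mapping.lookup e i)"
  unfolding mono_eval_def using assms
  by (intro prod.mono_neutral_left) (auto simp: in_keys_iff)

lemma mono_eval_add: "mono_eval (e + e') x = mono_eval e x * mono_eval e' x"
proof -
  let ?A = "Poly_Mapping.keys e \<union> Poly_Mapping.keys e'"
  have "mono_eval (e + e') x = (\<Prod>i\<in>?A. x i ^ Poly_Mapping.lookup (e + e') i)"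
    by (rule mono_eval_superset) (simp, rule Poly_Mapping.keys_add)
  also have "\<dots> = (\<Prod>i\<in>?A. x i ^ Poly_Mapping.lookup e i) * (\<Prod>i\<in>?A. x i ^ Poly_Mapping.lookup e' i)"
    by (simp add: lookup_add power_add prod.distrib)
  also have "\<dots> = mono_eval e x * mono_eval e' x"
    by (simp add: mono_eval_superset[of ?A])
  finally show ?thesis .
qed

lemma mono_eval_single: "mono_eval (Poly_Mapping.single i k) x = x i ^ k"
  by (subst mono_eval_superset[of "{i}"]) auto

lemma mpoly_eval_alt: "mpoly_eval p x = (\<Sum>e\<in>Poly_Mapping.keys p. Poly_Mapping.lookup p e * mono_eval e x)"
  by (simp add: mpoly_eval_def mono_eval_def)

lemma mpoly_eval_superset:
  assumes "finite A" "Poly_Mapping.keys p \<subseteq> A"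
  shows "mpoly_eval p x = (\<Sum>e\<in>A. Poly_Mapping.lookup p e * mono_eval e x)"
  unfolding mpoly_eval_alt using assms
  by (intro sum.mono_neutral_left) (auto simp: in_keys_iff)

lemma mpoly_eval_0 [simp]: "mpoly_eval 0 x = 0"
  by (simp add: mpoly_eval_def)

lemma mpoly_eval_add: "mpoly_eval (p + q) x = mpoly_eval p x + mpoly_eval q x"
proof -
  let ?A = "Poly_Mapping.keys p \<union> Poly_Mapping.keys q"
  have "mpoly_eval (p + q) x = (\<Sum>e\<in>?A. Poly_Mapping.lookup (p + q) e * mono_eval e x)"
    by (rule mpoly_eval_superset) (simp, rule Poly_Mapping.keys_add)
  also have "\<dots> = mpoly_eval p x + mpoly_eval q x"
    by (simp add: lookup_add distrib_right sum.distrib mpoly_eval_superset[of ?A])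
  finally show ?thesis .
qed

lemma mpoly_eval_sum: "mpoly_eval (sum f I) x = (\<Sum>i\<in>I. mpoly_eval (f i) x)"
  by (induction I rule: infinite_finite_induct) (auto simp: mpoly_eval_add)

lemma mpoly_eval_single: "mpoly_eval (Poly_Mapping.single e c) x = c * mono_eval e x"
  by (subst mpoly_eval_superset[of "{e}"]) auto

lemma poly_mapping_decomp:
  "p = (\<Sum>e\<in>Poly_Mapping.keys p. Poly_Mapping.single e (Poly_Mapping.lookup p e))"
proof (rule poly_mapping_eqI)
  fix k
  have "(\<Sum>e\<in>Poly_Mapping.keys p. Poly_Mapping.lookup p e when e = k) = Poly_Mapping.lookup p k"
    by (simp add: when_def in_keys_iff)
  then show "Poly_Mapping.lookup p k = Poly_Mapping.lookup (\<Sum>e\<in>Poly_Mapping.keys p. Poly_Mapping.single e (Poly_Mapping.lookup p e)) k"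
    by (simp add: lookup_sum lookup_single)
qed

lemma mult_decomp:
  "p * q = (\<Sum>e\<in>Poly_Mapping.keys p. \<Sum>e'\<in>Poly_Mapping.keys q.
      Poly_Mapping.single (e + e') (Poly_Mapping.lookup p e * Poly_Mapping.lookup q e'))"
proof -
  have "p * q = (\<Sum>e\<in>Poly_Mapping.keys p. Poly_Mapping.single e (Poly_Mapping.lookup p e)) *
    (\<Sum>e\<in>Poly_Mapping.keys q. Poly_Mapping.single e (Poly_Mapping.lookup q e))"
    using poly_mapping_decomp[of p] poly_mapping_decomp[of q] by simp
  then show ?thesis by (simp add: sum_product mult_single)
qed

lemma mpoly_eval_mult: "mpoly_eval (p * q) x = mpoly_eval p x * mpoly_eval q x"
  unfolding mult_decomp[of p q] mpoly_eval_sum mpoly_eval_single mono_eval_add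
  unfolding mpoly_eval_alt sum_product by (intro sum.cong refl) simp

definition mpolys_over :: "'a::field set \<Rightarrow> 'i set \<Rightarrow> (('i \<Rightarrow>\<^sub>0 nat) \<Rightarrow>\<^sub>0 'a) set" where
  "mpolys_over K I = {p. (\<forall>e. Poly_Mapping.lookup p e \<in> K) \<and>
     (\<forall>e\<in>Poly_Mapping.keys p. Poly_Mapping.keys e \<subseteq> I)}"

lemma alg_independent_iff:
  "alg_independent K I x \<longleftrightarrow> (\<forall>p\<in>mpolys_over K I. mpoly_eval p x = 0 \<longrightarrow> p = 0)"
  unfolding alg_independent_def mpolys_over_def by blast

lemma mpolys_over_closed:
  assumes K: "is_subfield K"
  shows mpolys_over_0: "0 \<in> mpolys_over K I"
    and mpolys_over_single: "c \<in> K \<Longrightarrow> Poly_Mapping.keys e \<subseteq> I \<Longrightarrow> Poly_Mapping.single e c \<in> mpolys_over K I"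
    and mpolys_over_add: "p \<in> mpolys_over K I \<Longrightarrow> q \<in> mpolys_over K I \<Longrightarrow> p + q \<in> mpolys_over K I"
    and mpolys_over_sum: "(\<And>j. j \<in> J \<Longrightarrow> f j \<in> mpolys_over K I) \<Longrightarrow> sum f J \<in> mpolys_over K I"
proof -
  show 0: "0 \<in> mpolys_over K I" using subfield_0[OF K] by (simp add: mpolys_over_def)
  show s: "c \<in> K \<Longrightarrow> Poly_Mapping.keys e \<subseteq> I \<Longrightarrow> Poly_Mapping.single e c \<in> mpolys_over K I" for c e
    using subfield_0[OF K] by (auto simp: mpolys_over_def lookup_single when_def)
  show a: "p \<in> mpolys_over K I \<Longrightarrow> q \<in> mpolys_over K I \<Longrightarrow> p + q \<in> mpolys_over K I" for p q
    using subfield_add[OF K] subsetD[OF Poly_Mapping.keys_add[of p q]]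
    unfolding mpolys_over_def mem_Collect_eq lookup_add by (metis UnE)
  show "(\<And>j. j \<in> J \<Longrightarrow> f j \<in> mpolys_over K I) \<Longrightarrow> sum f J \<in> mpolys_over K I"
    by (induction J rule: infinite_finite_induct) (auto intro: 0 a)
qed

lemma mpolys_over_mult:
  assumes K: "is_subfield K" and pq: "p \<in> mpolys_over K I" "q \<in> mpolys_over K I"
  shows "p * q \<in> mpolys_over K I"
  unfolding mult_decomp[of p q]
proof (intro mpolys_over_sum[OF K] mpolys_over_single[OF K])
  fix e e' assume e: "e \<in> Poly_Mapping.keys p" "e' \<in> Poly_Mapping.keys q"
  show "Poly_Mapping.lookup p e * Poly_Mapping.lookup q e' \<in> K"
    using pq subfield_mult[OF K] by (auto simp: mpolys_over_def)
  have "Poly_Mapping.keys e \<subseteq> I" "Poly_Mapping.keys e' \<subseteq> I" using pq e by (auto simp: mpolys_over_def)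
  then show "Poly_Mapping.keys (e + e') \<subseteq> I" using Poly_Mapping.keys_add[of e e'] by blast
qed

lemma single_add_cancel:
  fixes e e' :: "'i \<Rightarrow>\<^sub>0 nat"
  assumes "i \<notin> Poly_Mapping.keys e" "i \<notin> Poly_Mapping.keys e'"
    and "e + Poly_Mapping.single i k = e' + Poly_Mapping.single i k'"
  shows "k = k'" "e = e'"
proof -
  have "Poly_Mapping.lookup (e + Poly_Mapping.single i k) i = Poly_Mapping.lookup (e' + Poly_Mapping.single i k') i"
    using assms(3) by simp
  then show "k = k'" using assms(1,2) by (simp add: lookup_add in_keys_iff)
  then show "e = e'" using assms(3) by simp
qed

text \<open>The bridge between vanishing polynomials and the closure operator: a polynomial in the
  variables \<open>insert i I\<close> is a polynomial in the variable \<open>i\<close> over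
  polynomials in the others. In one direction fractional coefficients are cleared, in the other the
  terms are sorted by the exponent of \<open>i\<close>.\<close>

lemma alg_independent_insert:
  assumes K: "is_subfield K" and i: "i \<notin> I"
  shows "alg_independent K (insert i I) x \<longleftrightarrow> alg_independent K I x \<and> x i \<notin> cl (K \<union> x ` I)"
proof
  assume ind: "alg_independent K (insert i I) x"
  have sub: "mpolys_over K I \<subseteq> mpolys_over K (insert i I)" unfolding mpolys_over_def by blast
  then have indI: "alg_independent K I x" using ind unfolding alg_independent_iff by blast
  define S where "S = (\<lambda>p. mpoly_eval p x) ` mpolys_over K I"
  have S: "mpoly_eval p x \<in> S" if "p \<in> mpolys_over K I" for p using that by (auto simp: S_def)
  have SE: "\<exists>p\<in>mpolys_over K I. s = mpoly_eval p x" if "s \<in> S" for s using that by (auto simp: S_def)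
  have S1: "c \<in> S" if "c \<in> K" for c
    using S[OF mpolys_over_single[OF K that, of 0]] by (simp add: mpoly_eval_single mono_eval_def)
  have Sx: "x j \<in> S" if "j \<in> I" for j
    using S[OF mpolys_over_single[OF K subfield_1[OF K], of "Poly_Mapping.single j 1"]] that
    by (simp add: mpoly_eval_single mono_eval_single)
  have Sadd: "a + b \<in> S" and Smult: "a * b \<in> S" if "a \<in> S" "b \<in> S" for a b
    using SE[OF that(1)] SE[OF that(2)] S mpolys_over_add[OF K] mpolys_over_mult[OF K]
    by (metis mpoly_eval_add, metis mpoly_eval_mult)
  have Smin: "- a \<in> S" if "a \<in> S" for a
    using Smult[OF S1[OF subfield_uminus[OF K subfield_1[OF K]]] that] by simp
  have frac: "\<exists>p\<in>S. \<exists>q\<in>S. q \<noteq> 0 \<and> z = p / q" if z: "z \<in> field_gen (K \<union> x ` I)" for z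
    by (rule field_gen_fractions[OF S1[OF subfield_1[OF K]] S1[OF subfield_0[OF K]] Sadd Smult Smin _ z])
      (use S1 Sx in auto)
  have "x i \<notin> cl (K \<union> x ` I)"
  proof
    assume "x i \<in> cl (K \<union> x ` I)"
    then obtain p where p: "p \<in> polys_over (field_gen (K \<union> x ` I))" "p \<noteq> 0" "poly p (x i) = 0"
      unfolding cl_def acl_def algebraic_over_iff by blast
    obtain c q where c: "\<And>k. k \<in> {..degree p} \<Longrightarrow> c k \<in> S" "q \<in> S" "q \<noteq> 0"
      "\<And>k. k \<in> {..degree p} \<Longrightarrow> coeff p k = c k / q"
      using common_denominator[OF S1[OF subfield_1[OF K]] Smult, of "{..degree p}" "coeff p"]
        frac[OF polys_overD[OF p(1)]] by (metis finite_atMost)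
    have "\<exists>P. P \<in> mpolys_over K I \<and> c k = mpoly_eval P x" if "k \<in> {..degree p}" for k
      using SE[OF c(1)[OF that]] by blast
    then obtain P where P: "\<And>k. k \<in> {..degree p} \<Longrightarrow> P k \<in> mpolys_over K I"
      "\<And>k. k \<in> {..degree p} \<Longrightarrow> c k = mpoly_eval (P k) x" by metis
    define Q where "Q = (\<Sum>k\<le>degree p. \<Sum>e\<in>Poly_Mapping.keys (P k).
      Poly_Mapping.single (e + Poly_Mapping.single i k) (Poly_Mapping.lookup (P k) e))"
    have PI: "Poly_Mapping.keys e \<subseteq> I" if "k \<le> degree p" "e \<in> Poly_Mapping.keys (P k)" for k e
      using P(1)[of k] that unfolding mpolys_over_def by auto
    have PK: "Poly_Mapping.lookup (P k) e \<in> K" if "k \<le> degree p" for k e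
      using P(1)[of k] that unfolding mpolys_over_def by auto
    have "Q \<in> mpolys_over K (insert i I)"
      unfolding Q_def
    proof (intro mpolys_over_sum[OF K] mpolys_over_single[OF K])
      fix k e assume k: "k \<in> {..degree p}" and e: "e \<in> Poly_Mapping.keys (P k)"
      show "Poly_Mapping.lookup (P k) e \<in> K" using PK k by auto
      show "Poly_Mapping.keys (e + Poly_Mapping.single i k) \<subseteq> insert i I"
        using Poly_Mapping.keys_add[of e "Poly_Mapping.single i k"] PI[of k e] k e
        by (auto split: if_splits)
    qed
    moreover have "mpoly_eval Q x = 0"
    proof -
      have "mpoly_eval Q x = (\<Sum>k\<le>degree p. c k * x i ^ k)"
        unfolding Q_def mpoly_eval_sum mpoly_eval_single mono_eval_add mono_eval_single
        by (intro sum.cong refl) (simp add: P(2) mpoly_eval_alt sum_distrib_right mult.assoc)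
      also have "\<dots> = (\<Sum>k\<le>degree p. q * coeff p k * x i ^ k)"
        using c(3,4) by (intro sum.cong) auto
      also have "\<dots> = q * poly p (x i)" by (simp add: poly_altdef sum_distrib_left mult.assoc)
      finally show ?thesis using p(3) by simp
    qed
    ultimately have Q0: "Q = 0" using ind unfolding alg_independent_iff by blast
    have "P k = 0" if k: "k \<le> degree p" for k
    proof (rule ccontr)
      assume "P k \<noteq> 0"
      then obtain e where e: "e \<in> Poly_Mapping.keys (P k)" by (metis all_not_in_conv keys_eq_empty)
      have "Poly_Mapping.lookup Q (e + Poly_Mapping.single i k) =
        (\<Sum>k'\<le>degree p. \<Sum>e'\<in>Poly_Mapping.keys (P k').
          if k' = k \<and> e' = e then Poly_Mapping.lookup (P k) e else 0)"
        unfolding Q_def lookup_sum lookup_single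
      proof (intro sum.cong refl)
        fix k' e' assume "k' \<in> {..degree p}" "e' \<in> Poly_Mapping.keys (P k')"
        then have "i \<notin> Poly_Mapping.keys e'" "i \<notin> Poly_Mapping.keys e" using PI i e k by blast+
        then show "(Poly_Mapping.lookup (P k') e' when e' + Poly_Mapping.single i k' = e + Poly_Mapping.single i k)
          = (if k' = k \<and> e' = e then Poly_Mapping.lookup (P k) e else 0)"
          using single_add_cancel[of i e' e k' k] by (auto simp: when_def)
      qed
      also have "\<dots> = (\<Sum>k'\<le>degree p. if k' = k then Poly_Mapping.lookup (P k) e else 0)"
        using e by (intro sum.cong refl) (auto)
      also have "\<dots> = Poly_Mapping.lookup (P k) e" using k by simp
      finally show False using Q0 e by (simp add: in_keys_iff)
    qed
    then have "coeff p k = 0" if "k \<le> degree p" for k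
      using c(4)[of k] P(2)[of k] that by simp
    then show False using p(2) by (metis leading_coeff_0_iff order_refl)
  qed
  then show "alg_independent K I x \<and> x i \<notin> cl (K \<union> x ` I)" using indI by blast
next
  assume asm: "alg_independent K I x \<and> x i \<notin> cl (K \<union> x ` I)"
  show "alg_independent K (insert i I) x"
    unfolding alg_independent_iff
  proof (intro ballI impI)
    fix p assume p: "p \<in> mpolys_over K (insert i I)" "mpoly_eval p x = 0"
    \<comment> \<open>The exponent vector with the variable \<open>i\<close> removed. It determines
      \<open>e\<close> once the exponent of \<open>i\<close> is fixed, so distinct terms are not
      merged in \<open>P k\<close>.\<close>
    define r where "r e = e - Poly_Mapping.single i (Poly_Mapping.lookup e i)" for e :: "_ \<Rightarrow>\<^sub>0 nat"
    have r: "e = r e + Poly_Mapping.single i (Poly_Mapping.lookup e i)" for e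
      unfolding r_def by (rule poly_mapping_eqI) (auto simp: lookup_add lookup_minus lookup_single when_def)
    define A where "A k = {e \<in> Poly_Mapping.keys p. Poly_Mapping.lookup e i = k}" for k
    have finA: "finite (A k)" for k unfolding A_def by simp
    define P where "P k = (\<Sum>e\<in>A k. Poly_Mapping.single (r e) (Poly_Mapping.lookup p e))" for k
    have PM: "P k \<in> mpolys_over K I" for k
      unfolding P_def
    proof (intro mpolys_over_sum[OF K] mpolys_over_single[OF K])
      fix e assume e: "e \<in> A k"
      show "Poly_Mapping.lookup p e \<in> K" using p unfolding mpolys_over_def by auto
      have "Poly_Mapping.keys e \<subseteq> insert i I" using p e unfolding mpolys_over_def A_def by auto
      then show "Poly_Mapping.keys (r e) \<subseteq> I"
        by (auto simp: r_def in_keys_iff lookup_minus lookup_single when_def subset_iff split: if_splits)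
    qed
    define N where "N = Max ((\<lambda>e. Poly_Mapping.lookup e i) ` Poly_Mapping.keys p)"
    have N: "Poly_Mapping.lookup e i \<le> N" if "e \<in> Poly_Mapping.keys p" for e
      using that unfolding N_def by (auto intro: Max_ge)
    define q where "q = (\<Sum>k\<le>N. monom (mpoly_eval (P k) x) k)"
    have F: "is_subfield (field_gen (K \<union> x ` I))" by blast
    have "mpoly_eval (P k) x \<in> field_gen (K \<union> x ` I)" for k
      unfolding mpoly_eval_def
    proof (intro subfield_sum[OF F] subfield_mult[OF F] subfield_prod[OF F] subfield_power[OF F])
      show "Poly_Mapping.lookup (P k) e \<in> field_gen (K \<union> x ` I)" for e
        using PM[of k] by (intro field_gen_incl) (auto simp: mpolys_over_def)
      show "x j \<in> field_gen (K \<union> x ` I)" if "e \<in> Poly_Mapping.keys (P k)" "j \<in> Poly_Mapping.keys e" for e j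
        using PM[of k] that by (intro field_gen_incl) (auto simp: mpolys_over_def)
    qed
    then have "q \<in> polys_over (field_gen (K \<union> x ` I))"
      unfolding q_def by (intro polys_over_sum[OF F] polys_over_monom[OF F])
    moreover have "poly q (x i) = 0"
    proof -
      have "poly q (x i) = (\<Sum>k\<le>N. \<Sum>e\<in>A k. Poly_Mapping.lookup p e * mono_eval e x)"
        unfolding q_def P_def poly_sum poly_monom mpoly_eval_sum mpoly_eval_single sum_distrib_right
      proof (intro sum.cong refl)
        fix k e assume "e \<in> A k"
        then have "e = r e + Poly_Mapping.single i k" using r[of e] unfolding A_def by simp
        then have "mono_eval e x = mono_eval (r e) x * x i ^ k"
          by (metis mono_eval_add mono_eval_single)
        then show "Poly_Mapping.lookup p e * mono_eval (r e) x * x i ^ k = Poly_Mapping.lookup p e * mono_eval e x"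
          by simp
      qed
      also have "\<dots> = (\<Sum>e\<in>(\<Union>k\<le>N. A k). Poly_Mapping.lookup p e * mono_eval e x)"
        by (subst sum.UNION_disjoint) (auto simp: A_def)
      also have "(\<Union>k\<le>N. A k) = Poly_Mapping.keys p" using N by (auto simp: A_def)
      finally show ?thesis using p(2) by (simp add: mpoly_eval_alt)
    qed
    ultimately have "q = 0" using asm unfolding cl_def acl_def algebraic_over_iff by blast
    have "P k = 0" if "k \<le> N" for k
    proof -
      have "coeff q k = mpoly_eval (P k) x" using that by (simp add: q_def coeff_sum)
      then show ?thesis using asm PM[of k] \<open>q = 0\<close> unfolding alg_independent_iff by simp
    qed
    show "p = 0"
    proof (rule ccontr)
      assume "p \<noteq> 0"
      then obtain e where e: "e \<in> Poly_Mapping.keys p" by (metis all_not_in_conv keys_eq_empty)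
      define k where "k = Poly_Mapping.lookup e i"
      have eA: "e \<in> A k" using e by (simp add: A_def k_def)
      have "Poly_Mapping.lookup (P k) (r e) = (\<Sum>e'\<in>A k. if e' = e then Poly_Mapping.lookup p e else 0)"
        unfolding P_def lookup_sum lookup_single
      proof (intro sum.cong refl)
        fix e' assume "e' \<in> A k"
        then have "r e' = r e \<longleftrightarrow> e' = e" using r[of e] r[of e'] eA unfolding A_def
          by (metis (mono_tags, lifting) mem_Collect_eq)
        then show "(Poly_Mapping.lookup p e' when r e' = r e) = (if e' = e then Poly_Mapping.lookup p e else 0)"
          by (auto simp: when_def)
      qed
      also have "\<dots> = Poly_Mapping.lookup p e" using eA finA by simp
      finally show False using \<open>\<And>k. k \<le> N \<Longrightarrow> P k = 0\<close>[of k] N[OF e] e by (simp add: k_def in_keys_iff)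
    qed
  qed
qed

lemma alg_independent_finitary:
  "alg_independent K I x \<longleftrightarrow> (\<forall>J. finite J \<and> J \<subseteq> I \<longrightarrow> alg_independent K J x)"
proof
  show "alg_independent K I x \<Longrightarrow> \<forall>J. finite J \<and> J \<subseteq> I \<longrightarrow> alg_independent K J x"
    unfolding alg_independent_def by (meson order_trans)
  assume *: "\<forall>J. finite J \<and> J \<subseteq> I \<longrightarrow> alg_independent K J x"
  show "alg_independent K I x"
    unfolding alg_independent_iff
  proof (intro ballI impI)
    fix p assume p: "p \<in> mpolys_over K I" "mpoly_eval p x = 0"
    let ?J = "\<Union>e\<in>Poly_Mapping.keys p. Poly_Mapping.keys e"
    have "finite ?J" by simp
    moreover have "?J \<subseteq> I" using p unfolding mpolys_over_def by auto
    ultimately have "alg_independent K ?J x" using * by blast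
    moreover have "p \<in> mpolys_over K ?J" using p unfolding mpolys_over_def by auto
    ultimately show "p = 0" using p(2) unfolding alg_independent_iff by blast
  qed
qed

text \<open>Both sides are determined by finite subfamilies, where
  \<open>alg_independent_insert\<close> adds one index at a time. Injectivity appears because equal
  values at two indices already violate independence of a family.\<close>

lemma alg_independent_iff_indep:
  assumes K: "is_subfield K"
  shows "alg_independent K I x \<longleftrightarrow> inj_on x I \<and> indep K (x ` I)"
proof -
  have fin: "alg_independent K J x \<longleftrightarrow> inj_on x J \<and> indep K (x ` J)" if "finite J" for J
    using that
  proof (induction J rule: finite_induct)
    case empty
    have "alg_independent K {} x"
      unfolding alg_independent_iff
    proof (intro ballI impI)
      fix p assume p: "p \<in> mpolys_over K {}" "mpoly_eval p x = 0"
      then have sub: "Poly_Mapping.keys p \<subseteq> {0}" unfolding mpolys_over_def by auto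
      then have "mpoly_eval p x = Poly_Mapping.lookup p 0"
        by (subst mpoly_eval_superset[of "{0}"]) (auto simp: mono_eval_def)
      then have "0 \<notin> Poly_Mapping.keys p" using p(2) by (simp add: in_keys_iff)
      then have "Poly_Mapping.keys p = {}" using sub by blast
      then show "p = 0" using keys_eq_empty by blast
    qed
    then show ?case by simp
  next
    case (insert i J)
    have "x i \<notin> cl (K \<union> x ` J) \<Longrightarrow> x i \<notin> x ` J" using cl_superset[of "K \<union> x ` J"] by blast
    moreover have "x i \<notin> cl (K \<union> x ` J)" if "x i \<notin> x ` J" "indep K (x ` insert i J)"
    proof -
      have "x ` insert i J - {x i} = x ` J" using that(1) by auto
      then show ?thesis using that(2) unfolding indep_def by auto
    qed
    moreover have "indep K (x ` insert i J) \<Longrightarrow> indep K (x ` J)" by (rule indep_subset) auto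
    ultimately show ?case
      unfolding alg_independent_insert[OF K insert.hyps(2)] insert.IH
      using indep_insert[of K "x ` J" "x i"] insert.hyps(2) by auto
  qed
  show ?thesis
  proof
    assume a: "alg_independent K I x"
    show "inj_on x I \<and> indep K (x ` I)"
    proof
      show "inj_on x I"
      proof (rule inj_onI)
        fix i j assume ij: "i \<in> I" "j \<in> I" "x i = x j"
        then have "alg_independent K {i, j} x"
          using a unfolding alg_independent_def by (metis insert_subset empty_subsetI order_trans)
        then have "inj_on x {i, j}" using fin[of "{i, j}"] by blast
        then show "i = j" using ij(3) by (rule inj_onD) auto
      qed
      show "indep K (x ` I)"
      proof (rule indep_finitary)
        fix T assume "finite T" "T \<subseteq> x ` I"
        then obtain J where "J \<subseteq> I" "finite J" "T = x ` J" by (meson finite_subset_image)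
        then show "indep K T" using iffD1[OF alg_independent_finitary a, rule_format, of J] fin[of J]
          by simp
      qed
    qed
  next
    assume a: "inj_on x I \<and> indep K (x ` I)"
    show "alg_independent K I x"
    proof (rule iffD2[OF alg_independent_finitary], intro allI impI)
      fix J assume J: "finite J \<and> J \<subseteq> I"
      then show "alg_independent K J x"
        using a fin[of J] inj_on_subset[of x I J] indep_subset[of K "x ` I" "x ` J"] by auto
    qed
  qed
qed

lemma trdeg_eq_card:
  assumes K: "is_subfield K" and B: "finite B" "indep K B" "B \<subseteq> L" "L \<subseteq> cl (K \<union> B)"
  shows "trdeg K L = card B"
proof -
  have iff: "transcendence_basis K L C \<longleftrightarrow> C \<subseteq> L \<and> indep K C \<and> L \<subseteq> cl (K \<union> C)" for C
    unfolding transcendence_basis_def alg_independent_iff_indep[OF K] cl_def acl_def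
    by (simp add: subset_iff Ball_def)
  define C where "C = (SOME B. transcendence_basis K L B)"
  have "transcendence_basis K L B" using B unfolding iff by simp
  then have "transcendence_basis K L C" unfolding C_def by (rule someI)
  then have C: "C \<subseteq> L" "indep K C" "L \<subseteq> cl (K \<union> C)" unfolding iff by simp_all
  have "card C = card B"
    using B(3,4) C(1,3) by (intro indep_cl_card_eq[OF B(1,2) C(2)]) (rule order_trans; assumption)+
  then show ?thesis unfolding trdeg_def C_def .
qed

subsection \<open>Simple extensions\<close>

lemma acl_not_poly_root:
  "x \<notin> acl K \<Longrightarrow> p \<in> polys_over K \<Longrightarrow> poly p x = 0 \<Longrightarrow> p = 0"
  unfolding acl_def algebraic_over_iff by blast

lemma acl_poly_root:
  "p \<in> polys_over K \<Longrightarrow> p \<noteq> 0 \<Longrightarrow> poly p x = 0 \<Longrightarrow> x \<in> acl K"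
  unfolding acl_def algebraic_over_iff by blast

lemma smult_eq_imp_mem:
  assumes K: "is_subfield K" and "p \<in> polys_over K" "q \<in> polys_over K" "q \<noteq> 0" "p = smult c q"
  shows "c \<in> K"
proof -
  have "lead_coeff q \<noteq> 0" using assms(4) by simp
  then have "c = coeff p (degree q) / lead_coeff q" using assms(5) by simp
  then show ?thesis using subfield_divide[OF K polys_overD[OF assms(2)] polys_overD[OF assms(3)]] by simp
qed

text \<open>If \<open>c = p(x) / q(x)\<close>, then \<open>x\<close> is a root of
  \<open>p - c q\<close>. This polynomial is non-zero, since otherwise \<open>c\<close> would be a
  quotient of coefficients in \<open>K\<close>.\<close>

lemma acl_of_nonconstant:
  assumes K: "is_subfield K" and c: "c \<in> field_gen (insert x K)" "c \<notin> K"
  shows "x \<in> cl (insert c K)"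
proof -
  obtain p q where pq: "p \<in> polys_over K" "q \<in> polys_over K" "poly q x \<noteq> 0" "c = poly p x / poly q x"
    using field_gen_simple[OF K c(1)] by metis
  let ?L = "field_gen (insert c K)"
  have L: "is_subfield ?L" by blast
  have "K \<subseteq> ?L" using field_gen_superset[of "insert c K"] by blast
  then have "p - smult c q \<in> polys_over ?L"
    using pq(1,2) polys_over_mono[of K ?L]
    by (intro polys_over_diff[OF L] polys_over_smult[OF L] field_gen_incl) auto
  moreover have "poly (p - smult c q) x = 0" using pq(3,4) by simp
  moreover have "p - smult c q \<noteq> 0"
  proof
    assume "p - smult c q = 0"
    then have "p = smult c q" by simp
    moreover have "q \<noteq> 0" using pq(3) by auto
    ultimately show False using smult_eq_imp_mem[OF K pq(1,2)] c(2) by blast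
  qed
  ultimately show ?thesis unfolding cl_def by (intro acl_poly_root)
qed

text \<open>Writing \<open>g = p(y) / q(y)\<close>, the polynomial \<open>p - g q\<close> over
  \<open>Q\<close> vanishes at the transcendental \<open>y\<close>, so \<open>g\<close> is a
  quotient of coefficients in \<open>P\<close>. This removes variables one at a time in
  \<open>G_generated\<close>.\<close>

lemma mem_of_transcendental_extension:
  assumes P: "is_subfield P" and Q: "is_subfield Q" and "P \<subseteq> Q" "y \<notin> acl Q" "g \<in> Q"
    and "g \<in> field_gen (insert y P)"
  shows "g \<in> P"
proof -
  obtain p q where pq: "p \<in> polys_over P" "q \<in> polys_over P" "poly q y \<noteq> 0" "g = poly p y / poly q y"
    using field_gen_simple[OF P assms(6)] by metis
  have "p - smult g q \<in> polys_over Q"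
    using pq(1,2) polys_over_mono[OF assms(3)] assms(5)
    by (intro polys_over_diff[OF Q] polys_over_smult[OF Q]) auto
  moreover have "poly (p - smult g q) y = 0" using pq(3,4) by simp
  ultimately have "p = smult g q" using acl_not_poly_root[OF assms(4)] by fastforce
  moreover have "q \<noteq> 0" using pq(3) by auto
  ultimately show ?thesis using smult_eq_imp_mem[OF P pq(1,2)] by blast
qed

section \<open>Division with remainder and minimal polynomials over a subfield\<close>

lemma polys_over_division:
  assumes K: "is_subfield K" and g: "g \<in> polys_over K" "g \<noteq> 0"
  shows "f \<in> polys_over K \<Longrightarrow> \<exists>q\<in>polys_over K. f - g * q = 0 \<or> degree (f - g * q) < degree g"
proof (induction "degree f" arbitrary: f rule: less_induct)
  case less
  show ?case
  proof (cases "f = 0 \<or> degree f < degree g")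
    case True
    then show ?thesis using polys_over_0[OF K] by (intro bexI[of _ 0]) auto
  next
    case False
    define c where "c = lead_coeff f / lead_coeff g"
    define h where "h = monom c (degree f - degree g)"
    have h: "h \<in> polys_over K" unfolding h_def c_def
      by (intro polys_over_monom[OF K] subfield_divide[OF K] polys_overD less.prems g)
    have "c \<noteq> 0" using False g by (auto simp: c_def)
    have dgh: "degree (g * h) = degree f"
      using g(2) False \<open>c \<noteq> 0\<close> by (simp add: h_def degree_mult_eq degree_monom_eq)
    have "lead_coeff (g * h) = lead_coeff f"
      using g(2) \<open>c \<noteq> 0\<close> unfolding lead_coeff_mult h_def by (simp add: degree_monom_eq) (simp add: c_def)
    then have lc: "coeff (f - g * h) (degree f) = 0" using dgh by simp
    have le: "degree (f - g * h) \<le> degree f" using dgh by (metis degree_diff_le order_refl)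
    have fK: "f - g * h \<in> polys_over K" using less.prems g h
      by (intro polys_over_diff[OF K] polys_over_mult[OF K])
    show ?thesis
    proof (cases "f - g * h = 0")
      case True
      then show ?thesis using h by blast
    next
      case False
      then have "degree (f - g * h) < degree f" using le lc by (metis le_neq_implies_less leading_coeff_0_iff)
      then obtain q where q: "q \<in> polys_over K"
        "f - g * h - g * q = 0 \<or> degree (f - g * h - g * q) < degree g"
        using less.hyps fK by blast
      then show ?thesis using h by (intro bexI[of _ "h + q"]) (auto simp: algebra_simps intro: polys_over_add[OF K])
    qed
  qed
qed

lemma minimal_polynomial:
  assumes K: "is_subfield K" and "x \<in> acl K"
  obtains p where "p \<in> polys_over K" "lead_coeff p = 1" "degree p > 0" "poly p x = 0"
    "\<And>q. q \<in> polys_over K \<Longrightarrow> poly q x = 0 \<Longrightarrow> degree q < degree p \<Longrightarrow> q = 0"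
    "\<And>q. q \<in> polys_over K \<Longrightarrow> poly q x = 0 \<Longrightarrow> \<exists>r\<in>polys_over K. q = p * r"
proof -
  let ?P = "\<lambda>p. p \<in> polys_over K \<and> lead_coeff p = 1 \<and> poly p x = 0 \<and> degree p > 0"
  obtain p0 where "?P p0" using algebraic_monic[OF assms] by metis
  then obtain p where p: "?P p" "\<And>q. ?P q \<Longrightarrow> degree p \<le> degree q"
    using ex_has_least_nat[of ?P p0 degree] by blast
  have min: "q = 0" if q: "q \<in> polys_over K" "poly q x = 0" "degree q < degree p" for q
  proof (rule ccontr)
    assume "q \<noteq> 0"
    let ?q = "smult (inverse (lead_coeff q)) q"
    have "?q \<in> polys_over K" using q(1) by (intro polys_over_smult[OF K] subfield_inverse[OF K] polys_overD)
    moreover have "lead_coeff ?q = 1" "poly ?q x = 0" "degree ?q = degree q" using \<open>q \<noteq> 0\<close> q by auto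
    moreover have "degree q > 0"
    proof (rule ccontr)
      assume "\<not> degree q > 0"
      then obtain c where "q = [:c:]" by (metis degree_eq_zeroE neq0_conv)
      then show False using q(2) \<open>q \<noteq> 0\<close> by simp
    qed
    ultimately show False using p(2)[of ?q] q(3) by auto
  qed
  show ?thesis
  proof (rule that[of p])
    show "p \<in> polys_over K" "lead_coeff p = 1" "degree p > 0" "poly p x = 0" using p by auto
    show "q = 0" if "q \<in> polys_over K" "poly q x = 0" "degree q < degree p" for q using min that by blast
    fix q assume q: "q \<in> polys_over K" "poly q x = 0"
    have "p \<noteq> 0" using p(1) by auto
    then obtain r where r: "r \<in> polys_over K" "q - p * r = 0 \<or> degree (q - p * r) < degree p"
      using polys_over_division[OF K _ _ q(1), of p] p(1) by blast
    have "q - p * r \<in> polys_over K" using q r p(1) by (intro polys_over_diff[OF K] polys_over_mult[OF K]) auto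
    moreover have "poly (q - p * r) x = 0" using q p(1) by simp
    ultimately have "q - p * r = 0" using min r(2) by blast
    then show "\<exists>r\<in>polys_over K. q = p * r" using r(1) by (auto intro!: bexI[of _ r])
  qed
qed

subsection \<open>Derivations and algebraic elements\<close>

text \<open>Relative to a subfield and with values anywhere, because the partial derivative at a
  leader will be a derivation only on the field generated by the derivatives up to that
  leader.\<close>

definition deriv_on :: "'a::field set \<Rightarrow> ('a \<Rightarrow> 'a) \<Rightarrow> bool" where
  "deriv_on K d \<longleftrightarrow> (\<forall>x\<in>K. \<forall>y\<in>K. d (x + y) = d x + d y \<and> d (x * y) = d x * y + x * d y)"

lemma deriv_on_subset: "deriv_on L d \<Longrightarrow> K \<subseteq> L \<Longrightarrow> deriv_on K d"
  unfolding deriv_on_def by blast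

lemma deriv_on_rules:
  assumes K: "is_subfield K" and d: "deriv_on K d"
  shows deriv_on_add: "x \<in> K \<Longrightarrow> y \<in> K \<Longrightarrow> d (x + y) = d x + d y"
    and deriv_on_mult: "x \<in> K \<Longrightarrow> y \<in> K \<Longrightarrow> d (x * y) = d x * y + x * d y"
    and deriv_on_0: "d 0 = 0" and deriv_on_1: "d 1 = 0"
    and deriv_on_uminus: "x \<in> K \<Longrightarrow> d (- x) = - d x"
    and deriv_on_inverse: "x \<in> K \<Longrightarrow> x \<noteq> 0 \<Longrightarrow> d (inverse x) = - d x * inverse x * inverse x"
    and deriv_on_diff: "x \<in> K \<Longrightarrow> y \<in> K \<Longrightarrow> d (x - y) = d x - d y"
    and deriv_on_sum: "(\<And>i. i \<in> I \<Longrightarrow> f i \<in> K) \<Longrightarrow> d (sum f I) = (\<Sum>i\<in>I. d (f i))"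
    and deriv_on_of_nat: "d (of_nat n) = 0"
    and deriv_on_poly: "p \<in> polys_over K \<Longrightarrow> x \<in> K \<Longrightarrow>
      d (poly p x) = poly (map_poly d p) x + poly (pderiv p) x * d x"
proof -
  show a: "x \<in> K \<Longrightarrow> y \<in> K \<Longrightarrow> d (x + y) = d x + d y"
    and m: "x \<in> K \<Longrightarrow> y \<in> K \<Longrightarrow> d (x * y) = d x * y + x * d y" for x y
    using d unfolding deriv_on_def by auto
  show 0: "d 0 = 0" using a[of 0 0] subfield_0[OF K] by (simp only: add_0 add_cancel_right_right)
  show 1: "d 1 = 0" using m[of 1 1] subfield_1[OF K] by (simp only: mult_1 mult_1_right add_cancel_right_right)
  show u: "x \<in> K \<Longrightarrow> d (- x) = - d x" for x
    using a[of x "- x"] subfield_uminus[OF K, of x] 0 by (simp add: add_eq_0_iff)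
  show "d (inverse x) = - d x * inverse x * inverse x" if "x \<in> K" "x \<noteq> 0"
  proof -
    have "d x * inverse x + x * d (inverse x) = 0"
      using m[of x "inverse x"] subfield_inverse[OF K, of x] that 1 by simp
    then show ?thesis using that(2) by (simp add: field_simps add_eq_0_iff)
  qed
  show "x \<in> K \<Longrightarrow> y \<in> K \<Longrightarrow> d (x - y) = d x - d y"
    using a[of x "- y"] subfield_uminus[OF K, of y] u by simp
  show "(\<And>i. i \<in> I \<Longrightarrow> f i \<in> K) \<Longrightarrow> d (sum f I) = (\<Sum>i\<in>I. d (f i))"
    by (induction I rule: infinite_finite_induct) (auto simp: 0 a subfield_sum[OF K])
  show "d (of_nat n) = 0"
    by (induction n) (auto simp: 0 1 a subfield_of_nat[OF K] subfield_1[OF K])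
  show "p \<in> polys_over K \<Longrightarrow> x \<in> K \<Longrightarrow>
      d (poly p x) = poly (map_poly d p) x + poly (pderiv p) x * d x"
  proof (induction p)
    case (pCons c p)
    then have c: "c \<in> K" "p \<in> polys_over K"
      unfolding polys_over_def by (auto simp: coeff_pCons split: nat.splits)
    have pK: "poly p x \<in> K" using c pCons.prems polys_over_poly[OF K] by blast
    have "d (poly (pCons c p) x) = d c + (d x * poly p x + x * d (poly p x))"
      using c pCons.prems pK by (simp add: a m subfield_mult[OF K])
    also have "d (poly p x) = poly (map_poly d p) x + poly (pderiv p) x * d x"
      using pCons.IH c pCons.prems by blast
    finally show ?case using 0 by (simp add: map_poly_pCons pderiv_pCons algebra_simps)
  qed (simp add: 0)
qed

lemma derivation_deriv_on: "derivation d \<Longrightarrow> deriv_on K d"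
  unfolding derivation_def deriv_on_def by blast

text \<open>The derivative of the minimal polynomial has smaller degree and, in characteristic
  \<open>0\<close>, is not zero, so it cannot vanish at \<open>x\<close>.\<close>

lemma acl_separable:
  fixes x :: "'a::field_char_0"
  assumes K: "is_subfield K" and "x \<in> acl K"
  obtains p where "p \<in> polys_over K" "poly p x = 0" "poly (pderiv p) x \<noteq> 0"
proof -
  obtain p where p: "p \<in> polys_over K" "degree p > 0" "poly p x = 0"
    "\<And>q. q \<in> polys_over K \<Longrightarrow> poly q x = 0 \<Longrightarrow> degree q < degree p \<Longrightarrow> q = 0"
    using minimal_polynomial[OF assms] by metis
  have "pderiv p \<noteq> 0" using p(2) by (simp add: pderiv_eq_0_iff)
  moreover have "degree (pderiv p) < degree p" using p(2) by (simp add: degree_pderiv)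
  ultimately have "poly (pderiv p) x \<noteq> 0" using p(4)[OF polys_over_pderiv[OF K p(1)]] by blast
  then show ?thesis using that p by blast
qed

text \<open>Both derivations that preserve a field and derivations whose values lie on a line are
  covered by letting \<open>M\<close> be a module over \<open>A\<close>.\<close>

lemma deriv_preimage:
  fixes A :: "'a::field_char_0 set"
  assumes A: "is_subfield A" and d: "deriv_on A d"
    and M: "0 \<in> M" "\<And>a b. a \<in> M \<Longrightarrow> b \<in> M \<Longrightarrow> a + b \<in> M" "\<And>a b. a \<in> A \<Longrightarrow> b \<in> M \<Longrightarrow> a * b \<in> M"
  shows subfield_deriv_preimage: "is_subfield {z \<in> A. d z \<in> M}"
    and acl_deriv_preimage: "w \<in> A \<Longrightarrow> w \<in> acl {z \<in> A. d z \<in> M} \<Longrightarrow> d w \<in> M"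
proof -
  note r = deriv_on_rules[OF A d]
  note c = subfield_closed[OF A]
  have Mu: "- a \<in> M" if "a \<in> M" for a using M(3)[OF c(5)[OF c(2)] that] by simp
  show T: "is_subfield {z \<in> A. d z \<in> M}"
  proof (rule is_subfieldI)
    show "0 \<in> {z \<in> A. d z \<in> M}" "1 \<in> {z \<in> A. d z \<in> M}" using r(3,4) c(1,2) M(1) by auto
    show "x + y \<in> {z \<in> A. d z \<in> M}" if "x \<in> {z \<in> A. d z \<in> M}" "y \<in> {z \<in> A. d z \<in> M}" for x y
      using that r(1) c(3) M(2) by simp
    show "x * y \<in> {z \<in> A. d z \<in> M}" if "x \<in> {z \<in> A. d z \<in> M}" "y \<in> {z \<in> A. d z \<in> M}" for x y
      using that r(2) c(4) M(2) M(3)[of y "d x"] M(3)[of x "d y"] by (simp add: mult.commute)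
    show "- x \<in> {z \<in> A. d z \<in> M}" if "x \<in> {z \<in> A. d z \<in> M}" for x
      using that r(5) c(5) Mu by simp
    show "inverse x \<in> {z \<in> A. d z \<in> M}" if "x \<in> {z \<in> A. d z \<in> M}" "x \<noteq> 0" for x
    proof -
      define y where "y = - inverse x * inverse x"
      have "d (inverse x) = y * d x" using that r(6) by (simp add: y_def)
      moreover have "y \<in> A" using that c(4,5,6) by (auto simp: y_def)
      ultimately have "d (inverse x) \<in> M" using that M(3) by simp
      then show ?thesis using that c(6) by simp
    qed
  qed
  show "d w \<in> M" if w: "w \<in> A" "w \<in> acl {z \<in> A. d z \<in> M}"
  proof -
    obtain p where p: "p \<in> polys_over {z \<in> A. d z \<in> M}" "poly p w = 0" "poly (pderiv p) w \<noteq> 0"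
      using acl_separable[OF T w(2)] by metis
    have pA: "p \<in> polys_over A" using p(1) unfolding polys_over_def by blast
    \<comment> \<open>Differentiating \<open>p(w) = 0\<close> gives a linear equation for
      \<open>d w\<close>. Separability permits division by its coefficient, and the derivatives of
      the coefficients of \<open>p\<close> lie in the module \<open>M\<close>.\<close>
    have "poly (map_poly d p) w + poly (pderiv p) w * d w = 0"
      using r(10)[OF pA w(1)] p(2) r(3) by simp
    then have eq: "d w = - inverse (poly (pderiv p) w) * poly (map_poly d p) w"
      using p(3) by (simp add: field_simps add_eq_0_iff)
    have Msum: "(\<And>i. i \<in> I \<Longrightarrow> f i \<in> M) \<Longrightarrow> sum f I \<in> M" for f and I :: "nat set"
      by (induction I rule: infinite_finite_induct) (auto intro: M)
    have "w ^ i * coeff (map_poly d p) i \<in> M" for i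
      using p(1) w(1) r(3) by (intro M(3) c(9)) (auto simp: coeff_map_poly polys_over_def)
    then have "poly (map_poly d p) w \<in> M"
      unfolding poly_altdef by (intro Msum) (simp add: mult.commute)
    moreover have "- inverse (poly (pderiv p) w) \<in> A"
      using pA w(1) by (intro c(5,6) polys_over_poly[OF A] polys_over_pderiv[OF A])
    ultimately show ?thesis unfolding eq by (intro M(3))
  qed
qed

subsection \<open>Lueroth's theorem\<close>

text \<open>\<open>g\<close> is a non-zero element of least degree in the ideal generated by the
  \<open>a i\<close>. The last identity says that the cofactors have no common factor, in the form
  in which \<open>gauss_dvd\<close> uses primitivity.\<close>

lemma polys_over_bezout:
  assumes K: "is_subfield K" and "finite I" and a: "\<And>i. i \<in> I \<Longrightarrow> a i \<in> polys_over K"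
    and "\<exists>i\<in>I. a i \<noteq> 0"
  shows "\<exists>g b u. g \<in> polys_over K \<and> g \<noteq> 0 \<and> (\<forall>i\<in>I. b i \<in> polys_over K \<and> a i = g * b i) \<and>
    (\<Sum>i\<in>I. b i * u i) = 1"
proof -
  define J where "J = {\<Sum>i\<in>I. a i * u i |u. \<forall>i\<in>I. u i \<in> polys_over K}"
  have Ja: "a i \<in> J" if "i \<in> I" for i
  proof -
    have "a i = (\<Sum>k\<in>I. a k * (if k = i then 1 else 0))"
      using assms(2) that by (simp add: if_distrib[of "\<lambda>b. _ * b"] cong: if_cong)
    then show ?thesis unfolding J_def
      by (intro CollectI exI[of _ "\<lambda>k. if k = i then 1 else 0"])
        (auto intro: polys_over_0[OF K] polys_over_1[OF K])
  qed
  have Jdiff: "p - q * r \<in> J" if pq: "p \<in> J" "q \<in> J" "r \<in> polys_over K" for p q r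
  proof -
    obtain u v where u: "p = (\<Sum>i\<in>I. a i * u i)" "\<forall>i\<in>I. u i \<in> polys_over K"
      and v: "q = (\<Sum>i\<in>I. a i * v i)" "\<forall>i\<in>I. v i \<in> polys_over K"
      using pq(1,2) unfolding J_def by blast
    have "p - q * r = (\<Sum>i\<in>I. a i * (u i - v i * r))"
      unfolding u(1) v(1) sum_distrib_right
      by (simp add: sum_subtractf right_diff_distrib mult.assoc)
    then show ?thesis unfolding J_def using u(2) v(2) pq(3)
      by (intro CollectI exI[of _ "\<lambda>i. u i - v i * r"])
        (auto intro: polys_over_diff[OF K] polys_over_mult[OF K])
  qed
  have JK: "J \<subseteq> polys_over K"
    unfolding J_def using a by (auto intro!: polys_over_sum[OF K] polys_over_mult[OF K])
  obtain i0 where "i0 \<in> I" "a i0 \<noteq> 0" using assms(4) by blast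
  then have "\<exists>p. p \<in> J \<and> p \<noteq> 0" using Ja by blast
  then obtain g where g: "g \<in> J" "g \<noteq> 0" "\<And>p. p \<in> J \<and> p \<noteq> 0 \<Longrightarrow> degree g \<le> degree p"
    using ex_has_least_nat[of "\<lambda>p. p \<in> J \<and> p \<noteq> 0" _ degree] by blast
  have "\<exists>b. b \<in> polys_over K \<and> a i = g * b" if i: "i \<in> I" for i
  proof -
    obtain q where q: "q \<in> polys_over K" "a i - g * q = 0 \<or> degree (a i - g * q) < degree g"
      using polys_over_division[OF K _ g(2) a[OF i]] g(1) JK by blast
    have "a i - g * q = 0" using g(3)[of "a i - g * q"] Jdiff[OF Ja[OF i] g(1) q(1)] q(2) by force
    then show ?thesis using q(1) by auto
  qed
  then obtain b where b: "\<And>i. i \<in> I \<Longrightarrow> b i \<in> polys_over K" "\<And>i. i \<in> I \<Longrightarrow> a i = g * b i" by metis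
  obtain u where u: "g = (\<Sum>i\<in>I. a i * u i)" using g(1) unfolding J_def by blast
  have "g = g * (\<Sum>i\<in>I. b i * u i)" by (subst u) (simp add: sum_distrib_left b(2) mult.assoc)
  then have "(\<Sum>i\<in>I. b i * u i) = 1" using g(2) by (metis mult.right_neutral mult_left_cancel)
  then show ?thesis using g(1,2) b JK by blast
qed

lemma irreducible_factor_exists:
  fixes q :: "'a::field poly"
  assumes "degree q > 0"
  obtains p where "irreducible p" "p dvd q"
proof -
  let ?P = "\<lambda>p. p dvd q \<and> degree p > 0"
  obtain p where p: "p dvd q" "degree p > 0" "\<And>r. r dvd q \<Longrightarrow> degree r > 0 \<Longrightarrow> degree p \<le> degree r"
    using ex_has_least_nat[of ?P q degree] assms by auto
  have "irreducible p"
  proof (rule irreducibleI)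
    show "p \<noteq> 0" using p(2) by auto
    then show "\<not> is_unit p" using p(2) by (simp add: is_unit_iff_degree)
    fix a b assume ab: "p = a * b"
    then have nz: "a \<noteq> 0" "b \<noteq> 0" using p(2) by auto
    then have deg: "degree p = degree a + degree b" using ab degree_mult_eq by blast
    have "a dvd q" "b dvd q" using ab p(1) by (metis dvd_mult_left, metis dvd_mult_right)
    then have "degree a = 0 \<or> degree b = 0" using p(3)[of a] p(3)[of b] deg by (metis add_le_same_cancel2 add_le_same_cancel1 le_zero_eq neq0_conv)
    then show "is_unit a \<or> is_unit b" using nz by (auto simp: is_unit_iff_degree)
  qed
  then show ?thesis using that p(1) by blast
qed

text \<open>Gauss's lemma, with primitivity of \<open>P\<close> given by a Bezout identity.
  Irreducible factors of \<open>q\<close> are peeled off one by one: each stays prime as a constant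
  polynomial and cannot divide \<open>P\<close>, since it would then divide
  \<open>1\<close>.\<close>

lemma gauss_dvd:
  fixes P M :: "'a::field poly poly"
  assumes bez: "(\<Sum>i\<in>I. coeff P i * u i) = 1"
  shows "q \<noteq> 0 \<Longrightarrow> [:q:] dvd P * M \<Longrightarrow> [:q:] dvd M"
proof (induction "degree q" arbitrary: q M rule: less_induct)
  case less
  show ?case
  proof (cases "degree q = 0")
    case True
    then have "is_unit q" using less.prems(1) by (simp add: is_unit_iff_degree)
    then show ?thesis by (simp add: const_poly_dvd_iff unit_imp_dvd)
  next
    case False
    then obtain p where p: "irreducible p" "p dvd q" using irreducible_factor_exists by blast
    then obtain r where r: "q = p * r" by (elim dvdE)
    have "prime_elem p" using p(1) by (rule field_poly_irreducible_imp_prime)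
    then have pr: "prime_elem [:p:]" by (rule lift_prime_elem_poly)
    have "[:p:] dvd [:q:]" using r by simp
    then have "[:p:] dvd P * M" using less.prems(2) by (rule dvd_trans)
    moreover have "\<not> [:p:] dvd P"
    proof
      assume "[:p:] dvd P"
      then have "p dvd coeff P i" for i by (simp add: const_poly_dvd_iff)
      then have "p dvd (\<Sum>i\<in>I. coeff P i * u i)" by (intro dvd_sum dvd_mult2)
      then show False using bez p(1) by (simp add: irreducible_def)
    qed
    ultimately have "[:p:] dvd M" using pr prime_elem_dvd_mult_iff by blast
    then obtain M1 where M1: "M = [:p:] * M1" by (elim dvdE)
    have "[:q:] = [:p:] * [:r:]" using r by simp
    then have "[:p:] * [:r:] dvd [:p:] * (P * M1)" using less.prems(2) M1 by (metis mult.left_commute)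
    moreover have "p \<noteq> 0" "r \<noteq> 0" using r less.prems(1) by auto
    ultimately have "[:r:] dvd P * M1" by (metis dvd_mult_cancel_left pCons_eq_0_iff)
    moreover have "degree r < degree q"
    proof -
      have "degree p > 0" using p(1) \<open>p \<noteq> 0\<close> by (auto simp: irreducible_def is_unit_iff_degree)
      then show ?thesis using r \<open>p \<noteq> 0\<close> \<open>r \<noteq> 0\<close> by (simp add: degree_mult_eq)
    qed
    ultimately have "[:r:] dvd M1" using less.hyps \<open>r \<noteq> 0\<close> by blast
    then show ?thesis unfolding \<open>[:q:] = [:p:] * [:r:]\<close> M1 by (rule mult_dvd_mono[OF dvd_refl])
  qed
qed

text \<open>Degrees in the inner variable add up. Among the coefficients of maximal inner degree
  take, in each factor, the one of highest outer index; the product of their leading terms meets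
  nothing to cancel it.\<close>

lemma inner_degree_cofactor:
  fixes P M :: "'a::field poly poly"
  assumes "\<And>k. degree (coeff (P * M) k) \<le> e" "\<And>k. degree (coeff P k) \<le> e" "\<exists>k. degree (coeff P k) = e \<and> coeff P k \<noteq> 0"
  shows "degree (coeff M j) = 0"
proof (rule ccontr)
  assume pos: "degree (coeff M j) \<noteq> 0"
  have fin: "finite (coeff M ` UNIV)"
    by (rule finite_subset[of _ "insert 0 (coeff M ` {..degree M})"]) (auto, metis coeff_eq_0 image_eqI atMost_iff not_less)
  define f where "f = Max (degree ` coeff M ` UNIV)"
  have f: "degree (coeff M k) \<le> f" for k unfolding f_def using fin by (intro Max_ge) auto
  have "f \<in> degree ` coeff M ` UNIV" unfolding f_def using fin by (intro Max_in) auto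
  then obtain j0 where j0: "degree (coeff M j0) = f" by auto
  have fpos: "f > 0" using f[of j] pos by simp
  have bM: "k \<le> degree M" if "degree (coeff M k) = f" for k
    using that fpos by (metis coeff_eq_0 degree_0 linorder_not_le less_numeral_extra(3))
  have bP: "k \<le> degree P" if "coeff P k \<noteq> 0" for k using that by (rule le_degree)
  obtain jm where jm: "degree (coeff M jm) = f" "\<And>k. degree (coeff M k) = f \<Longrightarrow> k \<le> jm"
    using ex_has_greatest_nat[of "\<lambda>k. degree (coeff M k) = f" j0 "\<lambda>k. k" "Suc (degree M)"] j0 bM
    by (auto simp: less_Suc_eq_le)
  obtain i0 where i0: "degree (coeff P i0) = e" "coeff P i0 \<noteq> 0" using assms(3) by blast
  obtain im where im: "degree (coeff P im) = e" "coeff P im \<noteq> 0"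
    "\<And>k. degree (coeff P k) = e \<Longrightarrow> coeff P k \<noteq> 0 \<Longrightarrow> k \<le> im"
    using ex_has_greatest_nat[of "\<lambda>k. degree (coeff P k) = e \<and> coeff P k \<noteq> 0" i0 "\<lambda>k. k" "Suc (degree P)"]
      i0 bP by (auto simp: less_Suc_eq_le)
  have "coeff (coeff (P * M) (im + jm)) (e + f) =
    (\<Sum>k\<le>im + jm. coeff (coeff P k * coeff M (im + jm - k)) (e + f))"
    by (simp add: coeff_mult[of P M] coeff_sum)
  also have "\<dots> = (\<Sum>k\<le>im + jm. if k = im then lead_coeff (coeff P im) * lead_coeff (coeff M jm) else 0)"
  proof (intro sum.cong refl)
    fix k assume k: "k \<in> {..im + jm}"
    show "coeff (coeff P k * coeff M (im + jm - k)) (e + f) =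
      (if k = im then lead_coeff (coeff P im) * lead_coeff (coeff M jm) else 0)"
    proof (cases "k = im")
      case True
      then show ?thesis using im(1) jm(1) coeff_mult_degree_sum[of "coeff P im" "coeff M jm"] by simp
    next
      case False
      have "degree (coeff P k * coeff M (im + jm - k)) < e + f \<or> coeff P k * coeff M (im + jm - k) = 0"
      proof (cases "k < im")
        case True
        then have "degree (coeff M (im + jm - k)) \<noteq> f" using jm(2)[of "im + jm - k"] k by auto
        then have "degree (coeff M (im + jm - k)) < f" using f[of "im + jm - k"] by simp
        then show ?thesis using assms(2)[of k] degree_mult_le[of "coeff P k" "coeff M (im + jm - k)"] by linarith
      next
        case False2: False
        then have "degree (coeff P k) \<noteq> e \<or> coeff P k = 0" using im(3)[of k] False by auto
        then show ?thesis
          using assms(2)[of k] f[of "im + jm - k"] degree_mult_le[of "coeff P k" "coeff M (im + jm - k)"]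
          by fastforce
      qed
      then show ?thesis using False by (auto simp: coeff_eq_0)
    qed
  qed
  also have "\<dots> = lead_coeff (coeff P im) * lead_coeff (coeff M jm)" by simp
  finally have "coeff (coeff (P * M) (im + jm)) (e + f) \<noteq> 0"
    using im(2) jm(1) fpos by auto
  then have "e + f \<le> degree (coeff (P * M) (im + jm))" by (rule le_degree)
  then show False using assms(1)[of "im + jm"] fpos by simp
qed

lemma map_poly_eval_mult:
  fixes R S :: "'a::field poly poly"
  shows "map_poly (\<lambda>A. poly A x) (R * S) = map_poly (\<lambda>A. poly A x) R * map_poly (\<lambda>A. poly A x) S"
  by (rule poly_eqI) (simp add: coeff_map_poly coeff_mult poly_sum)

text \<open>Let \<open>P\<close> be the minimal polynomial of \<open>x\<close> over \<open>H\<close>, with denominators cleared in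
  \<open>F[X][Y]\<close>, and let \<open>w = a(x) / b(x)\<close> be one of its coefficients outside \<open>F\<close>. Comparing degrees
  in \<open>X\<close> in \<open>P dvd a(Y) b(X) - b(Y) a(X)\<close> shows that the cofactor does not involve \<open>X\<close>, and then
  antisymmetry shows that it is constant. So \<open>x\<close> has the same degree over \<open>F(w)\<close> and over \<open>H\<close>.\<close>

theorem luroth:
  assumes F: "is_subfield F" and x: "x \<notin> acl F" and H: "is_subfield H" "F \<subseteq> H"
    and Hx: "H \<subseteq> field_gen (insert x F)" and v0: "v0 \<in> H" "v0 \<notin> F"
  obtains w where "w \<in> H" "H = field_gen (insert w F)"
proof -
  have x0: "p = 0" if "p \<in> polys_over F" "poly p x = 0" for p
    using acl_not_poly_root[OF x] that by blast
  have "x \<in> cl (insert v0 F)" using acl_of_nonconstant[OF F] v0 Hx by blast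
  moreover have "cl (insert v0 F) \<subseteq> acl H"
    unfolding cl_def using v0 H by (intro acl_mono field_gen_least) auto
  ultimately have "x \<in> acl H" by blast
  then obtain P where P: "P \<in> polys_over H" "lead_coeff P = 1" "degree P > 0" "poly P x = 0"
    "\<And>q. q \<in> polys_over H \<Longrightarrow> poly q x = 0 \<Longrightarrow> degree q < degree P \<Longrightarrow> q = 0"
    "\<And>q. q \<in> polys_over H \<Longrightarrow> poly q x = 0 \<Longrightarrow> \<exists>r\<in>polys_over H. q = P * r"
    using minimal_polynomial[OF H(1)] by metis
  define d where "d = degree P"
  have "coeff P i \<in> field_gen (insert x F)" for i using polys_overD[OF P(1)] Hx by blast
  then obtain a b where ab: "\<And>i. i \<in> {..d} \<Longrightarrow> a i \<in> polys_over F" "b \<in> polys_over F" "poly b x \<noteq> 0"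
    "\<And>i. i \<in> {..d} \<Longrightarrow> coeff P i = poly (a i) x / poly b x"
    using field_gen_simple_common[OF F, of "{..d}" "coeff P" x] by (metis finite_atMost)
  have "coeff P d = 1" using P(2) by (simp add: d_def)
  then have adx: "poly (a d) x = poly b x" using ab(3) ab(4)[of d] by (simp add: field_simps)
  then have "a d \<noteq> 0" using ab(3) by auto
  then have ne: "\<exists>i\<in>{..d}. a i \<noteq> 0" by blast
  obtain g A u where A: "g \<in> polys_over F" "g \<noteq> 0" "\<And>i. i \<in> {..d} \<Longrightarrow> A i \<in> polys_over F"
    "\<And>i. i \<in> {..d} \<Longrightarrow> a i = g * A i" and bez: "(\<Sum>i\<in>{..d}. A i * u i) = 1"
    using polys_over_bezout[OF F finite_atMost ab(1) ne] by blast
  define B where "B = A d"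
  have BF: "B \<in> polys_over F" unfolding B_def using A(3) by simp
  have gx: "poly g x \<noteq> 0" using x0 A(1,2) by blast
  have "B \<noteq> 0" using \<open>a d \<noteq> 0\<close> A(4)[of d] unfolding B_def by auto
  then have Bx: "poly B x \<noteq> 0" using x0 BF by blast
  have c: "coeff P i = poly (A i) x / poly B x" if "i \<le> d" for i
    using ab(4)[of i] A(4)[of i] A(4)[of d] that gx Bx unfolding B_def adx[symmetric] by simp
  have "\<exists>i\<le>d. coeff P i \<notin> F"
  proof (rule ccontr)
    assume "\<not> ?thesis"
    then have "coeff P i \<in> F" for i using subfield_0[OF F] by (cases "i \<le> d") (auto simp: d_def coeff_eq_0)
    then have "P \<in> polys_over F" by (simp add: polys_over_def)
    then show False using x0 P(2,4) by fastforce
  qed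
  then obtain i0 where i0: "i0 \<le> d" "coeff P i0 \<notin> F" by blast
  define w where "w = coeff P i0"
  have wH: "w \<in> H" "w \<notin> F" using i0 polys_overD[OF P(1)] unfolding w_def by auto
  define a0 where "a0 = A i0"
  have a0F: "a0 \<in> polys_over F" unfolding a0_def using A(3) i0 by simp
  have a0x: "poly a0 x = w * poly B x" using c[OF i0(1)] Bx unfolding a0_def w_def by simp

  \<comment> \<open>The outer variable is \<open>Y\<close>, the inner one is \<open>X\<close>. The
    map \<open>ev\<close> below specialises \<open>X\<close> to \<open>x\<close>; it is injective on
    polynomials over \<open>F\<close> because \<open>x\<close> is transcendental, so identities can
    be lifted from \<open>H[Y]\<close>.\<close>
  define Pt where "Pt = (\<Sum>i\<le>d. monom (A i) i)"
  have cPt: "coeff Pt i = (if i \<le> d then A i else 0)" for i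
    by (simp add: Pt_def coeff_sum)
  define N where "N = max (degree a0) (degree B)"
  \<comment> \<open>This is \<open>a0(Y) B(X) - B(Y) a0(X)\<close>, which specialises at
    \<open>X = x\<close> to a multiple of \<open>q0\<close>.\<close>
  define Q where "Q = (\<Sum>i\<le>N. monom (smult (coeff a0 i) B - smult (coeff B i) a0) i)"
  have cQ: "coeff Q i = smult (coeff a0 i) B - smult (coeff B i) a0" for i
  proof (cases "i \<le> N")
    case False
    then have "coeff a0 i = 0" "coeff B i = 0" by (auto simp: N_def coeff_eq_0)
    then show ?thesis using False by (simp add: Q_def coeff_sum)
  qed (simp add: Q_def coeff_sum)
  define ev where "ev = map_poly (\<lambda>A. poly A x)"
  have cev: "coeff (ev R) i = poly (coeff R i) x" for R i by (simp add: ev_def coeff_map_poly)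
  have ev_mult: "ev (R * S) = ev R * ev S" for R S unfolding ev_def by (rule map_poly_eval_mult)
  have ev_inj: "R = S" if "ev R = ev S" "\<And>i. coeff R i \<in> polys_over F" "\<And>i. coeff S i \<in> polys_over F" for R S
  proof (rule poly_eqI)
    fix i
    have "poly (coeff R i - coeff S i) x = 0" using cev[of R i] cev[of S i] that(1) by simp
    then have "coeff R i - coeff S i = 0" using x0 polys_over_diff[OF F] that(2,3) by blast
    then show "coeff R i = coeff S i" by simp
  qed
  have evP: "ev Pt = smult (poly B x) P"
    by (rule poly_eqI) (use c Bx in \<open>auto simp: cev cPt d_def coeff_eq_0\<close>)
  define q0 where "q0 = a0 - smult w B"
  have evQ: "ev Q = smult (poly B x) q0"
    by (rule poly_eqI) (simp add: cev cQ q0_def a0x algebra_simps)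
  have "q0 \<in> polys_over H"
    unfolding q0_def using a0F BF polys_over_mono[OF H(2)] wH
    by (intro polys_over_diff[OF H(1)] polys_over_smult[OF H(1)]) auto
  moreover have q0x: "poly q0 x = 0" by (simp add: q0_def a0x)
  ultimately obtain M where M: "M \<in> polys_over H" "q0 = P * M" using P(6) by blast
  have q0: "q0 \<noteq> 0"
  proof
    assume "q0 = 0"
    then have "a0 = smult w B" by (simp add: q0_def)
    then show False using smult_eq_imp_mem[OF F a0F BF \<open>B \<noteq> 0\<close>] wH by blast
  qed
  have "coeff M i \<in> field_gen (insert x F)" for i using polys_overD[OF M(1)] Hx by blast
  then obtain m q where mq: "\<And>i. i \<in> {..degree M} \<Longrightarrow> m i \<in> polys_over F" "q \<in> polys_over F" "poly q x \<noteq> 0"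
    "\<And>i. i \<in> {..degree M} \<Longrightarrow> coeff M i = poly (m i) x / poly q x"
    using field_gen_simple_common[OF F, of "{..degree M}" "coeff M" x] by (metis finite_atMost)
  define Mt where "Mt = (\<Sum>i\<le>degree M. monom (m i) i)"
  have cMt: "coeff Mt i = (if i \<le> degree M then m i else 0)" for i
    by (simp add: Mt_def coeff_sum)
  have evM: "ev Mt = smult (poly q x) M"
    by (rule poly_eqI) (use mq in \<open>auto simp: cev cMt coeff_eq_0\<close>)
  have "q \<noteq> 0" using mq(3) by auto
  have eq: "[:q:] * Q = Pt * Mt"
  proof (rule ev_inj)
    have "ev [:q:] = [:poly q x:]" by (simp add: ev_def map_poly_pCons)
    then show "ev ([:q:] * Q) = ev (Pt * Mt)"
      unfolding ev_mult evP evM evQ M(2) by (simp add: mult.commute)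
    show "coeff ([:q:] * Q) i \<in> polys_over F" for i
      using mq(2) a0F BF
      by (auto simp: cQ intro!: polys_over_mult[OF F] polys_over_diff[OF F] polys_over_smult[OF F] polys_overD)
    show "coeff (Pt * Mt) i \<in> polys_over F" for i
      unfolding coeff_mult using A(3) mq(1) polys_over_0[OF F]
      by (intro polys_over_sum[OF F] polys_over_mult[OF F]) (auto simp: cPt cMt)
  qed
  have bez': "(\<Sum>i\<in>{..d}. coeff Pt i * u i) = 1" using bez by (simp add: cPt)
  have "[:q:] dvd Pt * Mt" by (metis eq dvd_triv_left)
  then have "[:q:] dvd Mt" using gauss_dvd[OF bez' \<open>q \<noteq> 0\<close>] by blast
  then obtain M' where "Mt = [:q:] * M'" by (elim dvdE)
  then have "[:q:] * Q = [:q:] * (Pt * M')" using eq by (simp add: mult.left_commute)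
  then have QM: "Q = Pt * M'" using \<open>q \<noteq> 0\<close> by (metis mult_cancel_left pCons_eq_0_iff)
  have "Q \<noteq> 0" using evQ q0 Bx by (auto simp: ev_def)
  then have "M' \<noteq> 0" "Pt \<noteq> 0" using QM by auto

  define e where "e = Max (degree ` A ` {..d})"
  have eA: "degree (A i) \<le> e" if "i \<le> d" for i unfolding e_def using that by (intro Max_ge) auto
  have deg0: "degree (coeff M' j) = 0" for j
  proof (rule inner_degree_cofactor)
    show "degree (coeff (Pt * M') k) \<le> e" for k
      unfolding QM[symmetric] cQ
      using eA[of i0] eA[of d] i0 by (intro degree_diff_le order.trans[OF degree_smult_le]) (auto simp: a0_def B_def)
    show "degree (coeff Pt k) \<le> e" for k using eA by (auto simp: cPt)
    have "e \<in> degree ` A ` {..d}" unfolding e_def by (intro Max_in) auto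
    then obtain k where k: "k \<le> d" "degree (A k) = e" by auto
    show "\<exists>k. degree (coeff Pt k) = e \<and> coeff Pt k \<noteq> 0"
    proof (cases "A k = 0")
      case True
      then have "degree B = e" using k eA[of d] unfolding B_def by auto
      then show ?thesis using \<open>B \<noteq> 0\<close> by (intro exI[of _ d]) (simp add: cPt B_def)
    next
      case False
      then show ?thesis using k by (intro exI[of _ k]) (simp add: cPt)
    qed
  qed
  define \<mu> where "\<mu> = map_poly (\<lambda>A. coeff A 0) M'"
  have cM': "coeff M' j = [:coeff \<mu> j:]" for j
    using deg0[of j] by (auto simp: \<mu>_def coeff_map_poly elim: degree_eq_zeroE)
  have "\<mu> \<noteq> 0"
  proof
    assume "\<mu> = 0"
    then have "M' = 0" by (intro poly_eqI) (simp add: cM')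
    then show False using \<open>M' \<noteq> 0\<close> by blast
  qed
  \<comment> \<open>Interchanging \<open>X\<close> and \<open>Y\<close> only changes the sign of
    \<open>Q\<close>, so the factor \<open>\<mu>(Y)\<close> of \<open>Q\<close> yields the factor
    \<open>\<mu>(X)\<close>. By Gauss it divides the cofactor, whose coefficients are free of
    \<open>X\<close>; thus \<open>\<mu>\<close> is constant.\<close>
  have "\<mu> dvd coeff Q k" for k
  proof -
    have "coeff Q k = - map_poly (\<lambda>A. coeff A k) Q"
      by (rule poly_eqI) (simp add: coeff_map_poly cQ mult.commute)
    also have "map_poly (\<lambda>A. coeff A k) Q = map_poly (\<lambda>A. coeff A k) Pt * \<mu>"
      unfolding QM
    proof (rule poly_eqI)
      fix n
      have "coeff (coeff (Pt * M') n) k = (\<Sum>i\<le>n. coeff (coeff Pt i) k * coeff \<mu> (n - i))"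
        unfolding coeff_mult[of Pt M'] coeff_sum cM' by (intro sum.cong refl) simp
      then show "coeff (map_poly (\<lambda>A. coeff A k) (Pt * M')) n = coeff (map_poly (\<lambda>A. coeff A k) Pt * \<mu>) n"
        by (simp add: coeff_map_poly coeff_mult[of _ \<mu>])
    qed
    finally show ?thesis by simp
  qed
  then have "[:\<mu>:] dvd Pt * M'" unfolding QM[symmetric] by (simp add: const_poly_dvd_iff)
  then have "[:\<mu>:] dvd M'" using gauss_dvd[OF bez' \<open>\<mu> \<noteq> 0\<close>] by blast
  then have "\<mu> dvd [:coeff \<mu> j:]" for j unfolding cM'[symmetric] by (simp add: const_poly_dvd_iff)
  then have "\<mu> dvd [:lead_coeff \<mu>:]" by blast
  then have "degree \<mu> = 0" using \<open>\<mu> \<noteq> 0\<close> dvd_imp_degree_le[of \<mu> "[:lead_coeff \<mu>:]"] by auto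
  have "degree M' = 0"
  proof -
    have "coeff M' j = 0" if "j > 0" for j using that \<open>degree \<mu> = 0\<close> by (simp add: cM' coeff_eq_0)
    then show ?thesis by (metis gr0I leading_coeff_0_iff \<open>M' \<noteq> 0\<close>)
  qed
  have "degree Pt \<le> d" by (rule degree_le) (auto simp: cPt)
  then have "degree Q \<le> d" using \<open>degree M' = 0\<close> degree_mult_le[of Pt M'] unfolding QM by linarith
  then have "degree (ev Q) \<le> d" by (intro degree_le) (auto simp: cev coeff_eq_0)
  then have dq0: "degree q0 \<le> d" using Bx by (simp add: evQ)

  define Fw where "Fw = field_gen (insert w F)"
  have Fw: "is_subfield Fw" "F \<subseteq> Fw" "w \<in> Fw" "Fw \<subseteq> H"
    unfolding Fw_def using field_gen_superset[of "insert w F"] field_gen_least[OF H(1), of "insert w F"] H(2) wH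
    by auto
  have q0F: "q0 \<in> polys_over Fw"
    unfolding q0_def using a0F BF polys_over_mono[OF Fw(2)] Fw
    by (intro polys_over_diff[OF Fw(1)] polys_over_smult[OF Fw(1)]) auto
  then have xFw: "x \<in> acl Fw" using q0 q0x by (rule acl_poly_root)
  \<comment> \<open>\<open>h\<close> is a polynomial in \<open>x\<close> over \<open>F(w)\<close>,
    which is reduced modulo \<open>q0\<close> to degree below \<open>d\<close>. Minus the constant
    \<open>h\<close> it lies over \<open>H\<close> and vanishes at \<open>x\<close>, so by
    minimality of \<open>P\<close> it is zero, and \<open>h\<close> is a coefficient over
    \<open>F(w)\<close>.\<close>
  have "h \<in> Fw" if h: "h \<in> H" for h
  proof -
    have "h \<in> field_gen (insert x Fw)"
      using h Hx field_gen_mono[of "insert x F" "insert x Fw"] Fw(2) by blast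
    then obtain r where r: "r \<in> polys_over Fw" "h = poly r x"
      using field_gen_algebraic_simple[OF Fw(1) xFw] by metis
    obtain s where s: "s \<in> polys_over Fw" "r - q0 * s = 0 \<or> degree (r - q0 * s) < degree q0"
      using polys_over_division[OF Fw(1) q0F q0 r(1)] by blast
    define t where "t = r - q0 * s"
    have tF: "t \<in> polys_over Fw" unfolding t_def
      using r(1) s(1) q0F by (intro polys_over_diff[OF Fw(1)] polys_over_mult[OF Fw(1)])
    have tx: "poly t x = h" by (simp add: t_def r(2) q0x)
    have "degree t < d" using s(2) dq0 P(3) unfolding t_def[symmetric] d_def by auto
    then have "degree (t - [:h:]) < degree P" using P(3) unfolding d_def
      by (intro degree_diff_less) auto
    moreover have "t - [:h:] \<in> polys_over H" using tF polys_over_mono[OF Fw(4)] h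
      by (intro polys_over_diff[OF H(1)] polys_over_const[OF H(1)]) auto
    moreover have "poly (t - [:h:]) x = 0" by (simp add: tx)
    ultimately have "t - [:h:] = 0" using P(5) by blast
    then have "h = coeff t 0" by simp
    then show ?thesis using polys_overD[OF tF] by simp
  qed
  then have "H = field_gen (insert w F)" using Fw(4) unfolding Fw_def by blast
  then show ?thesis using that wH(1) by blast
qed

subsection \<open>Gordan's extension to several variables\<close>

definition hom_on :: "'a::field set \<Rightarrow> ('a \<Rightarrow> 'a) \<Rightarrow> bool" where
  "hom_on H \<phi> \<longleftrightarrow> \<phi> 1 = 1 \<and> (\<forall>a\<in>H. \<forall>b\<in>H. \<phi> (a + b) = \<phi> a + \<phi> b \<and> \<phi> (a * b) = \<phi> a * \<phi> b)"

lemma hom_on_rules: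
  assumes H: "is_subfield H" and h: "hom_on H \<phi>"
  shows hom_on_1: "\<phi> 1 = 1" and hom_on_0: "\<phi> 0 = 0"
    and hom_on_add: "a \<in> H \<Longrightarrow> b \<in> H \<Longrightarrow> \<phi> (a + b) = \<phi> a + \<phi> b"
    and hom_on_mult: "a \<in> H \<Longrightarrow> b \<in> H \<Longrightarrow> \<phi> (a * b) = \<phi> a * \<phi> b"
    and hom_on_uminus: "a \<in> H \<Longrightarrow> \<phi> (- a) = - \<phi> a"
    and hom_on_inverse: "a \<in> H \<Longrightarrow> \<phi> (inverse a) = inverse (\<phi> a)"
    and hom_on_eq_0: "a \<in> H \<Longrightarrow> \<phi> a = 0 \<Longrightarrow> a = 0"
    and hom_on_inj: "a \<in> H \<Longrightarrow> b \<in> H \<Longrightarrow> \<phi> a = \<phi> b \<Longrightarrow> a = b"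
    and hom_on_poly: "p \<in> polys_over H \<Longrightarrow> a \<in> H \<Longrightarrow> \<phi> (poly p a) = poly (map_poly \<phi> p) (\<phi> a)"
proof -
  show 1: "\<phi> 1 = 1" and a: "a \<in> H \<Longrightarrow> b \<in> H \<Longrightarrow> \<phi> (a + b) = \<phi> a + \<phi> b"
    and m: "a \<in> H \<Longrightarrow> b \<in> H \<Longrightarrow> \<phi> (a * b) = \<phi> a * \<phi> b" for a b
    using h unfolding hom_on_def by auto
  show 0: "\<phi> 0 = 0" using a[of 0 0] subfield_0[OF H] by (simp only: add_0 add_cancel_right_right)
  show u: "a \<in> H \<Longrightarrow> \<phi> (- a) = - \<phi> a" for a
    using a[of a "- a"] subfield_uminus[OF H, of a] 0 by (simp add: add_eq_0_iff)
  have inv: "\<phi> a * \<phi> (inverse a) = 1" if "a \<in> H" "a \<noteq> 0" for a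
    using m[of a "inverse a"] subfield_inverse[OF H, of a] that 1 by simp
  show z: "a \<in> H \<Longrightarrow> \<phi> a = 0 \<Longrightarrow> a = 0" for a using inv[of a] by auto
  show "\<phi> (inverse a) = inverse (\<phi> a)" if "a \<in> H"
  proof (cases "a = 0")
    case False
    then show ?thesis using inv[OF that] by (metis inverse_unique)
  qed (simp add: 0)
  show "a = b" if ab: "a \<in> H" "b \<in> H" "\<phi> a = \<phi> b"
  proof -
    have "\<phi> (a + - b) = 0" using ab a[of a "- b"] u[of b] subfield_uminus[OF H] by simp
    then have "a + - b = 0" using z subfield_add[OF H ab(1) subfield_uminus[OF H ab(2)]] by blast
    then show ?thesis by simp
  qed
  show "p \<in> polys_over H \<Longrightarrow> a \<in> H \<Longrightarrow> \<phi> (poly p a) = poly (map_poly \<phi> p) (\<phi> a)"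
  proof (induction p)
    case (pCons c p)
    then have c: "c \<in> H" "p \<in> polys_over H"
      unfolding polys_over_def by (auto simp: coeff_pCons split: nat.splits)
    have pH: "poly p a \<in> H" using c pCons.prems polys_over_poly[OF H] by blast
    show ?case using c pCons.prems pH pCons.IH
      by (simp add: map_poly_pCons 0 a m subfield_mult[OF H])
  qed (simp add: 0)
qed

lemma hom_on_subfields:
  assumes H: "is_subfield H" and h: "hom_on H \<phi>"
  shows subfield_hom_image: "is_subfield K \<Longrightarrow> K \<subseteq> H \<Longrightarrow> is_subfield (\<phi> ` K)"
    and subfield_hom_preimage: "is_subfield M \<Longrightarrow> is_subfield {z \<in> H. \<phi> z \<in> M}"
proof -
  note r = hom_on_rules[OF H h]
  show "is_subfield (\<phi> ` K)" if K: "is_subfield K" "K \<subseteq> H"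
  proof (rule is_subfieldI)
    have KH: "z \<in> H" if "z \<in> K" for z using that K(2) by blast
    show "0 \<in> \<phi> ` K" "1 \<in> \<phi> ` K"
      using r(1,2) subfield_0[OF K(1)] subfield_1[OF K(1)] by (metis imageI)+
    show "x + y \<in> \<phi> ` K" "x * y \<in> \<phi> ` K" if xy: "x \<in> \<phi> ` K" "y \<in> \<phi> ` K" for x y
    proof -
      obtain a b where ab: "a \<in> K" "b \<in> K" "x = \<phi> a" "y = \<phi> b" using xy by blast
      show "x + y \<in> \<phi> ` K" using ab r(3)[OF KH KH] subfield_add[OF K(1)] by (metis imageI)
      show "x * y \<in> \<phi> ` K" using ab r(4)[OF KH KH] subfield_mult[OF K(1)] by (metis imageI)
    qed
    show "- x \<in> \<phi> ` K" "inverse x \<in> \<phi> ` K" if x: "x \<in> \<phi> ` K" for x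
    proof -
      obtain a where a: "a \<in> K" "x = \<phi> a" using x by blast
      show "- x \<in> \<phi> ` K" using a r(5)[OF KH] subfield_uminus[OF K(1)] by (metis imageI)
      show "inverse x \<in> \<phi> ` K" using a r(6)[OF KH] subfield_inverse[OF K(1)] by (metis imageI)
    qed
  qed
  show "is_subfield {z \<in> H. \<phi> z \<in> M}" if M: "is_subfield M"
    by (rule is_subfieldI) (auto simp: r(1-6) subfield_closed(1-6)[OF M] subfield_closed(1-6)[OF H])
qed

text \<open>The place \<open>x \<mapsto> a\<close> of \<open>Y(x)\<close> is regular on \<open>H\<close> as soon as \<open>v0\<close> has a transcendental value
  there, because \<open>H\<close> is algebraic over \<open>F(v0)\<close>. The derivation \<open>D\<close> witnesses transcendence over \<open>F\<close>.\<close>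

lemma specialisation:
  fixes F :: "'a::field_char_0 set"
  assumes F: "is_subfield F" and Y: "is_subfield Y" "F \<subseteq> Y" and x: "x \<notin> acl Y"
    and D: "deriv_on (field_gen (insert x Y)) D" "\<And>y. y \<in> Y \<Longrightarrow> D y \<in> Y" "D x = 0" "\<And>y. y \<in> F \<Longrightarrow> D y = 0"
    and H: "is_subfield H" "F \<subseteq> H" "H \<subseteq> field_gen (insert x Y)"
    and v0: "v0 \<in> H" "D v0 \<noteq> 0" "H \<subseteq> cl (insert v0 F)"
  shows "\<exists>\<phi>. hom_on H \<phi> \<and> \<phi> ` H \<subseteq> Y \<and> (\<forall>c\<in>F. \<phi> c = c) \<and> D (\<phi> v0) \<noteq> 0"
proof -
  let ?Z = "field_gen (insert x Y)"
  have Z: "is_subfield ?Z" by blast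
  have YZ: "Y \<subseteq> ?Z" and xZ: "x \<in> ?Z" using field_gen_superset[of "insert x Y"] by auto
  have pYZ: "polys_over Y \<subseteq> polys_over ?Z" using YZ by (rule polys_over_mono)
  note rZ = deriv_on_rules[OF Z D(1)]
  have x0: "p = 0" if "p \<in> polys_over Y" "poly p x = 0" for p
    using acl_not_poly_root[OF x] that by blast
  have map_D: "map_poly D f \<in> polys_over Y" if "f \<in> polys_over Y" for f
    using that D(2) rZ(3) by (auto simp: polys_over_def coeff_map_poly)
  have Dp: "D (poly f b) = poly (map_poly D f) b" if "f \<in> polys_over Y" "b \<in> ?Z" "D b = 0" for f b
    using rZ(10)[of f b] that pYZ by auto
  have Dquot: "D (poly f b / poly g b) = poly (map_poly D f * g - f * map_poly D g) b / (poly g b)\<^sup>2"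
    if "f \<in> polys_over Y" "g \<in> polys_over Y" "b \<in> ?Z" "D b = 0" "poly g b \<noteq> 0" for f g b
  proof -
    have mem: "poly f b \<in> ?Z" "poly g b \<in> ?Z" using that pYZ polys_over_poly[OF Z] by blast+
    have "D (poly f b / poly g b) = D (poly f b) * inverse (poly g b) + poly f b * D (inverse (poly g b))"
      using rZ(2)[OF mem(1) subfield_inverse[OF Z mem(2)]] by (simp add: divide_inverse)
    also have "D (inverse (poly g b)) = - D (poly g b) * inverse (poly g b) * inverse (poly g b)"
      using rZ(6) mem(2) that(5) by blast
    finally show ?thesis using Dp[OF that(1,3,4)] Dp[OF that(2,3,4)] that(5)
      by (simp add: field_simps power2_eq_square)
  qed
  obtain p q where pq: "p \<in> polys_over Y" "q \<in> polys_over Y" "poly q x \<noteq> 0" "v0 = poly p x / poly q x"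
    using field_gen_simple[OF Y(1), of v0 x] v0(1) H(3) by blast
  \<comment> \<open>The numerator of \<open>D v0\<close> as a fraction in \<open>x\<close>. The
    point \<open>a\<close> is chosen outside the roots of \<open>q\<close> and \<open>R\<close>, so
    that the value \<open>v1\<close> exists and \<open>D v1 \<noteq> 0\<close>; being a natural
    number, \<open>a\<close> satisfies \<open>D a = 0\<close> as \<open>x\<close> does.\<close>
  define R where "R = map_poly D p * q - p * map_poly D q"
  have "poly R x \<noteq> 0" using Dquot[OF pq(1,2) xZ D(3) pq(3)] v0(2) pq(4) unfolding R_def by auto
  then have "q * R \<noteq> 0" using pq(3) by auto
  then have "finite {b. poly (q * R) b = 0}" by (rule poly_roots_finite)
  moreover have "infinite (range (of_nat :: nat \<Rightarrow> 'a))" by (simp add: finite_image_iff inj_of_nat)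
  ultimately have "\<exists>k::nat. poly (q * R) (of_nat k) \<noteq> 0"
    by (metis (mono_tags, lifting) finite_subset image_subsetI mem_Collect_eq)
  then obtain k :: nat where k: "poly (q * R) (of_nat k) \<noteq> 0" by blast
  define a :: 'a where "a = of_nat k"
  have a: "poly q a \<noteq> 0" "poly R a \<noteq> 0" using k by (auto simp: a_def)
  have aY: "a \<in> Y" "D a = 0" unfolding a_def using subfield_of_nat[OF Y(1)] rZ(9) by auto
  have aZ: "a \<in> ?Z" using aY YZ by blast
  define v1 where "v1 = poly p a / poly q a"
  have v1Y: "v1 \<in> Y" unfolding v1_def using pq aY by (intro subfield_divide[OF Y(1)] polys_over_poly[OF Y(1)])
  have Dv1: "D v1 \<noteq> 0" using Dquot[OF pq(1,2) aZ aY(2) a(1)] a unfolding v1_def R_def by simp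
  have v1: "v1 \<notin> acl F"
  proof
    assume "v1 \<in> acl F"
    moreover have "F \<subseteq> {z \<in> Y. D z \<in> {0}}" using D(4) Y(2) by auto
    ultimately have "v1 \<in> acl {z \<in> Y. D z \<in> {0}}" using acl_mono by blast
    then have "D v1 \<in> {0}"
      using acl_deriv_preimage[OF Y(1) deriv_on_subset[OF D(1) YZ], of "{0}" v1] v1Y by simp
    then show False using Dv1 by simp
  qed

  \<comment> \<open>The graph of the place: \<open>z\<close> has a representation in
    \<open>x\<close> whose denominator survives at \<open>a\<close>, and \<open>y\<close> is its
    value there. As a relation it is available before regularity on \<open>H\<close> is
    known.\<close>
  define Rep where "Rep z y \<longleftrightarrow> (\<exists>f\<in>polys_over Y. \<exists>g\<in>polys_over Y. poly g a \<noteq> 0 \<and>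
    z = poly f x / poly g x \<and> y = poly f a / poly g a)" for z y
  have gx: "poly g x \<noteq> 0" if "g \<in> polys_over Y" "poly g a \<noteq> 0" for g using x0[OF that(1)] that(2) by auto
  have Rep_unique: "y = y'" if "Rep z y" "Rep z y'" for z y y'
  proof -
    obtain f g f' g' where *: "f \<in> polys_over Y" "g \<in> polys_over Y" "f' \<in> polys_over Y" "g' \<in> polys_over Y"
      "poly g a \<noteq> 0" "poly g' a \<noteq> 0" "z = poly f x / poly g x" "z = poly f' x / poly g' x"
      "y = poly f a / poly g a" "y' = poly f' a / poly g' a"
      using \<open>Rep z y\<close> \<open>Rep z y'\<close> unfolding Rep_def by blast
    have "poly (f * g' - f' * g) x = 0"
      using *(7,8) gx[OF *(2,5)] gx[OF *(4,6)] by (simp add: field_simps)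
    then have "f * g' - f' * g = 0"
      using * by (intro x0) (auto intro: polys_over_diff[OF Y(1)] polys_over_mult[OF Y(1)])
    then have "poly (f * g' - f' * g) a = 0" by simp
    then show ?thesis using *(5,6) unfolding *(9,10) by (simp add: frac_eq_eq)
  qed
  have Rep_ring: "Rep (z + z') (y + y')" "Rep (z * z') (y * y')" if "Rep z y" "Rep z' y'" for z z' y y'
  proof -
    obtain f g f' g' where *: "f \<in> polys_over Y" "g \<in> polys_over Y" "f' \<in> polys_over Y" "g' \<in> polys_over Y"
      "poly g a \<noteq> 0" "poly g' a \<noteq> 0" "z = poly f x / poly g x" "z' = poly f' x / poly g' x"
      "y = poly f a / poly g a" "y' = poly f' a / poly g' a"
      using \<open>Rep z y\<close> \<open>Rep z' y'\<close> unfolding Rep_def by blast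
    note nz = gx[OF *(2,5)] gx[OF *(4,6)]
    have mem: "f * g' + f' * g \<in> polys_over Y" "f * f' \<in> polys_over Y" "g * g' \<in> polys_over Y"
      using * by (auto intro: polys_over_add[OF Y(1)] polys_over_mult[OF Y(1)])
    have "z + z' = poly (f * g' + f' * g) x / poly (g * g') x" "z * z' = poly (f * f') x / poly (g * g') x"
      "y + y' = poly (f * g' + f' * g) a / poly (g * g') a" "y * y' = poly (f * f') a / poly (g * g') a"
      "poly (g * g') a \<noteq> 0"
      using *(5,6) nz unfolding *(7-10) by (simp_all add: add_frac_eq)
    then show "Rep (z + z') (y + y')" "Rep (z * z') (y * y')" unfolding Rep_def using mem by blast+
  qed
  have Rep_const: "Rep c c" if "c \<in> Y" for c
    unfolding Rep_def
    by (rule bexI[of _ "[:c:]"], rule bexI[of _ 1])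
      (auto intro: polys_over_const[OF Y(1)] polys_over_1[OF Y(1)] that)
  have Rep_Y: "y \<in> Y" if "Rep z y" for z y
    using that aY polys_over_poly[OF Y(1)] subfield_divide[OF Y(1)] unfolding Rep_def by blast
  have Rep_v: "Rep v0 v1" unfolding Rep_def v1_def using pq a by blast
  have Rep_poly: "Rep (poly c z) (poly c y)" if "c \<in> polys_over F" "Rep z y" for c z y
    using that(1)
  proof (induction c)
    case 0
    then show ?case using Rep_const[OF subfield_0[OF Y(1)]] by simp
  next
    case (pCons b c)
    then have "b \<in> Y" "c \<in> polys_over F"
      using Y(2) unfolding polys_over_def by (auto simp: coeff_pCons split: nat.splits)
    then show ?case using Rep_ring(1)[OF Rep_const Rep_ring(2)[OF that(2)]] pCons.IH by simp
  qed
  have Rep_sum: "Rep (sum f I) (sum f' I)" if "\<And>i. i \<in> I \<Longrightarrow> Rep (f i) (f' i)" for f f' and I :: "nat set"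
    using that
    by (induction I rule: infinite_finite_induct) (auto intro: Rep_ring Rep_const[OF subfield_0[OF Y(1)]])
  have Rep_power: "Rep (z ^ i) (y ^ i)" if "Rep z y" for z y i
    using that by (induction i) (auto intro: Rep_ring Rep_const[OF subfield_1[OF Y(1)]])

  have Rep_H: "\<exists>y. Rep v y" if vH: "v \<in> H" for v
  proof -
    \<comment> \<open>A representation of \<open>v\<close> with denominator of least degree; its
      numerator and denominator cannot both vanish at \<open>a\<close>, since a common linear factor
      would cancel.\<close>
    have "\<exists>fg. fst fg \<in> polys_over Y \<and> snd fg \<in> polys_over Y \<and> poly (snd fg) x \<noteq> 0 \<and>
      v = poly (fst fg) x / poly (snd fg) x"
      using field_gen_simple[OF Y(1), of v x] vH H(3) by (metis fst_conv snd_conv subsetD)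
    then obtain fg where fg: "fst fg \<in> polys_over Y" "snd fg \<in> polys_over Y" "poly (snd fg) x \<noteq> 0"
      "v = poly (fst fg) x / poly (snd fg) x"
      "\<And>h. fst h \<in> polys_over Y \<and> snd h \<in> polys_over Y \<and> poly (snd h) x \<noteq> 0 \<and>
      v = poly (fst h) x / poly (snd h) x \<Longrightarrow> degree (snd fg) \<le> degree (snd h)"
      using ex_has_least_nat[of "\<lambda>fg. fst fg \<in> polys_over Y \<and> snd fg \<in> polys_over Y \<and> poly (snd fg) x \<noteq> 0 \<and>
        v = poly (fst fg) x / poly (snd fg) x" _ "\<lambda>fg. degree (snd fg)"] by blast
    define f g where "f = fst fg" and "g = snd fg"
    note fg = fg[folded f_def g_def]
    show ?thesis
    proof (cases "poly g a = 0")
      case False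
      then show ?thesis unfolding Rep_def using fg by blast
    next
      case True
      let ?l = "[:- a, 1:]"
      have l: "?l \<in> polys_over Y" "?l \<noteq> 0"
        using aY subfield_uminus[OF Y(1)] subfield_1[OF Y(1)]
        by (auto intro!: polys_over_pCons[OF Y(1)] polys_over_0[OF Y(1)])
      have fac: "\<exists>s\<in>polys_over Y. r = ?l * s" if r: "r \<in> polys_over Y" "poly r a = 0" for r
      proof -
        obtain s where s: "s \<in> polys_over Y" "r - ?l * s = 0 \<or> degree (r - ?l * s) < degree ?l"
          using polys_over_division[OF Y(1) l r(1)] by blast
        have "r - ?l * s = 0"
        proof (rule ccontr)
          assume ne: "r - ?l * s \<noteq> 0"
          then have "degree (r - ?l * s) = 0" using s(2) by auto
          then obtain c where c: "r - ?l * s = [:c:]" by (metis degree_eq_zeroE)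
          have "poly (r - ?l * s) a = 0" using r(2) by simp
          then show False using ne unfolding c by simp
        qed
        then show ?thesis using s(1) by (intro bexI[of _ s]) auto
      qed
      have fa: "poly f a \<noteq> 0"
      proof
        assume "poly f a = 0"
        then obtain f' g' where *: "f' \<in> polys_over Y" "g' \<in> polys_over Y" "f = ?l * f'" "g = ?l * g'"
          using fac[OF fg(1)] fac[OF fg(2) True] by blast
        have lx: "poly ?l x \<noteq> 0" using x0[OF l(1)] l(2) by blast
        have "g' \<noteq> 0" "poly g' x \<noteq> 0" using fg(3) *(4) by auto
        moreover have "v = poly f' x / poly g' x" using fg(4) lx unfolding *(3,4) poly_mult by simp
        ultimately have "degree g \<le> degree g'" using fg(5)[of "(f', g')"] * by auto
        moreover have "degree g = Suc (degree g')"
          using \<open>g' \<noteq> 0\<close> unfolding *(4) by (subst degree_mult_eq) auto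
        ultimately show False by simp
      qed
      have vne: "v \<noteq> 0" using fg(3,4) fa x0[OF fg(1)] by auto
      \<comment> \<open>If the denominator vanished at \<open>a\<close>, then \<open>1 / v\<close>
        would have value \<open>0\<close>. The equation of \<open>v\<close> over
        \<open>F(v0)\<close>, divided by \<open>v ^ d\<close>, specialises to its leading
        coefficient at \<open>v1\<close>, which cannot vanish because \<open>v1\<close> is
        transcendental over \<open>F\<close>.\<close>
      define u where "u = inverse v"
      have Rep_u: "Rep u 0"
        unfolding Rep_def u_def using fg fa True by (intro bexI[of _ g] bexI[of _ f]) auto
      have FF: "is_subfield (field_gen (insert v0 F))" by blast
      obtain P where P: "P \<in> polys_over (field_gen (insert v0 F))" "P \<noteq> 0" "poly P v = 0"
        using v0(3) vH unfolding cl_def acl_def algebraic_over_iff by blast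
      define d where "d = degree P"
      obtain c b where cb: "\<And>i. i \<in> {..d} \<Longrightarrow> c i \<in> polys_over F" "b \<in> polys_over F" "poly b v0 \<noteq> 0"
        "\<And>i. i \<in> {..d} \<Longrightarrow> coeff P i = poly (c i) v0 / poly b v0"
        using field_gen_simple_common[OF F, of "{..d}" "coeff P" v0] polys_overD[OF P(1)] by (metis finite_atMost)
      have "Rep (\<Sum>i\<le>d. poly (c i) v0 * u ^ (d - i)) (\<Sum>i\<le>d. poly (c i) v1 * 0 ^ (d - i))"
        using cb(1) Rep_v Rep_u by (intro Rep_sum Rep_ring Rep_poly Rep_power)
      moreover have "(\<Sum>i\<le>d. poly (c i) v0 * u ^ (d - i)) = 0"
      proof -
        have "(\<Sum>i\<le>d. poly (c i) v0 * u ^ (d - i)) = (\<Sum>i\<le>d. poly b v0 * u ^ d * (coeff P i * v ^ i))"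
        proof (intro sum.cong refl)
          fix i assume i: "i \<in> {..d}"
          have "u ^ d * v ^ i = u ^ (d - i)"
            using i vne unfolding u_def by (simp add: power_diff power_inverse field_simps)
          then show "poly (c i) v0 * u ^ (d - i) = poly b v0 * u ^ d * (coeff P i * v ^ i)"
            using cb(3) cb(4)[OF i] by (simp add: field_simps)
        qed
        also have "\<dots> = poly b v0 * u ^ d * poly P v"
          by (simp add: poly_altdef d_def sum_distrib_left)
        finally show ?thesis using P(3) by simp
      qed
      moreover have "(\<Sum>i\<le>d. poly (c i) v1 * 0 ^ (d - i)) = poly (c d) v1"
      proof -
        have "(\<Sum>i\<le>d. poly (c i) v1 * 0 ^ (d - i)) = (\<Sum>i\<le>d. if i = d then poly (c d) v1 else 0)"
          by (intro sum.cong) auto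
        then show ?thesis by simp
      qed
      ultimately have "Rep 0 (poly (c d) v1)" by simp
      then have "poly (c d) v1 = 0" using Rep_unique Rep_const[OF subfield_0[OF Y(1)]] by blast
      then have "c d = 0" using acl_not_poly_root[OF v1] cb(1) by simp
      then have "coeff P d = 0" using cb(4)[of d] by simp
      then show ?thesis using P(2) by (simp add: d_def)
    qed
  qed
  define \<phi> where "\<phi> z = (THE y. Rep z y)" for z
  have \<phi>: "\<phi> z = y" if "Rep z y" for z y unfolding \<phi>_def using that Rep_unique by blast
  have \<phi>H: "Rep z (\<phi> z)" if "z \<in> H" for z using Rep_H[OF that] \<phi> by blast
  have "hom_on H \<phi>"
    unfolding hom_on_def
    using \<phi>[OF Rep_const[OF subfield_1[OF Y(1)]]] \<phi>[OF Rep_ring(1)[OF \<phi>H \<phi>H]] \<phi>[OF Rep_ring(2)[OF \<phi>H \<phi>H]] by blast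
  moreover have "\<phi> ` H \<subseteq> Y" using Rep_Y[OF \<phi>H] by blast
  moreover have "\<forall>c\<in>F. \<phi> c = c" using \<phi>[OF Rep_const] Y(2) by blast
  moreover have "D (\<phi> v0) \<noteq> 0" using \<phi>[OF Rep_v] Dv1 by simp
  ultimately show ?thesis by blast
qed

text \<open>Induction on the number of additional variables. Specialising one of them embeds
  \<open>H\<close> over \<open>F\<close> into a field with fewer variables and keeps
  \<open>D v0 \<noteq> 0\<close>, so the hypotheses hold for the image. \<open>D\<close> annihilates
  all variables except \<open>x\<close>, which is left for \<open>luroth\<close>.\<close>

theorem gordan:
  fixes F :: "'a::field_char_0 set"
  assumes F: "is_subfield F" and "finite S"
    and "indep F (insert x S)" "x \<notin> S"
    and "deriv_on (field_gen (F \<union> insert x S)) D" "\<And>y. y \<in> F \<union> S \<Longrightarrow> D y = 0" "D x = 1"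
    and "is_subfield H" "F \<subseteq> H" "H \<subseteq> field_gen (F \<union> insert x S)"
    and "v0 \<in> H" "D v0 \<noteq> 0" "H \<subseteq> cl (insert v0 F)"
  shows "\<exists>w\<in>H. H = field_gen (insert w F)"
  using assms(2-)
proof (induction S arbitrary: H v0 rule: finite_induct)
  case empty
  have "x \<notin> acl F" using empty.prems(1) F unfolding indep_def cl_def by auto
  moreover have "v0 \<notin> F" using empty.prems by blast
  moreover have "H \<subseteq> field_gen (insert x F)" using empty.prems(8) by simp
  ultimately show ?case using luroth[OF F _ empty.prems(6,7) _ empty.prems(9)] by metis
next
  case (insert s S)
  define Y where "Y = field_gen (F \<union> insert x S)"
  have Y: "is_subfield Y" "F \<subseteq> Y" "x \<in> Y" "S \<subseteq> Y"
    unfolding Y_def using field_gen_superset[of "F \<union> insert x S"] by auto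
  have Zeq: "field_gen (F \<union> insert x (insert s S)) = field_gen (insert s Y)"
    using field_gen_Un_field_gen[of "F \<union> insert x S" "{s}"] unfolding Y_def by (simp add: insert_commute)
  have YZ: "Y \<subseteq> field_gen (insert s Y)" using field_gen_superset[of "insert s Y"] by auto
  have "s \<notin> cl (F \<union> (insert x (insert s S) - {s}))"
    using insert.prems(1) unfolding indep_def by blast
  moreover have "insert x (insert s S) - {s} = insert x S" using insert.hyps(2) insert.prems(2) by auto
  ultimately have s: "s \<notin> acl Y" unfolding Y_def cl_def by simp
  have D: "deriv_on (field_gen (insert s Y)) D" using insert.prems(3) unfolding Zeq .
  have DY: "deriv_on Y D" using D YZ by (rule deriv_on_subset)
  have "Y \<subseteq> {z \<in> Y. D z \<in> Y}"
    unfolding Y_def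
  proof (rule field_gen_least)
    show "is_subfield {z \<in> field_gen (F \<union> insert x S). D z \<in> field_gen (F \<union> insert x S)}"
      using subfield_deriv_preimage[OF Y(1) DY, of Y] subfield_closed[OF Y(1)] unfolding Y_def by blast
    show "F \<union> insert x S \<subseteq> {z \<in> field_gen (F \<union> insert x S). D z \<in> field_gen (F \<union> insert x S)}"
      using insert.prems(4,5) subfield_0[OF Y(1)] subfield_1[OF Y(1)] field_gen_superset[of "F \<union> insert x S"]
      unfolding Y_def by auto
  qed
  then have DYY: "D y \<in> Y" if "y \<in> Y" for y using that by blast
  obtain \<phi> where \<phi>: "hom_on H \<phi>" "\<phi> ` H \<subseteq> Y" "\<And>c. c \<in> F \<Longrightarrow> \<phi> c = c" "D (\<phi> v0) \<noteq> 0"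
    using specialisation[OF F Y(1,2) s D DYY _ _ insert.prems(6,7) _ insert.prems(9-11)]
      insert.prems(4,8) unfolding Zeq by blast
  note h = hom_on_rules[OF insert.prems(6) \<phi>(1)]
  have FH: "F \<subseteq> \<phi> ` H" using insert.prems(7) \<phi>(3) by (metis image_eqI subset_iff)
  have "\<phi> ` H \<subseteq> cl (insert (\<phi> v0) F)"
  proof
    fix y assume "y \<in> \<phi> ` H"
    then obtain z where z: "z \<in> H" "y = \<phi> z" by blast
    obtain P where P: "P \<in> polys_over (field_gen (insert v0 F))" "P \<noteq> 0" "poly P z = 0"
      using insert.prems(11) z(1) unfolding cl_def acl_def algebraic_over_iff by blast
    have sub: "field_gen (insert v0 F) \<subseteq> {z \<in> H. \<phi> z \<in> field_gen (insert (\<phi> v0) F)}"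
      using insert.prems(7,9) \<phi>(3)
      by (intro field_gen_least subfield_hom_preimage[OF insert.prems(6) \<phi>(1)])
        (auto intro: field_gen_incl)
    have PH: "coeff P i \<in> H" "\<phi> (coeff P i) \<in> field_gen (insert (\<phi> v0) F)" for i
      using polys_overD[OF P(1), of i] sub by auto
    have "map_poly \<phi> P \<in> polys_over (field_gen (insert (\<phi> v0) F))"
      using PH(2) h(2) by (auto simp: polys_over_def coeff_map_poly)
    moreover have "poly (map_poly \<phi> P) y = 0"
      using h(9)[of P z] PH(1) z P(3) h(2) by (simp add: polys_over_def)
    moreover have "map_poly \<phi> P \<noteq> 0"
    proof
      assume "map_poly \<phi> P = 0"
      then have "\<phi> (lead_coeff P) = 0" using h(2) by (metis coeff_0 coeff_map_poly)
      then have "lead_coeff P = 0" using h(7) PH(1) by blast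
      then show False using P(2) by simp
    qed
    ultimately show "y \<in> cl (insert (\<phi> v0) F)" unfolding cl_def by (intro acl_poly_root)
  qed
  then have "\<exists>w'\<in>\<phi> ` H. \<phi> ` H = field_gen (insert w' F)"
    using insert.prems(1,2,4,5,9) \<phi>(2,4) DY FH unfolding Y_def
    by (intro insert.IH[of "\<phi> ` H" "\<phi> v0"] subfield_hom_image[OF insert.prems(6) \<phi>(1) insert.prems(6)])
      (auto intro: indep_subset)
  then obtain w where w: "w \<in> H" "\<phi> ` H = field_gen (insert (\<phi> w) F)" by blast
  have wsub: "field_gen (insert w F) \<subseteq> H" using w(1) insert.prems(6,7) by (intro field_gen_least) auto
  have "H \<subseteq> field_gen (insert w F)"
  proof
    fix z assume z: "z \<in> H"
    \<comment> \<open>The image of the field generated by \<open>w\<close> already exhausts the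
      image of \<open>H\<close>; injectivity of \<open>\<phi>\<close> carries this back to
      \<open>H\<close>.\<close>
    have "field_gen (insert (\<phi> w) F) \<subseteq> \<phi> ` field_gen (insert w F)"
    proof (rule field_gen_least)
      show "is_subfield (\<phi> ` field_gen (insert w F))"
        by (rule subfield_hom_image[OF insert.prems(6) \<phi>(1) _ wsub]) blast
      show "insert (\<phi> w) F \<subseteq> \<phi> ` field_gen (insert w F)"
      proof
        fix y assume "y \<in> insert (\<phi> w) F"
        then consider "y = \<phi> w" | "y \<in> F" "y = \<phi> y" using \<phi>(3) by auto
        then show "y \<in> \<phi> ` field_gen (insert w F)"
          by cases (metis field_gen_incl image_eqI insertI1, metis field_gen_incl image_eqI insertI2)
      qed
    qed
    then obtain y where y: "y \<in> field_gen (insert w F)" "\<phi> z = \<phi> y" using z w(2) by blast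
    then have "z = y" using h(8) z wsub by blast
    then show "z \<in> field_gen (insert w F)" using y(1) by simp
  qed
  then show ?case using w(1) wsub by blast
qed

subsection \<open>Counting derivative operators\<close>

definition shift :: "nat \<Rightarrow> (nat \<Rightarrow> nat) \<Rightarrow> nat \<Rightarrow> nat" where
  "shift i e = e(i := Suc (e i))"

definition tadd :: "(nat \<Rightarrow> nat) \<Rightarrow> (nat \<Rightarrow> nat) \<Rightarrow> nat \<Rightarrow> nat" where
  "tadd e f = (\<lambda>i. e i + f i)"

lemma zero_Theta: "(\<lambda>_. 0) \<in> Theta m"
  by (simp add: Theta_def)

lemma shift_Theta: "e \<in> Theta m \<Longrightarrow> i < m \<Longrightarrow> shift i e \<in> Theta m"
  by (auto simp: Theta_def shift_def)

lemma tadd_Theta: "e \<in> Theta m \<Longrightarrow> f \<in> Theta m \<Longrightarrow> tadd e f \<in> Theta m"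
  by (simp add: Theta_def tadd_def)

lemma theta_ord_zero [simp]: "theta_ord m (\<lambda>_. 0) = 0"
  by (simp add: theta_ord_def)

lemma theta_ord_shift: "i < m \<Longrightarrow> theta_ord m (shift i e) = Suc (theta_ord m e)"
  unfolding theta_ord_def shift_def by (simp add: sum.remove[of "{..<m}" i])

lemma theta_ord_tadd: "theta_ord m (tadd e f) = theta_ord m e + theta_ord m f"
  by (simp add: theta_ord_def tadd_def sum.distrib)

lemma shift_commute: "shift i (shift j e) = shift j (shift i e)"
  by (auto simp: shift_def)

lemma tadd_shift: "tadd (shift i e) f = shift i (tadd e f)" "tadd e (shift i f) = shift i (tadd e f)"
  by (auto simp: shift_def tadd_def)

lemma tadd_zero [simp]: "tadd (\<lambda>_. 0) e = e" "tadd e (\<lambda>_. 0) = e"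
  by (auto simp: tadd_def)

lemma tadd_commute: "tadd e f = tadd f e"
  by (auto simp: tadd_def add.commute)

lemma tadd_left_cancel: "tadd e f = tadd e g \<longleftrightarrow> f = g"
  by (auto simp: tadd_def fun_eq_iff)

lemma theta_induct [consumes 1, case_names zero shift]:
  assumes "e \<in> Theta m" "P (\<lambda>_. 0)" "\<And>e i. e \<in> Theta m \<Longrightarrow> i < m \<Longrightarrow> P e \<Longrightarrow> P (shift i e)"
  shows "P e"
  using assms(1)
proof (induction "theta_ord m e" arbitrary: e)
  case 0
  have "e = (\<lambda>_. 0)"
  proof
    fix i show "e i = 0" using 0 by (cases "i < m") (auto simp: theta_ord_def Theta_def)
  qed
  then show ?case using assms(2) by simp
next
  case (Suc k)
  then have "\<exists>i<m. e i \<noteq> 0" by (metis theta_ord_def lessThan_iff sum.neutral nat.distinct(1))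
  then obtain i where i: "i < m" "e i \<noteq> 0" by blast
  define f where "f = e(i := e i - 1)"
  have e: "e = shift i f" using i by (auto simp: f_def shift_def)
  have f: "f \<in> Theta m" using Suc.prems i by (auto simp: f_def Theta_def)
  have "k = theta_ord m f" using Suc.hyps(2) theta_ord_shift[OF i(1), of f] unfolding e by simp
  then show ?case using Suc.hyps(1) f assms(3) i(1) e by blast
qed

text \<open>Pascal's rule: an operator either omits the last derivation or has one factor of it
  split off.\<close>

lemma card_Theta_ord_le: "card {e \<in> Theta m. theta_ord m e \<le> t} = (t + m) choose m"
  and finite_Theta_ord_le: "finite {e \<in> Theta m. theta_ord m e \<le> t}"
proof -
  have "finite {e \<in> Theta m. theta_ord m e \<le> t} \<and> card {e \<in> Theta m. theta_ord m e \<le> t} = (t + m) choose m"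
  proof (induction m arbitrary: t)
    case 0
    have "{e \<in> Theta 0. theta_ord 0 e \<le> t} = {\<lambda>_. 0}" by (auto simp: Theta_def theta_ord_def)
    then show ?case by simp
  next
    case (Suc m)
    show ?case
    proof (induction t)
      case 0
      have "{e \<in> Theta (Suc m). theta_ord (Suc m) e \<le> 0} = {\<lambda>_. 0}"
      proof (intro equalityI subsetI)
        fix e assume e: "e \<in> {e \<in> Theta (Suc m). theta_ord (Suc m) e \<le> 0}"
        have "e i = 0" for i using e by (cases "i < Suc m") (auto simp: theta_ord_def Theta_def less_Suc_eq)
        then show "e \<in> {\<lambda>_. 0}" by auto
      qed (simp add: Theta_def)
      then show ?case by simp
    next
      case (Suc t)
      let ?A = "{e \<in> Theta m. theta_ord m e \<le> Suc t}" and ?B = "{e \<in> Theta (Suc m). theta_ord (Suc m) e \<le> t}"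
      have eq: "{e \<in> Theta (Suc m). theta_ord (Suc m) e \<le> Suc t} = ?A \<union> shift m ` ?B"
      proof (rule set_eqI, rule iffI)
        fix e assume e: "e \<in> {e \<in> Theta (Suc m). theta_ord (Suc m) e \<le> Suc t}"
        show "e \<in> ?A \<union> shift m ` ?B"
        proof (cases "e m = 0")
          case True
          have "e i = 0" if "i \<ge> m" for i using e True that by (cases "i = m") (auto simp: Theta_def)
          then have "e \<in> ?A" using e True by (simp add: Theta_def theta_ord_def)
          then show ?thesis by blast
        next
          case False
          define f where "f = e(m := e m - 1)"
          have ef: "e = shift m f" using False by (auto simp: f_def shift_def)
          have "f \<in> Theta (Suc m)" using e by (auto simp: f_def Theta_def)
          moreover have "theta_ord (Suc m) f \<le> t" using e theta_ord_shift[of m "Suc m" f] unfolding ef by simp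
          ultimately show ?thesis using ef by blast
        qed
      next
        fix e assume "e \<in> ?A \<union> shift m ` ?B"
        then show "e \<in> {e \<in> Theta (Suc m). theta_ord (Suc m) e \<le> Suc t}"
          using theta_ord_shift[of m "Suc m"] shift_Theta[of _ "Suc m" m]
          by (auto simp: Theta_def theta_ord_def)
      qed
      have "?A \<inter> shift m ` ?B = {}" by (auto simp: Theta_def shift_def)
      moreover have "inj_on (shift m) ?B"
      proof (rule inj_onI, rule ext)
        fix e f i assume "shift m e = shift m f"
        then have "shift m e i = shift m f i" by simp
        then show "e i = f i" by (simp add: shift_def split: if_splits)
      qed
      ultimately have "card (?A \<union> shift m ` ?B) = card ?A + card ?B"
        using Suc.IH \<open>\<And>t. finite {e \<in> Theta m. theta_ord m e \<le> t} \<and> card {e \<in> Theta m. theta_ord m e \<le> t} = (t + m) choose m\<close>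
        by (subst card_Un_disjoint) (auto simp: card_image)
      then show ?case
        using Suc.IH \<open>\<And>t. finite {e \<in> Theta m. theta_ord m e \<le> t} \<and> card {e \<in> Theta m. theta_ord m e \<le> t} = (t + m) choose m\<close>
        unfolding eq by simp
    qed
  qed
  then show "card {e \<in> Theta m. theta_ord m e \<le> t} = (t + m) choose m" "finite {e \<in> Theta m. theta_ord m e \<le> t}"
    by auto
qed

lemma card_Theta_translate:
  assumes "a \<in> Theta m" "theta_ord m a \<le> t"
  shows "card {e \<in> tadd a ` Theta m. theta_ord m e \<le> t} = (t - theta_ord m a + m) choose m"
proof -
  have "{e \<in> tadd a ` Theta m. theta_ord m e \<le> t} = tadd a ` {e \<in> Theta m. theta_ord m e \<le> t - theta_ord m a}"
    using assms(2) by (auto simp: theta_ord_tadd)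
  moreover have "inj_on (tadd a) X" for X by (simp add: inj_on_def tadd_left_cancel)
  ultimately show ?thesis by (simp add: card_image card_Theta_ord_le)
qed

lemma binomial_ratio_limit:
  "(\<lambda>t. real ((t + k + m) choose m) / real ((t + m) choose m)) \<longlonglongrightarrow> 1"
proof (induction k)
  case 0
  have "real ((t + m) choose m) \<noteq> 0" for t by (simp add: binomial_eq_0_iff)
  then show ?case by simp
next
  case (Suc k)
  have step: "real ((t + Suc k + m) choose m) = (1 + real m / real (t + Suc k)) * real ((t + k + m) choose m)" for t
  proof -
    have "(t + Suc k) * ((t + Suc k + m) choose m) = (t + Suc k + m) * ((t + k + m) choose m)"
      using binomial_absorb_comp[of "t + Suc k + m" m] by simp
    then have "real (t + Suc k) * real ((t + Suc k + m) choose m) = real (t + Suc k + m) * real ((t + k + m) choose m)"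
      by (metis of_nat_mult)
    then show ?thesis by (simp add: field_simps)
  qed
  have "(\<lambda>t. real m / real (t + Suc k)) \<longlonglongrightarrow> 0"
    using LIMSEQ_ignore_initial_segment[OF lim_const_over_n[of "real m"], of "Suc k"] by simp
  then have "(\<lambda>t. (1 + real m / real (t + Suc k)) * (real ((t + k + m) choose m) / real ((t + m) choose m))) \<longlonglongrightarrow> (1 + 0) * 1"
    by (intro tendsto_intros Suc.IH)
  then show ?case unfolding step by (simp del: of_nat_Suc of_nat_add)
qed

text \<open>A shift of the argument does not affect the leading coefficient. This excludes a second
  family of derivatives in two places: among the leaders and among the differentiated coefficients
  of a relation.\<close>

lemma binomial_eventually_less_double:
  "\<forall>\<^sub>F t in sequentially. (t + k + m) choose m < 2 * ((t + m) choose m)"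
proof -
  have "\<forall>\<^sub>F t in sequentially. real ((t + k + m) choose m) / real ((t + m) choose m) < 2"
    using binomial_ratio_limit[of k m] by (rule order_tendstoD) simp
  then show ?thesis
  proof eventually_elim
    case (elim t)
    have "(t + m) choose m > 0" by simp
    then have "real ((t + k + m) choose m) < 2 * real ((t + m) choose m)" using elim by (simp add: field_simps)
    then have "real ((t + k + m) choose m) < real (2 * ((t + m) choose m))" by simp
    then show ?case by (simp only: of_nat_less_iff)
  qed
qed

section \<open>Ideals of derivative operators and their counting functions\<close>

lemma binomial_strict_mono_lower: "0 < m \<Longrightarrow> i < j \<Longrightarrow> (i + m) choose m < (j + m) choose m"
proof (induction j)
  case (Suc j)
  obtain k where k: "m = Suc k" using Suc.prems by (cases m) auto
  have "(Suc j + m) choose m = ((j + m) choose m) + ((j + m) choose k)" by (simp add: k)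
  moreover have "(j + m) choose k > 0" by (simp add: k)
  ultimately have "(j + m) choose m < (Suc j + m) choose m" by simp
  then show ?case using Suc by (cases "i = j") auto
qed simp

lemma card_Theta_box:
  assumes "\<And>i. i < m \<Longrightarrow> finite (B i)"
  shows "card {f \<in> Theta m. \<forall>i<m. f i \<in> B i} \<le> (\<Prod>i<m. card (B i))"
    and "finite {f \<in> Theta m. \<forall>i<m. f i \<in> B i}"
proof -
  let ?S = "{f \<in> Theta m. \<forall>i<m. f i \<in> B i}"
  let ?r = "\<lambda>f. restrict f {..<m}"
  have inj: "inj_on ?r ?S"
  proof (rule inj_onI)
    fix f g assume fg: "f \<in> ?S" "g \<in> ?S" "?r f = ?r g"
    show "f = g"
    proof
      fix i show "f i = g i"
        using fg(1,2) fun_cong[OF fg(3), of i] by (cases "i < m") (simp_all add: Theta_def)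
    qed
  qed
  have sub: "?r ` ?S \<subseteq> PiE {..<m} B"
    by (auto simp: restrict_def PiE_def extensional_def)
  have fin: "finite (PiE {..<m} B)" using assms by (intro finite_PiE) auto
  show "finite ?S" by (rule finite_imageD[OF finite_subset[OF sub fin] inj])
  have "card ?S = card (?r ` ?S)" using inj by (simp add: card_image)
  also have "\<dots> \<le> card (PiE {..<m} B)" using fin sub by (rule card_mono)
  also have "\<dots> = (\<Prod>i<m. card (B i))" by (simp add: card_PiE)
  finally show "card ?S \<le> (\<Prod>i<m. card (B i))" .
qed

text \<open>Outside an ideal without common divisor, two coordinates are bounded.\<close>

lemma card_complement_bound:
  assumes m: "1 < m" and U: "\<And>f g. f \<in> U \<Longrightarrow> g \<in> Theta m \<Longrightarrow> tadd f g \<in> U" "U \<subseteq> Theta m"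
    and c: "\<And>i. i < m \<Longrightarrow> \<exists>f\<in>U. f i = 0"
  shows "\<exists>C. \<forall>T. card {f \<in> Theta m - U. theta_ord m f \<le> T} \<le> C * (T + 1) ^ (m - 2)"
proof -
  obtain h where h: "\<And>i. i < m \<Longrightarrow> h i \<in> U" "\<And>i. i < m \<Longrightarrow> h i i = 0" using c by metis
  define M where "M = Max ((\<lambda>(i, k). h i k) ` ({..<m} \<times> {..<m}))"
  have M: "h i k \<le> M" if "i < m" "k < m" for i k
    unfolding M_def using that by (intro Max_ge) (auto intro: rev_image_eqI[of "(i, k)"])
  \<comment> \<open>If all coordinates of \<open>f\<close> other than the \<open>i\<close>-th were
    at least \<open>M\<close>, then \<open>f\<close> would be a multiple of \<open>h i\<close>,
    whose \<open>i\<close>-th coordinate is \<open>0\<close>.\<close>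
  have low: "\<exists>k<m. k \<noteq> i \<and> f k < M" if f: "f \<in> Theta m - U" and i: "i < m" for f i
  proof (rule ccontr)
    assume "\<not> ?thesis"
    then have ge: "M \<le> f k" if "k < m" "k \<noteq> i" for k using that by (metis not_less)
    have "h i k \<le> f k" if "k < m" for k
      using that h(2)[OF i] M[OF i that] ge[OF that] by (cases "k = i") auto
    moreover have "h i k = 0" "f k = 0" if "k \<ge> m" for k using h(1)[OF i] U(2) f that by (auto simp: Theta_def)
    ultimately have le: "h i k \<le> f k" for k by (cases "k < m") auto
    have "f = tadd (h i) (\<lambda>k. f k - h i k)" using le by (auto simp: tadd_def)
    moreover have "(\<lambda>k. f k - h i k) \<in> Theta m" using f by (auto simp: Theta_def)
    ultimately have "f \<in> U" using U(1)[OF h(1)[OF i]] by metis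
    then show False using f by blast
  qed
  \<comment> \<open>Two coordinates are confined to a range independent of \<open>T\<close>; the
    remaining \<open>m - 2\<close> give the exponent in the bound.\<close>
  define Box where "Box T p = {f \<in> Theta m. \<forall>i<m. f i \<in> (if i = fst p \<or> i = snd p then {..<M} else {..T})}"
    for T :: nat and p :: "nat \<times> nat"
  define I where "I = {p. fst p < m \<and> snd p < m \<and> fst p \<noteq> snd p}"
  have finI: "finite I" by (rule finite_subset[of _ "{..<m} \<times> {..<m}"]) (auto simp: I_def)
  have box: "card (Box T p) \<le> M\<^sup>2 * (T + 1) ^ (m - 2)" "finite (Box T p)" if "p \<in> I" for T p
  proof -
    let ?B = "\<lambda>i. if i = fst p \<or> i = snd p then {..<M} else {..T}"
    have "card (Box T p) \<le> (\<Prod>i<m. card (?B i))" "finite (Box T p)"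
      unfolding Box_def using card_Theta_box[of m ?B] by auto
    moreover have "(\<Prod>i<m. card (?B i)) = (\<Prod>i\<in>{fst p, snd p}. card (?B i)) * (\<Prod>i\<in>{..<m} - {fst p, snd p}. card (?B i))"
      using that by (subst prod.subset_diff[of "{fst p, snd p}"]) (auto simp: I_def)
    moreover have "(\<Prod>i\<in>{fst p, snd p}. card (?B i)) = M\<^sup>2"
      using that by (simp add: I_def power2_eq_square)
    moreover have "(\<Prod>i\<in>{..<m} - {fst p, snd p}. card (?B i)) = (\<Prod>i\<in>{..<m} - {fst p, snd p}. T + 1)"
      by (intro prod.cong) auto
    moreover have "card ({..<m} - {fst p, snd p}) = m - 2"
      using that by (subst card_Diff_subset) (auto simp: I_def)
    ultimately show "card (Box T p) \<le> M\<^sup>2 * (T + 1) ^ (m - 2)" "finite (Box T p)" by simp_all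
  qed
  have "card {f \<in> Theta m - U. theta_ord m f \<le> T} \<le> card I * M\<^sup>2 * (T + 1) ^ (m - 2)" for T
  proof -
    have "{f \<in> Theta m - U. theta_ord m f \<le> T} \<subseteq> (\<Union>p\<in>I. Box T p)"
    proof
      fix f assume f: "f \<in> {f \<in> Theta m - U. theta_ord m f \<le> T}"
      have fT: "f i \<le> T" if "i < m" for i
        using f that member_le_sum[of i "{..<m}" f] by (auto simp: theta_ord_def)
      obtain k where k: "k < m" "f k < M" using low[of f 0] f m by auto
      obtain l where l: "l < m" "l \<noteq> k" "f l < M" using low[of f k] f k(1) by auto
      have "(k, l) \<in> I" "f \<in> Box T (k, l)" using k l f fT by (auto simp: I_def Box_def)
      then show "f \<in> (\<Union>p\<in>I. Box T p)" by blast
    qed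
    then have "card {f \<in> Theta m - U. theta_ord m f \<le> T} \<le> card (\<Union>p\<in>I. Box T p)"
      using finI box(2) by (intro card_mono) auto
    also have "\<dots> \<le> (\<Sum>p\<in>I. card (Box T p))" using finI by (rule card_UN_le)
    also have "\<dots> \<le> (\<Sum>p\<in>I. M\<^sup>2 * (T + 1) ^ (m - 2))" using box(1) by (intro sum_mono)
    finally show ?thesis by simp
  qed
  then show ?thesis by blast
qed

text \<open>\<open>a\<close> is the greatest common divisor of \<open>U\<close>, the componentwise
  minimum, and \<open>W\<close> is the quotient. If \<open>W\<close> were proper, then
  \<open>s\<close> would exceed the order of \<open>a\<close>, and the prescribed count would leave
  a complement growing like \<open>T ^ (m - 1)\<close>; but \<open>W\<close> has no common divisor,
  so its complement grows at most like \<open>T ^ (m - 2)\<close>.\<close>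

lemma Theta_ideal_principal:
  assumes m: "1 < m" and U: "\<And>f g. f \<in> U \<Longrightarrow> g \<in> Theta m \<Longrightarrow> tadd f g \<in> U" "U \<subseteq> Theta m" "U \<noteq> {}"
    and cnt: "\<forall>\<^sub>F t in sequentially. card {f \<in> U. theta_ord m f \<le> t} = (t - s + m) choose m"
  shows "\<exists>a\<in>Theta m. theta_ord m a = s \<and> U = tadd a ` Theta m"
proof -
  define a where "a i = (LEAST k. \<exists>f\<in>U. f i = k)" for i
  have aU: "\<exists>f\<in>U. f i = a i" for i
  proof -
    have "\<exists>k. \<exists>f\<in>U. f i = k" using U(3) by blast
    from LeastI_ex[OF this] show ?thesis unfolding a_def .
  qed
  have ale: "a i \<le> f i" if "f \<in> U" for f i
  proof -
    have "\<exists>g\<in>U. g i = f i" using that by blast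
    from Least_le[of "\<lambda>k. \<exists>g\<in>U. g i = k", OF this] show ?thesis unfolding a_def .
  qed
  have aT: "a \<in> Theta m"
    unfolding Theta_def
  proof (intro CollectI allI impI)
    fix i assume i: "i \<ge> m"
    obtain f where "f \<in> U" "f i = a i" using aU by blast
    then show "a i = 0" using U(2) i by (auto simp: Theta_def)
  qed
  define W where "W = {g \<in> Theta m. tadd a g \<in> U}"
  have UW: "U = tadd a ` W"
  proof
    show "U \<subseteq> tadd a ` W"
    proof
      fix f assume f: "f \<in> U"
      have "f = tadd a (\<lambda>i. f i - a i)" using ale[OF f] by (auto simp: tadd_def)
      moreover have "(\<lambda>i. f i - a i) \<in> Theta m" using f U(2) by (auto simp: Theta_def)
      ultimately show "f \<in> tadd a ` W" using f unfolding W_def by (metis (mono_tags, lifting) image_eqI mem_Collect_eq)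
    qed
  qed (auto simp: W_def)
  define r where "r = theta_ord m a"
  have inj: "inj_on (tadd a) X" for X by (simp add: inj_on_def tadd_left_cancel)
  have cU: "card {f \<in> U. theta_ord m f \<le> T + r} = card {g \<in> W. theta_ord m g \<le> T}" for T
  proof -
    have "{f \<in> U. theta_ord m f \<le> T + r} = tadd a ` {g \<in> W. theta_ord m g \<le> T}"
      unfolding UW by (auto simp: theta_ord_tadd r_def)
    then show ?thesis by (simp add: card_image[OF inj])
  qed
  obtain N where N: "\<And>t. t \<ge> N \<Longrightarrow> card {f \<in> U. theta_ord m f \<le> t} = (t - s + m) choose m"
    using cnt unfolding eventually_sequentially by blast
  have W: "card {g \<in> W. theta_ord m g \<le> T} = (T + r - s + m) choose m" if "T \<ge> N" for T
    using N[of "T + r"] cU[of T] that by simp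
  have finT: "finite {g \<in> Theta m. theta_ord m g \<le> T}" for T by (rule finite_Theta_ord_le)
  have WT: "W \<subseteq> Theta m" by (auto simp: W_def)
  show ?thesis
  proof (cases "W = Theta m")
    case True
    let ?T = "N + s"
    have "(?T + m) choose m = (?T + r - s + m) choose m"
      using W[of ?T] card_Theta_ord_le[of m ?T] True by simp
    then have "?T = ?T + r - s"
      using binomial_strict_mono_lower[of m ?T "?T + r - s"] binomial_strict_mono_lower[of m "?T + r - s" ?T] m
      by (metis less_irrefl linorder_neqE_nat less_trans zero_less_one)
    then have "r = s" by simp
    then show ?thesis using aT UW True unfolding r_def by blast
  next
    case False
    then obtain g0 where g0: "g0 \<in> Theta m" "g0 \<notin> W" using WT by blast
    have lt: "(T + r - s + m) choose m < (T + m) choose m" if "T \<ge> N" "T \<ge> theta_ord m g0" for T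
    proof -
      have "{g \<in> W. theta_ord m g \<le> T} \<subset> {g \<in> Theta m. theta_ord m g \<le> T}" using g0 WT that by auto
      then have "card {g \<in> W. theta_ord m g \<le> T} < card {g \<in> Theta m. theta_ord m g \<le> T}"
        using finT by (intro psubset_card_mono)
      then show ?thesis using W[OF that(1)] by (simp add: card_Theta_ord_le)
    qed
    \<comment> \<open>For \<open>s \<le> r\<close> the prescribed count of \<open>W\<close> would
      reach that of all of \<open>Theta m\<close>.\<close>
    have rs: "r < s"
    proof (rule ccontr)
      assume "\<not> r < s"
      define T where "T = N + theta_ord m g0"
      have "T \<le> T + r - s" using \<open>\<not> r < s\<close> by simp
      then have "(T + m) choose m \<le> (T + r - s + m) choose m" by (intro binomial_right_mono) simp
      then show False using lt[of T] by (simp add: T_def)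
    qed
    have "\<exists>f\<in>W. f i = 0" if "i < m" for i
    proof -
      obtain f where f: "f \<in> U" "f i = a i" using aU by blast
      then obtain g where "g \<in> W" "f = tadd a g" using UW by blast
      then show ?thesis using f(2) by (auto simp: tadd_def)
    qed
    moreover have "tadd f g \<in> W" if "f \<in> W" "g \<in> Theta m" for f g
    proof -
      have "tadd a (tadd f g) = tadd (tadd a f) g" by (simp add: tadd_def add.assoc)
      then show ?thesis using that U(1)[of "tadd a f" g] tadd_Theta unfolding W_def by auto
    qed
    ultimately obtain C where C: "\<And>T. card {f \<in> Theta m - W. theta_ord m f \<le> T} \<le> C * (T + 1) ^ (m - 2)"
      using card_complement_bound[OF m, of W] WT by blast
    \<comment> \<open>The right-hand side is free of \<open>T\<close>, so a large \<open>T\<close>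
      gives the contradiction. The factor \<open>(m - 1) ^ (m - 1)\<close> stems from the estimate
      \<open>n choose k \<ge> (n / k) ^ k\<close>.\<close>
    have bound: "T + 1 \<le> (m - 1) ^ (m - 1) * C" if T: "T \<ge> N" "T \<ge> 1" for T
    proof -
      have "{f \<in> Theta m - W. theta_ord m f \<le> T} = {f \<in> Theta m. theta_ord m f \<le> T} - {f \<in> W. theta_ord m f \<le> T}"
        by auto
      moreover have "{f \<in> W. theta_ord m f \<le> T} \<subseteq> {f \<in> Theta m. theta_ord m f \<le> T}" using WT by auto
      ultimately have "card {f \<in> Theta m - W. theta_ord m f \<le> T} = ((T + m) choose m) - ((T + r - s + m) choose m)"
        using finT[of T] W[OF T(1)] by (simp add: card_Diff_subset finite_subset card_Theta_ord_le)
      moreover have "(T + r - s + m) choose m \<le> (T - 1 + m) choose m" using rs by (intro binomial_right_mono) simp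
      moreover have "((T + m) choose m) = ((T - 1 + m) choose m) + ((T + m - 1) choose (m - 1))"
        using T(2) m by (cases T; cases m) auto
      ultimately have "(T + m - 1) choose (m - 1) \<le> C * (T + 1) ^ (m - 2)" using C[of T] by linarith
      moreover have "(T + 1) ^ (m - 1) \<le> (m - 1) ^ (m - 1) * ((T + m - 1) choose (m - 1))"
      proof -
        have "(real (T + m - 1) / real (m - 1)) ^ (m - 1) \<le> real ((T + m - 1) choose (m - 1))"
          using binomial_ge_n_over_k_pow_k[of "m - 1" "T + m - 1", where 'a = real] T by simp
        then have "real (T + m - 1) ^ (m - 1) \<le> real (m - 1) ^ (m - 1) * real ((T + m - 1) choose (m - 1))"
          using m by (simp add: power_divide field_simps)
        then have "real ((T + m - 1) ^ (m - 1)) \<le> real ((m - 1) ^ (m - 1) * ((T + m - 1) choose (m - 1)))"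
          by simp
        then have "(T + m - 1) ^ (m - 1) \<le> (m - 1) ^ (m - 1) * ((T + m - 1) choose (m - 1))"
          by (simp only: of_nat_le_iff)
        moreover have "(T + 1) ^ (m - 1) \<le> (T + m - 1) ^ (m - 1)" using m by (intro power_mono) auto
        ultimately show ?thesis by linarith
      qed
      ultimately have "(T + 1) ^ (m - 1) \<le> (m - 1) ^ (m - 1) * (C * (T + 1) ^ (m - 2))"
        by (meson le_trans mult_le_mono2)
      moreover have "(T + 1) ^ (m - 1) = (T + 1) * (T + 1) ^ (m - 2)"
        using m by (metis Suc_diff_Suc numeral_2_eq_2 One_nat_def power_Suc)
      ultimately have "(T + 1) * (T + 1) ^ (m - 2) \<le> ((m - 1) ^ (m - 1) * C) * (T + 1) ^ (m - 2)"
        by (simp add: mult.assoc)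
      then show ?thesis by (metis mult_le_cancel2 zero_less_power add_gr_0 zero_less_one)
    qed
    have "N + 1 + (m - 1) ^ (m - 1) * C + 1 \<le> (m - 1) ^ (m - 1) * C"
      by (rule bound) auto
    then show ?thesis by simp
  qed
qed

text \<open>Each index \<open>j\<close> occurring in \<open>E\<close> contributes all multiples of
  one of its elements, whose count has the leading coefficient of a full binomial. Two indices would
  double it, so \<open>E\<close> lives in a single copy of \<open>Theta m\<close>.\<close>

lemma kolchin_principal:
  fixes n :: nat
  assumes m: "1 < m" and E: "E \<subseteq> Theta m \<times> {..<n}"
    and up: "\<And>e j i. (e, j) \<in> E \<Longrightarrow> i < m \<Longrightarrow> (shift i e, j) \<in> E"
    and cnt: "\<forall>\<^sub>F t in sequentially. card {\<eta> \<in> E. theta_ord m (fst \<eta>) \<le> t} = (t - s + m) choose m"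
  shows "\<exists>a\<in>Theta m. \<exists>j<n. theta_ord m a = s \<and> E = (\<lambda>f. (tadd a f, j)) ` Theta m"
proof -
  have up': "(tadd e f, j) \<in> E" if "(e, j) \<in> E" "f \<in> Theta m" for e f j
    using that(2)
  proof (induction f rule: theta_induct)
    case (shift f i)
    then show ?case using up[of "tadd e f" j i] by (simp add: tadd_shift)
  qed (use that(1) in simp)
  obtain N where N: "\<And>t. t \<ge> N \<Longrightarrow> card {\<eta> \<in> E. theta_ord m (fst \<eta>) \<le> t} = (t - s + m) choose m"
    using cnt unfolding eventually_sequentially by blast
  have fin: "finite {\<eta> \<in> E. theta_ord m (fst \<eta>) \<le> t}" for t
    using E by (intro finite_subset[OF _ finite_cartesian_product[OF finite_Theta_ord_le[of m t] finite_lessThan[of n]]]) auto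
  have "card {\<eta> \<in> E. theta_ord m (fst \<eta>) \<le> N} > 0" using N[of N] by simp
  then have "{\<eta> \<in> E. theta_ord m (fst \<eta>) \<le> N} \<noteq> {}" by force
  then obtain e0 j0 where e0: "(e0, j0) \<in> E" by auto
  have e0T: "e0 \<in> Theta m" "j0 < n" using e0 E by auto
  have only: "j = j0" if ej: "(e, j) \<in> E" for e j
  proof (rule ccontr)
    assume "j \<noteq> j0"
    have eT: "e \<in> Theta m" using ej E by auto
    define c where "c = max (theta_ord m e0) (theta_ord m e)"
    obtain N' where N': "\<And>t. t \<ge> N' \<Longrightarrow> (t + c + m) choose m < 2 * ((t + m) choose m)"
      using binomial_eventually_less_double[of c m] unfolding eventually_sequentially by blast
    define T where "T = N + N'"
    define t where "t = T + c"
    let ?A = "\<lambda>e. {e' \<in> tadd e ` Theta m. theta_ord m e' \<le> t}"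
    have cA: "(T + m) choose m \<le> card (?A e')" if "e' \<in> Theta m" "theta_ord m e' \<le> c" for e'
    proof -
      have "card (?A e') = (t - theta_ord m e' + m) choose m"
        using that by (intro card_Theta_translate) (auto simp: t_def)
      moreover have "T \<le> t - theta_ord m e'" using that(2) by (simp add: t_def)
      ultimately show ?thesis by (simp add: binomial_right_mono)
    qed
    have finA: "finite (?A e')" if "e' \<in> Theta m" for e'
      by (rule finite_subset[OF _ finite_Theta_ord_le[of m t]]) (use that tadd_Theta in auto)
    have "(?A e0 \<times> {j0}) \<union> (?A e \<times> {j}) \<subseteq> {\<eta> \<in> E. theta_ord m (fst \<eta>) \<le> t}"
      using up' e0 ej by auto
    from card_mono[OF fin this] have "card ((?A e0 \<times> {j0}) \<union> (?A e \<times> {j})) \<le> (t - s + m) choose m"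
      using N[of t] by (simp add: t_def T_def)
    moreover have "card ((?A e0 \<times> {j0}) \<union> (?A e \<times> {j})) = card (?A e0) + card (?A e)"
      using \<open>j \<noteq> j0\<close> finA e0T(1) eT by (subst card_Un_disjoint) (auto simp: card_cartesian_product)
    moreover have "(T + m) choose m \<le> card (?A e0)" "(T + m) choose m \<le> card (?A e)"
      using cA e0T eT by (auto simp: c_def)
    moreover have "(t - s + m) choose m \<le> (T + c + m) choose m" by (intro binomial_right_mono) (simp add: t_def)
    moreover have "(T + c + m) choose m < 2 * ((T + m) choose m)" by (rule N') (simp add: T_def)
    ultimately show False by linarith
  qed
  define U where "U = fst ` E"
  have EU: "E = (\<lambda>f. (f, j0)) ` U"
  proof (intro equalityI subsetI)
    fix \<eta> assume "\<eta> \<in> E"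
    then show "\<eta> \<in> (\<lambda>f. (f, j0)) ` U" using only[of "fst \<eta>" "snd \<eta>"] unfolding U_def
      by (intro image_eqI[of _ _ "fst \<eta>"]) (auto simp: prod_eq_iff)
  next
    fix \<eta> assume "\<eta> \<in> (\<lambda>f. (f, j0)) ` U"
    then obtain \<zeta> where "\<zeta> \<in> E" "\<eta> = (fst \<zeta>, j0)" unfolding U_def by auto
    then show "\<eta> \<in> E" using only[of "fst \<zeta>" "snd \<zeta>"] by simp
  qed
  have "\<exists>a\<in>Theta m. theta_ord m a = s \<and> U = tadd a ` Theta m"
  proof (rule Theta_ideal_principal[OF m])
    show "tadd f g \<in> U" if "f \<in> U" "g \<in> Theta m" for f g
    proof -
      have "(f, j0) \<in> E" using that(1) EU by blast
      then have "(tadd f g, j0) \<in> E" using up' that(2) by blast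
      then show ?thesis unfolding U_def by (metis fst_conv image_eqI)
    qed
    show "U \<subseteq> Theta m" "U \<noteq> {}" using E e0 unfolding U_def by auto
    have "{\<eta> \<in> E. theta_ord m (fst \<eta>) \<le> t} = (\<lambda>f. (f, j0)) ` {f \<in> U. theta_ord m f \<le> t}" for t
      unfolding EU by auto
    then have "card {\<eta> \<in> E. theta_ord m (fst \<eta>) \<le> t} = card {f \<in> U. theta_ord m f \<le> t}" for t
      by (simp add: card_image inj_on_def)
    then show "\<forall>\<^sub>F t in sequentially. card {f \<in> U. theta_ord m f \<le> t} = (t - s + m) choose m"
      using cnt by simp
  qed
  then obtain a where a: "a \<in> Theta m" "theta_ord m a = s" "U = tadd a ` Theta m" by blast
  then have "E = (\<lambda>f. (tadd a f, j0)) ` Theta m" unfolding EU a(3) by (simp add: image_image)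
  then show ?thesis using a e0T(2) by blast
qed

subsection \<open>Orderly rankings\<close>

definition vshift :: "nat \<Rightarrow> (nat \<Rightarrow> nat) \<times> nat \<Rightarrow> (nat \<Rightarrow> nat) \<times> nat" where
  "vshift i \<eta> = (shift i (fst \<eta>), snd \<eta>)"

definition vadd :: "(nat \<Rightarrow> nat) \<Rightarrow> (nat \<Rightarrow> nat) \<times> nat \<Rightarrow> (nat \<Rightarrow> nat) \<times> nat" where
  "vadd e \<eta> = (tadd e (fst \<eta>), snd \<eta>)"

text \<open>Order first, then the lexicographic comparison of exponent vectors, with ties broken by
  the index of the indeterminate.\<close>

definition orderly_less :: "nat \<Rightarrow> (nat \<Rightarrow> nat) \<times> nat \<Rightarrow> (nat \<Rightarrow> nat) \<times> nat \<Rightarrow> bool" where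
  "orderly_less m \<eta> \<zeta> \<longleftrightarrow> theta_ord m (fst \<eta>) < theta_ord m (fst \<zeta>) \<or>
     (theta_ord m (fst \<eta>) = theta_ord m (fst \<zeta>) \<and>
       ((\<exists>i. fst \<eta> i < fst \<zeta> i \<and> (\<forall>k<i. fst \<eta> k = fst \<zeta> k)) \<or> (fst \<eta> = fst \<zeta> \<and> snd \<eta> < snd \<zeta>)))"

lemma orderly_less_irrefl: "\<not> orderly_less m \<eta> \<eta>"
  by (simp add: orderly_less_def)

lemma orderly_less_trans:
  assumes "orderly_less m \<eta> \<zeta>" "orderly_less m \<zeta> \<xi>"
  shows "orderly_less m \<eta> \<xi>"
proof (cases "theta_ord m (fst \<eta>) < theta_ord m (fst \<xi>)")
  case False
  then have o: "theta_ord m (fst \<eta>) = theta_ord m (fst \<zeta>)" "theta_ord m (fst \<zeta>) = theta_ord m (fst \<xi>)"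
    using assms unfolding orderly_less_def by auto
  let ?L = "\<lambda>e f. \<exists>i. e i < f i \<and> (\<forall>k<i. e k = (f k :: nat))"
  have L: "?L (fst \<eta>) (fst \<xi>)" if ab: "?L (fst \<eta>) (fst \<zeta>)" "?L (fst \<zeta>) (fst \<xi>)"
  proof -
    obtain i j where i: "fst \<eta> i < fst \<zeta> i" "\<forall>k<i. fst \<eta> k = fst \<zeta> k"
      and j: "fst \<zeta> j < fst \<xi> j" "\<forall>k<j. fst \<zeta> k = fst \<xi> k" using ab by blast
    show ?thesis
    proof (intro exI[of _ "min i j"] conjI allI impI)
      show "fst \<eta> (min i j) < fst \<xi> (min i j)" using i j by (cases i j rule: linorder_cases) auto
      show "fst \<eta> k = fst \<xi> k" if "k < min i j" for k using i j that by auto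
    qed
  qed
  have "?L (fst \<eta>) (fst \<zeta>) \<or> (fst \<eta> = fst \<zeta> \<and> snd \<eta> < snd \<zeta>)"
    "?L (fst \<zeta>) (fst \<xi>) \<or> (fst \<zeta> = fst \<xi> \<and> snd \<zeta> < snd \<xi>)"
    using assms o unfolding orderly_less_def by auto
  then have "?L (fst \<eta>) (fst \<xi>) \<or> (fst \<eta> = fst \<xi> \<and> snd \<eta> < snd \<xi>)" using L by force
  then show ?thesis unfolding orderly_less_def using o by simp
qed (simp add: orderly_less_def)

lemma orderly_less_total:
  assumes "\<eta> \<noteq> \<zeta>"
  shows "orderly_less m \<eta> \<zeta> \<or> orderly_less m \<zeta> \<eta>"
proof (cases "fst \<eta> = fst \<zeta>")
  case True
  then have "snd \<eta> \<noteq> snd \<zeta>" using assms by (auto simp: prod_eq_iff)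
  then show ?thesis using True unfolding orderly_less_def by auto
next
  case False
  define i where "i = (LEAST i. fst \<eta> i \<noteq> fst \<zeta> i)"
  have "\<exists>i. fst \<eta> i \<noteq> fst \<zeta> i" using False by auto
  from LeastI_ex[OF this] have i: "fst \<eta> i \<noteq> fst \<zeta> i" unfolding i_def .
  have lt: "\<forall>k<i. fst \<eta> k = fst \<zeta> k" unfolding i_def using not_less_Least by blast
  show ?thesis
  proof (cases "fst \<eta> i < fst \<zeta> i")
    case True
    then show ?thesis using lt unfolding orderly_less_def by (meson linorder_neqE_nat)
  next
    case False
    then have "fst \<zeta> i < fst \<eta> i" "\<forall>k<i. fst \<zeta> k = fst \<eta> k" using i lt by auto
    then show ?thesis unfolding orderly_less_def by (metis linorder_neqE_nat)
  qed
qed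

lemma orderly_less_shift:
  assumes "i < m" "orderly_less m \<eta> \<zeta>" shows "orderly_less m (vshift i \<eta>) (vshift i \<zeta>)"
proof -
  have eq: "shift i e k < shift i f k \<longleftrightarrow> e k < f k" "shift i e k = shift i f k \<longleftrightarrow> e k = f k" for e f k
    by (auto simp: shift_def)
  have "shift i e = shift i f \<longleftrightarrow> e = f" for e f using eq(2)[of e _ f] by (auto simp: fun_eq_iff)
  then show ?thesis using assms unfolding orderly_less_def vshift_def fst_conv snd_conv
    by (simp add: theta_ord_shift eq)
qed

text \<open>Ranks are natural numbers, so that induction over derivatives is induction over
  \<open>nat\<close>; this is possible for an orderly ranking because only finitely many derivatives
  have bounded order.\<close>

definition is_ranking :: "nat \<Rightarrow> nat \<Rightarrow> ((nat \<Rightarrow> nat) \<times> nat \<Rightarrow> nat) \<Rightarrow> bool" where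
  "is_ranking m n rk \<longleftrightarrow> inj_on rk (Theta m \<times> {..<n}) \<and>
     (\<forall>\<eta>\<in>Theta m \<times> {..<n}. \<forall>i<m. rk \<eta> < rk (vshift i \<eta>)) \<and>
     (\<forall>\<eta>\<in>Theta m \<times> {..<n}. \<forall>\<zeta>\<in>Theta m \<times> {..<n}. \<forall>i<m. rk \<eta> < rk \<zeta> \<longrightarrow> rk (vshift i \<eta>) < rk (vshift i \<zeta>)) \<and>
     (\<forall>\<eta>\<in>Theta m \<times> {..<n}. \<forall>\<zeta>\<in>Theta m \<times> {..<n}. theta_ord m (fst \<eta>) < theta_ord m (fst \<zeta>) \<longrightarrow> rk \<eta> < rk \<zeta>)"

lemma vshift_mem: "\<eta> \<in> Theta m \<times> {..<n} \<Longrightarrow> i < m \<Longrightarrow> vshift i \<eta> \<in> Theta m \<times> {..<n}"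
  by (auto simp: vshift_def shift_Theta)

text \<open>The rank is the number of predecessors, which is finite since their orders are
  bounded.\<close>

lemma ranking_exists: "\<exists>rk. is_ranking m n rk"
proof -
  let ?V = "Theta m \<times> {..<n}"
  define rk where "rk \<eta> = card {\<zeta> \<in> ?V. orderly_less m \<zeta> \<eta>}" for \<eta>
  have fin: "finite {\<zeta> \<in> ?V. orderly_less m \<zeta> \<eta>}" for \<eta>
    by (rule finite_subset[OF _ finite_cartesian_product[OF finite_Theta_ord_le[of m "theta_ord m (fst \<eta>)"] finite_lessThan[of n]]])
      (auto simp: orderly_less_def)
  have rk_less: "rk \<eta> < rk \<zeta>" if "\<eta> \<in> ?V" "orderly_less m \<eta> \<zeta>" for \<eta> \<zeta>
    unfolding rk_def
  proof (rule psubset_card_mono[OF fin])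
    have "\<eta> \<notin> {\<xi> \<in> ?V. orderly_less m \<xi> \<eta>}" using orderly_less_irrefl by blast
    moreover have "{\<xi> \<in> ?V. orderly_less m \<xi> \<eta>} \<subseteq> {\<xi> \<in> ?V. orderly_less m \<xi> \<zeta>}"
      using orderly_less_trans that(2) by blast
    ultimately show "{\<xi> \<in> ?V. orderly_less m \<xi> \<eta>} \<subset> {\<xi> \<in> ?V. orderly_less m \<xi> \<zeta>}" using that by blast
  qed
  have iff: "rk \<eta> < rk \<zeta> \<longleftrightarrow> orderly_less m \<eta> \<zeta>" if "\<eta> \<in> ?V" "\<zeta> \<in> ?V" for \<eta> \<zeta>
    using rk_less[OF that(1)] rk_less[OF that(2), of \<eta>] orderly_less_total[of \<eta> \<zeta> m] by (metis less_irrefl less_trans)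
  have "is_ranking m n rk"
    unfolding is_ranking_def
  proof (intro conjI ballI allI impI)
    show "inj_on rk ?V"
      by (rule inj_onI) (metis iff less_irrefl orderly_less_total)
    show "rk \<eta> < rk (vshift i \<eta>)" if "\<eta> \<in> ?V" "i < m" for \<eta> i
      using that by (subst iff) (auto simp: vshift_mem orderly_less_def vshift_def theta_ord_shift shift_Theta)
    show "rk (vshift i \<eta>) < rk (vshift i \<zeta>)" if "\<eta> \<in> ?V" "\<zeta> \<in> ?V" "i < m" "rk \<eta> < rk \<zeta>" for \<eta> \<zeta> i
      using iff[OF vshift_mem[OF that(1,3)] vshift_mem[OF that(2,3)]] orderly_less_shift[OF that(3)] iff[OF that(1,2)] that(4)
      by blast
    show "rk \<eta> < rk \<zeta>" if "\<eta> \<in> ?V" "\<zeta> \<in> ?V" "theta_ord m (fst \<eta>) < theta_ord m (fst \<zeta>)" for \<eta> \<zeta>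
      using iff[OF that(1,2)] that(3) by (simp add: orderly_less_def)
  qed
  then show ?thesis by blast
qed

subsection \<open>Derivative operators\<close>

lemma theta_app_zero [simp]: "theta_app \<delta> k (\<lambda>_. 0) x = x"
  by (induction k) auto

lemma theta_app_cong: "(\<And>i. i < k \<Longrightarrow> e i = f i) \<Longrightarrow> theta_app \<delta> k e x = theta_app \<delta> k f x"
  by (induction k arbitrary: x) auto

lemma commuting_funpow:
  assumes "commuting_derivations m \<delta>" "i < m" "j < m"
  shows "\<delta> i ((\<delta> j ^^ k) x) = (\<delta> j ^^ k) (\<delta> i x)"
  using assms by (induction k) (auto simp: commuting_derivations_def)

lemma theta_app_delta:
  assumes "commuting_derivations m \<delta>" "i < m"
  shows "k \<le> m \<Longrightarrow> \<delta> i (theta_app \<delta> k e x) = theta_app \<delta> k e (\<delta> i x)"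
  by (induction k arbitrary: x) (auto simp: commuting_funpow[OF assms])

lemma theta_app_shift:
  assumes c: "commuting_derivations m \<delta>" and "i < m"
  shows "theta_app \<delta> m (shift i e) x = \<delta> i (theta_app \<delta> m e x)"
proof -
  have "theta_app \<delta> k (shift i e) x = theta_app \<delta> k e (\<delta> i x)" if "i < k" "k \<le> m" for k
    using that
  proof (induction k arbitrary: x)
    case (Suc k)
    show ?case
    proof (cases "i = k")
      case True
      have "theta_app \<delta> k (shift k e) y = theta_app \<delta> k e y" for y
        by (rule theta_app_cong) (simp add: shift_def)
      moreover have "shift k e k = Suc (e k)" by (simp add: shift_def)
      ultimately show ?thesis using True by (simp add: funpow_swap1)
    next
      case False
      then have "shift i e k = e k" by (simp add: shift_def)
      then show ?thesis using Suc False commuting_funpow[OF c assms(2), of k] by simp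
    qed
  qed simp
  then show ?thesis using theta_app_delta[OF assms, of m] assms(2) by simp
qed

lemma theta_app_mem:
  assumes c: "commuting_derivations m \<delta>" and "delta_subfield m \<delta> K" "e \<in> Theta m" "x \<in> K"
  shows "theta_app \<delta> m e x \<in> K"
  using assms(3)
proof (induction e rule: theta_induct)
  case (shift e i)
  then show ?case using assms(2) by (simp add: theta_app_shift[OF c] delta_subfield_def)
qed (use assms in simp)

lemma vadd_zero [simp]: "vadd (\<lambda>_. 0) \<eta> = \<eta>"
  by (simp add: vadd_def)

lemma vadd_shift: "vadd (shift i e) \<eta> = vshift i (vadd e \<eta>)"
  by (simp add: vadd_def vshift_def tadd_shift)

lemma vadd_mem: "e \<in> Theta m \<Longrightarrow> \<eta> \<in> Theta m \<times> {..<n} \<Longrightarrow> vadd e \<eta> \<in> Theta m \<times> {..<n}"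
  by (auto simp: vadd_def tadd_Theta)

lemma vshift_commute: "vshift i (vshift j \<eta>) = vshift j (vshift i \<eta>)"
  by (simp add: vshift_def shift_commute)

lemma theta_ord_vadd: "theta_ord m (fst (vadd e \<eta>)) = theta_ord m e + theta_ord m (fst \<eta>)"
  by (simp add: vadd_def theta_ord_tadd)

lemma inj_vadd: "vadd e \<eta> = vadd f \<eta> \<longleftrightarrow> e = f"
  by (metis vadd_def fst_conv tadd_commute tadd_left_cancel)

subsection \<open>Leaders and their partial derivatives\<close>

locale delta_extension =
  fixes \<delta> :: "nat \<Rightarrow> 'a::field_char_0 \<Rightarrow> 'a" and m n :: nat and F :: "'a set" and u :: "nat \<Rightarrow> 'a"
    and rk :: "(nat \<Rightarrow> nat) \<times> nat \<Rightarrow> nat"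
  assumes m_gt_1: "1 < m" and comm: "commuting_derivations m \<delta>" and delta_F: "delta_subfield m \<delta> F"
    and indets: "delta_indeterminates m \<delta> F n u" and rk: "is_ranking m n rk"
begin

definition V :: "((nat \<Rightarrow> nat) \<times> nat) set" where
  "V = Theta m \<times> {..<n}"

definition X :: "(nat \<Rightarrow> nat) \<times> nat \<Rightarrow> 'a" where
  "X \<eta> = theta_app \<delta> m (fst \<eta>) (u (snd \<eta>))"

text \<open>A filtration by rank: an element of \<open>Y (Suc (rk \<eta>))\<close> outside
  \<open>Y (rk \<eta>)\<close> is one with leader \<open>\<eta>\<close>.\<close>

definition Y :: "nat \<Rightarrow> 'a set" where
  "Y k = field_gen (F \<union> X ` {\<zeta> \<in> V. rk \<zeta> < k})"

lemma subfield_F: "is_subfield F"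
  using delta_F by (simp add: delta_subfield_def)

lemma deriv_delta: "i < m \<Longrightarrow> deriv_on K (\<delta> i)"
  using comm by (intro derivation_deriv_on) (simp add: commuting_derivations_def)

lemma delta_commute: "i < m \<Longrightarrow> j < m \<Longrightarrow> \<delta> i (\<delta> j x) = \<delta> j (\<delta> i x)"
  using comm by (simp add: commuting_derivations_def)

lemma delta_add: "i < m \<Longrightarrow> \<delta> i (x + y) = \<delta> i x + \<delta> i y"
  and delta_mult: "i < m \<Longrightarrow> \<delta> i (x * y) = \<delta> i x * y + x * \<delta> i y"
  using comm by (auto simp: commuting_derivations_def derivation_def)

lemma rk_inj: "inj_on rk V"
  and rk_shift: "\<eta> \<in> V \<Longrightarrow> i < m \<Longrightarrow> rk \<eta> < rk (vshift i \<eta>)"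
  and rk_mono: "\<eta> \<in> V \<Longrightarrow> \<zeta> \<in> V \<Longrightarrow> i < m \<Longrightarrow> rk \<eta> < rk \<zeta> \<Longrightarrow> rk (vshift i \<eta>) < rk (vshift i \<zeta>)"
  and rk_orderly: "\<eta> \<in> V \<Longrightarrow> \<zeta> \<in> V \<Longrightarrow> theta_ord m (fst \<eta>) < theta_ord m (fst \<zeta>) \<Longrightarrow> rk \<eta> < rk \<zeta>"
  using rk unfolding is_ranking_def V_def by blast+

lemma rk_eq: "\<eta> \<in> V \<Longrightarrow> \<zeta> \<in> V \<Longrightarrow> rk \<eta> = rk \<zeta> \<Longrightarrow> \<eta> = \<zeta>"
  using rk_inj by (rule inj_onD)

lemma ord_le_of_rk: "\<eta> \<in> V \<Longrightarrow> \<zeta> \<in> V \<Longrightarrow> rk \<eta> \<le> rk \<zeta> \<Longrightarrow> theta_ord m (fst \<eta>) \<le> theta_ord m (fst \<zeta>)"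
  using rk_orderly[of \<zeta> \<eta>] by force

lemma V_shift: "\<eta> \<in> V \<Longrightarrow> i < m \<Longrightarrow> vshift i \<eta> \<in> V"
  unfolding V_def by (rule vshift_mem)

lemma V_vadd: "e \<in> Theta m \<Longrightarrow> \<eta> \<in> V \<Longrightarrow> vadd e \<eta> \<in> V"
  unfolding V_def by (rule vadd_mem)

lemma rk_vadd_le: "e \<in> Theta m \<Longrightarrow> \<eta> \<in> V \<Longrightarrow> rk \<eta> \<le> rk (vadd e \<eta>)"
proof (induction e rule: theta_induct)
  case (shift e i)
  then show ?case using rk_shift[OF V_vadd[OF shift.hyps(1) shift.prems] shift.hyps(2)] by (simp add: vadd_shift)
qed simp

lemma delta_X: "i < m \<Longrightarrow> \<delta> i (X \<eta>) = X (vshift i \<eta>)"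
  by (simp add: X_def vshift_def theta_app_shift[OF comm])

lemma indep_X: "inj_on X V" "indep F (X ` V)"
proof -
  have "(\<lambda>(e, j). theta_app \<delta> m e (u j)) = X" by (auto simp: X_def)
  then have "alg_independent F V X" using indets unfolding delta_indeterminates_def V_def by simp
  then show "inj_on X V" "indep F (X ` V)" using alg_independent_iff_indep[OF subfield_F] by auto
qed

lemma X_notin_cl:
  assumes "\<eta> \<in> V" "S \<subseteq> V" "\<eta> \<notin> S" shows "X \<eta> \<notin> cl (F \<union> X ` S)"
proof -
  have "X ` S \<subseteq> X ` V - {X \<eta>}" using assms indep_X(1) by (auto simp: inj_on_def)
  then have "cl (F \<union> X ` S) \<subseteq> cl (F \<union> (X ` V - {X \<eta>}))" by (intro cl_mono) auto
  then show ?thesis using indep_X(2) assms(1) unfolding indep_def by blast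
qed

lemma subfield_Y [simp, intro]: "is_subfield (Y k)"
  unfolding Y_def by blast

lemma Y_mono: "k \<le> l \<Longrightarrow> Y k \<subseteq> Y l"
  unfolding Y_def by (intro field_gen_mono) auto

lemma F_Y: "F \<subseteq> Y k"
  unfolding Y_def using field_gen_superset[of "F \<union> X ` {\<zeta> \<in> V. rk \<zeta> < k}"] by blast

lemma X_Y: "\<eta> \<in> V \<Longrightarrow> rk \<eta> < k \<Longrightarrow> X \<eta> \<in> Y k"
  unfolding Y_def by (rule field_gen_incl) auto

lemma Y_0: "Y 0 = F"
  by (simp add: Y_def subfield_F)

lemma X_notin_acl_Y: "\<eta> \<in> V \<Longrightarrow> X \<eta> \<notin> acl (Y (rk \<eta>))"
  using X_notin_cl[of \<eta> "{\<zeta> \<in> V. rk \<zeta> < rk \<eta>}"] unfolding Y_def cl_def by auto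

lemma Y_Suc: "\<eta> \<in> V \<Longrightarrow> Y (Suc (rk \<eta>)) = field_gen (insert (X \<eta>) (Y (rk \<eta>)))"
proof -
  assume \<eta>: "\<eta> \<in> V"
  have "{\<zeta> \<in> V. rk \<zeta> < Suc (rk \<eta>)} = insert \<eta> {\<zeta> \<in> V. rk \<zeta> < rk \<eta>}"
    using rk_eq[OF _ \<eta>] \<eta> less_Suc_eq by blast
  then show ?thesis
    using field_gen_Un_field_gen[of "F \<union> X ` {\<zeta> \<in> V. rk \<zeta> < rk \<eta>}" "{X \<eta>}"] unfolding Y_def by simp
qed

lemma Y_Suc_none: "(\<And>\<eta>. \<eta> \<in> V \<Longrightarrow> rk \<eta> \<noteq> k) \<Longrightarrow> Y (Suc k) = Y k"
proof -
  assume "\<And>\<eta>. \<eta> \<in> V \<Longrightarrow> rk \<eta> \<noteq> k"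
  then have "{\<zeta> \<in> V. rk \<zeta> < Suc k} = {\<zeta> \<in> V. rk \<zeta> < k}" by (auto simp: less_Suc_eq)
  then show ?thesis unfolding Y_def by simp
qed

lemma mem_Y_exists:
  assumes "z \<in> field_gen (F \<union> X ` V)" obtains k where "z \<in> Y k"
proof -
  obtain S where S: "finite S" "S \<subseteq> F \<union> X ` V" "z \<in> field_gen S" using field_gen_finitary[OF assms] by blast
  have "finite (S \<inter> X ` V)" "S \<inter> X ` V \<subseteq> X ` V" using S(1) by auto
  then obtain A where A: "A \<subseteq> V" "finite A" "S \<inter> X ` V = X ` A" by (meson finite_subset_image)
  have "X ` A \<subseteq> X ` {\<zeta> \<in> V. rk \<zeta> < Suc (Max (rk ` A))}"
    using A(1,2) by (intro image_mono) (auto simp: less_Suc_eq_le)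
  then have "S \<subseteq> F \<union> X ` {\<zeta> \<in> V. rk \<zeta> < Suc (Max (rk ` A))}" using S(2) A(3) by blast
  then have "z \<in> Y (Suc (Max (rk ` A)))" unfolding Y_def using S(3) field_gen_mono by blast
  then show ?thesis using that by blast
qed

text \<open>The least \<open>k\<close> with all \<open>c i\<close> in \<open>Y k\<close> is the
  successor of an attained rank. A whole family is treated at once, because the coefficients of a
  relation have to be differentiated with respect to one common derivative.\<close>

lemma common_leader:
  assumes "finite I" "\<And>i. i \<in> I \<Longrightarrow> c i \<in> field_gen (F \<union> X ` V)" "\<exists>i\<in>I. c i \<notin> Y k0"
  obtains \<eta> where "\<eta> \<in> V" "k0 \<le> rk \<eta>" "\<And>i. i \<in> I \<Longrightarrow> c i \<in> Y (Suc (rk \<eta>))" "\<exists>i\<in>I. c i \<notin> Y (rk \<eta>)"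
proof -
  have "\<exists>k. c i \<in> Y k" if "i \<in> I" for i using mem_Y_exists[OF assms(2)[OF that]] by blast
  then obtain f where f: "\<And>i. i \<in> I \<Longrightarrow> c i \<in> Y (f i)" by metis
  have "\<forall>i\<in>I. c i \<in> Y (Max (f ` I))" using f Y_mono assms(1) by (meson Max_ge finite_imageI imageI subsetD)
  then have ex: "\<exists>k. \<forall>i\<in>I. c i \<in> Y k" by blast
  define k where "k = (LEAST k. \<forall>i\<in>I. c i \<in> Y k)"
  have k: "\<forall>i\<in>I. c i \<in> Y k" unfolding k_def by (rule LeastI_ex[OF ex])
  have kmin: "\<not> (\<forall>i\<in>I. c i \<in> Y l)" if "l < k" for l using that not_less_Least unfolding k_def by blast
  have "k0 < k" using k assms(3) Y_mono[of k k0] by (meson not_less subsetD)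
  then obtain l where l: "k = Suc l" by (cases k) auto
  have "\<exists>\<eta>\<in>V. rk \<eta> = l" using Y_Suc_none[of l] k kmin[of l] l by auto
  then obtain \<eta> where "\<eta> \<in> V" "rk \<eta> = l" by blast
  then show ?thesis using that[of \<eta>] k kmin[of l] l \<open>k0 < k\<close> by auto
qed

lemma leader_exists:
  assumes "z \<in> field_gen (F \<union> X ` V)" "z \<notin> F"
  obtains \<eta> where "\<eta> \<in> V" "z \<in> Y (Suc (rk \<eta>))" "z \<notin> Y (rk \<eta>)"
  using common_leader[of "{z}" "\<lambda>z. z" 0] assms Y_0 by auto

text \<open>The ranking is compatible with shifts, so the generators and their derivatives stay
  below \<open>vshift i \<eta>\<close>. The base \<open>K\<close> is left open to cover both the
  filtration over \<open>F\<close> and the one over \<open>G\<close>.\<close>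

lemma delta_base:
  assumes K: "delta_subfield m \<delta> K" and \<eta>: "\<eta> \<in> V" "i < m"
    and "z \<in> field_gen (K \<union> X ` {\<zeta> \<in> V. rk \<zeta> < rk \<eta>})"
  shows "\<delta> i z \<in> field_gen (K \<union> X ` {\<zeta> \<in> V. rk \<zeta> < rk (vshift i \<eta>)})"
proof -
  let ?S = "K \<union> X ` {\<zeta> \<in> V. rk \<zeta> < rk (vshift i \<eta>)}"
  let ?W = "field_gen ?S"
  have W: "is_subfield ?W" by blast
  have "is_subfield {z \<in> ?W. \<delta> i z \<in> ?W}"
    using \<eta>(2) by (intro subfield_deriv_preimage deriv_delta W) (auto intro: subfield_closed(1-4)[OF W])
  moreover have "K \<union> X ` {\<zeta> \<in> V. rk \<zeta> < rk \<eta>} \<subseteq> {z \<in> ?W. \<delta> i z \<in> ?W}"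
  proof
    fix y assume "y \<in> K \<union> X ` {\<zeta> \<in> V. rk \<zeta> < rk \<eta>}"
    then show "y \<in> {z \<in> ?W. \<delta> i z \<in> ?W}"
    proof
      assume y: "y \<in> K"
      then have "\<delta> i y \<in> K" using K \<eta>(2) by (simp add: delta_subfield_def)
      then show ?thesis using y field_gen_incl[of _ ?S] by blast
    next
      assume "y \<in> X ` {\<zeta> \<in> V. rk \<zeta> < rk \<eta>}"
      then obtain \<zeta> where \<zeta>: "\<zeta> \<in> V" "rk \<zeta> < rk \<eta>" "y = X \<zeta>" by blast
      have "X \<zeta> \<in> ?S" using \<zeta> rk_shift[OF \<eta>] by fastforce
      moreover have "X (vshift i \<zeta>) \<in> ?S"
        using V_shift[OF \<zeta>(1) \<eta>(2)] rk_mono[OF \<zeta>(1) \<eta> \<zeta>(2)] by blast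
      ultimately show ?thesis using \<zeta>(3) delta_X[OF \<eta>(2)] field_gen_incl[of _ ?S] by simp
    qed
  qed
  ultimately have "field_gen (K \<union> X ` {\<zeta> \<in> V. rk \<zeta> < rk \<eta>}) \<subseteq> {z \<in> ?W. \<delta> i z \<in> ?W}"
    by (rule field_gen_least)
  then show ?thesis using assms(4) by blast
qed

lemma delta_Y: "\<eta> \<in> V \<Longrightarrow> i < m \<Longrightarrow> z \<in> Y (rk \<eta>) \<Longrightarrow> \<delta> i z \<in> Y (rk (vshift i \<eta>))"
  unfolding Y_def by (rule delta_base[OF delta_F])

lemma Y_Suc_subset_shift: "\<eta> \<in> V \<Longrightarrow> i < m \<Longrightarrow> Y (Suc (rk \<eta>)) \<subseteq> Y (rk (vshift i \<eta>))"
  using rk_shift[of \<eta> i] by (intro Y_mono) simp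

text \<open>The expressions \<open>A + S * X (vshift i \<eta>)\<close> form a module
  \<open>M\<close> over the lower field, so the elements with derivative in \<open>M\<close> form a
  field; it contains \<open>X \<eta>\<close> and \<open>Y (rk \<eta>)\<close>.\<close>

lemma delta_linear:
  assumes \<eta>: "\<eta> \<in> V" "i < m" and c: "c \<in> Y (Suc (rk \<eta>))"
  obtains A S where "A \<in> Y (rk (vshift i \<eta>))" "S \<in> Y (rk (vshift i \<eta>))" "\<delta> i c = A + S * X (vshift i \<eta>)"
proof -
  let ?W = "Y (rk (vshift i \<eta>))" and ?x = "X (vshift i \<eta>)"
  define M where "M = {A + S * ?x |A S. A \<in> ?W \<and> S \<in> ?W}"
  note cl = subfield_closed[OF subfield_Y[of "rk (vshift i \<eta>)"]]
  have M: "A + S * ?x \<in> M" if "A \<in> ?W" "S \<in> ?W" for A S using that unfolding M_def by blast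
  have "is_subfield {z \<in> ?W. \<delta> i z \<in> M}"
  proof (rule subfield_deriv_preimage[OF subfield_Y deriv_delta[OF \<eta>(2)]])
    show "0 \<in> M" using M[of 0 0] cl(1) by simp
    show "a + b \<in> M" if "a \<in> M" "b \<in> M" for a b
    proof -
      obtain A S B T where *: "a = A + S * ?x" "b = B + T * ?x" "A \<in> ?W" "S \<in> ?W" "B \<in> ?W" "T \<in> ?W"
        using \<open>a \<in> M\<close> \<open>b \<in> M\<close> unfolding M_def by blast
      have "a + b = (A + B) + (S + T) * ?x" using * by (simp add: algebra_simps)
      then show ?thesis using * M cl(3) by metis
    qed
    show "a * b \<in> M" if "a \<in> ?W" "b \<in> M" for a b
    proof -
      obtain B T where *: "b = B + T * ?x" "B \<in> ?W" "T \<in> ?W" using \<open>b \<in> M\<close> unfolding M_def by blast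
      have "a * b = a * B + (a * T) * ?x" using * by (simp add: algebra_simps)
      then show ?thesis using * M cl(4) \<open>a \<in> ?W\<close> by metis
    qed
  qed
  moreover have "insert (X \<eta>) (Y (rk \<eta>)) \<subseteq> {z \<in> ?W. \<delta> i z \<in> M}"
  proof
    fix y assume "y \<in> insert (X \<eta>) (Y (rk \<eta>))"
    then show "y \<in> {z \<in> ?W. \<delta> i z \<in> M}"
    proof
      assume "y = X \<eta>"
      then show ?thesis using X_Y[OF \<eta>(1) rk_shift[OF \<eta>]] delta_X[OF \<eta>(2)] M[of 0 1] cl(1,2) by simp
    next
      assume y: "y \<in> Y (rk \<eta>)"
      then have "y \<in> ?W" using Y_mono[of "rk \<eta>" "rk (vshift i \<eta>)"] rk_shift[OF \<eta>] by auto
      then show ?thesis using M[of "\<delta> i y" 0] delta_Y[OF \<eta> y] cl(1) by simp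
    qed
  qed
  ultimately have "Y (Suc (rk \<eta>)) \<subseteq> {z \<in> ?W. \<delta> i z \<in> M}" unfolding Y_Suc[OF \<eta>(1)] by (rule field_gen_least)
  then have "\<delta> i c \<in> M" using c by blast
  then show ?thesis using that unfolding M_def by blast
qed

lemma linear_unique:
  assumes "\<zeta> \<in> V" "A \<in> Y (rk \<zeta>)" "S \<in> Y (rk \<zeta>)" "B \<in> Y (rk \<zeta>)" "T \<in> Y (rk \<zeta>)"
    and "A + S * X \<zeta> = B + T * X \<zeta>"
  shows "S = T" "A = B"
proof -
  note cl = subfield_closed[OF subfield_Y[of "rk \<zeta>"]]
  show "S = T"
  proof (rule ccontr)
    assume "S \<noteq> T"
    then have "X \<zeta> = (B - A) / (S - T)" using assms(6) by (simp add: field_simps)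
    then have "X \<zeta> \<in> Y (rk \<zeta>)" using assms cl(7,8) by metis
    then show False using X_notin_acl_Y[OF assms(1)] acl_superset[OF subfield_Y] by blast
  qed
  then show "A = B" using assms(6) by simp
qed

text \<open>The partial derivative with respect to the leader, read off from the action of the
  derivation \<open>\<delta> 0\<close>.\<close>

definition PD :: "(nat \<Rightarrow> nat) \<times> nat \<Rightarrow> 'a \<Rightarrow> 'a" where
  "PD \<eta> c = (THE S. S \<in> Y (rk (vshift 0 \<eta>)) \<and> \<delta> 0 c - S * X (vshift 0 \<eta>) \<in> Y (rk (vshift 0 \<eta>)))"

lemma zero_lt_m: "0 < m"
  using m_gt_1 by simp

lemma PD_eqI:
  assumes "\<eta> \<in> V" "A \<in> Y (rk (vshift 0 \<eta>))" "S \<in> Y (rk (vshift 0 \<eta>))" "\<delta> 0 c = A + S * X (vshift 0 \<eta>)"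
  shows "PD \<eta> c = S"
  unfolding PD_def
proof (rule the_equality)
  let ?W = "Y (rk (vshift 0 \<eta>))"
  show "S \<in> ?W \<and> \<delta> 0 c - S * X (vshift 0 \<eta>) \<in> ?W" using assms by simp
  fix T assume T: "T \<in> ?W \<and> \<delta> 0 c - T * X (vshift 0 \<eta>) \<in> ?W"
  have "A + S * X (vshift 0 \<eta>) = (\<delta> 0 c - T * X (vshift 0 \<eta>)) + T * X (vshift 0 \<eta>)" using assms(4) by simp
  then show "T = S" using linear_unique(1)[OF V_shift[OF assms(1) zero_lt_m] assms(2,3)] T by metis
qed

text \<open>Computing the mixed derivative of \<open>c\<close> under \<open>\<delta> 0\<close> and
  \<open>\<delta> i\<close> in both orders gives two expressions linear in the same highest
  derivative. Comparing coefficients shows that the separant read off from \<open>\<delta> 0\<close>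
  is also the one for \<open>\<delta> i\<close>.\<close>

lemma delta_PD:
  assumes \<eta>: "\<eta> \<in> V" "i < m" and c: "c \<in> Y (Suc (rk \<eta>))"
  shows "PD \<eta> c \<in> Y (rk (vshift i \<eta>))" "\<delta> i c - PD \<eta> c * X (vshift i \<eta>) \<in> Y (rk (vshift i \<eta>))"
    "\<delta> i c \<in> Y (Suc (rk (vshift i \<eta>)))" "PD (vshift i \<eta>) (\<delta> i c) = PD \<eta> c"
proof -
  let ?\<zeta> = "vshift 0 (vshift i \<eta>)"
  let ?W = "Y (rk ?\<zeta>)"
  have \<zeta>: "?\<zeta> \<in> V" using \<eta> zero_lt_m V_shift by blast
  note cl = subfield_closed[OF subfield_Y]
  obtain A S where A: "A \<in> Y (rk (vshift i \<eta>))" "S \<in> Y (rk (vshift i \<eta>))" "\<delta> i c = A + S * X (vshift i \<eta>)"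
    using delta_linear[OF assms] by metis
  obtain B T where B: "B \<in> Y (rk (vshift 0 \<eta>))" "T \<in> Y (rk (vshift 0 \<eta>))" "\<delta> 0 c = B + T * X (vshift 0 \<eta>)"
    using delta_linear[OF \<eta>(1) zero_lt_m c] by metis
  have T: "PD \<eta> c = T" using PD_eqI[OF \<eta>(1) B] .
  have *: "\<delta> k A' + \<delta> k S' * X \<zeta>' \<in> Y (rk (vshift k \<zeta>'))" "S' \<in> Y (rk (vshift k \<zeta>'))"
    "\<delta> k (A' + S' * X \<zeta>') = (\<delta> k A' + \<delta> k S' * X \<zeta>') + S' * X (vshift k \<zeta>')"
    if "\<zeta>' \<in> V" "k < m" "A' \<in> Y (rk \<zeta>')" "S' \<in> Y (rk \<zeta>')" for \<zeta>' k A' S'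
  proof -
    show "\<delta> k A' + \<delta> k S' * X \<zeta>' \<in> Y (rk (vshift k \<zeta>'))"
      using that delta_Y X_Y rk_shift by (intro cl(3,4)) auto
    show "S' \<in> Y (rk (vshift k \<zeta>'))" using that Y_mono[of "rk \<zeta>'" "rk (vshift k \<zeta>')"] rk_shift[OF that(1,2)] by auto
    show "\<delta> k (A' + S' * X \<zeta>') = (\<delta> k A' + \<delta> k S' * X \<zeta>') + S' * X (vshift k \<zeta>')"
      by (simp add: delta_add[OF that(2)] delta_mult[OF that(2)] delta_X[OF that(2)])
  qed
  note a = *[OF V_shift[OF \<eta>] zero_lt_m A(1,2)]
  note b = *[OF V_shift[OF \<eta>(1) zero_lt_m] \<eta>(2) B(1,2), unfolded vshift_commute[of i 0]]
  have "(\<delta> 0 A + \<delta> 0 S * X (vshift i \<eta>)) + S * X ?\<zeta> = (\<delta> i B + \<delta> i T * X (vshift 0 \<eta>)) + T * X ?\<zeta>"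
    using delta_commute[OF zero_lt_m \<eta>(2), of c] unfolding A(3) B(3) a(3) b(3) .
  then have ST: "S = T" using linear_unique(1)[OF \<zeta> a(1,2) b(1,2)] by blast
  show "PD \<eta> c \<in> Y (rk (vshift i \<eta>))" "\<delta> i c - PD \<eta> c * X (vshift i \<eta>) \<in> Y (rk (vshift i \<eta>))"
    using A ST T by auto
  have "A \<in> Y (Suc (rk (vshift i \<eta>)))" "S \<in> Y (Suc (rk (vshift i \<eta>)))"
    using A(1,2) Y_mono[of "rk (vshift i \<eta>)" "Suc (rk (vshift i \<eta>))"] by auto
  then show "\<delta> i c \<in> Y (Suc (rk (vshift i \<eta>)))"
    unfolding A(3) using X_Y[OF V_shift[OF \<eta>]] by (intro cl(3,4)) auto
  have "\<delta> 0 (\<delta> i c) = (\<delta> 0 A + \<delta> 0 S * X (vshift i \<eta>)) + S * X ?\<zeta>" unfolding A(3) a(3) ..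
  then have "PD (vshift i \<eta>) (\<delta> i c) = S" by (rule PD_eqI[OF V_shift[OF \<eta>] a(1,2)])
  then show "PD (vshift i \<eta>) (\<delta> i c) = PD \<eta> c" using ST T by simp
qed

lemma PD_const:
  assumes "\<eta> \<in> V" "c \<in> Y (rk \<eta>)" shows "PD \<eta> c = 0"
  using delta_Y[OF assms(1) zero_lt_m assms(2)] subfield_0[OF subfield_Y]
  by (intro PD_eqI[OF assms(1)]) auto

lemma PD_X: "\<eta> \<in> V \<Longrightarrow> PD \<eta> (X \<eta>) = 1"
  using delta_X[OF zero_lt_m] subfield_closed[OF subfield_Y]
  by (intro PD_eqI[of _ 0]) auto

lemma deriv_PD:
  assumes \<eta>: "\<eta> \<in> V" shows "deriv_on (Y (Suc (rk \<eta>))) (PD \<eta>)"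
  unfolding deriv_on_def
proof (intro ballI conjI)
  let ?W = "Y (rk (vshift 0 \<eta>))" and ?x = "X (vshift 0 \<eta>)"
  note cl = subfield_closed[OF subfield_Y]
  fix c c' assume c: "c \<in> Y (Suc (rk \<eta>))" "c' \<in> Y (Suc (rk \<eta>))"
  define A A' where "A = \<delta> 0 c - PD \<eta> c * ?x" and "A' = \<delta> 0 c' - PD \<eta> c' * ?x"
  have eq: "\<delta> 0 c = A + PD \<eta> c * ?x" "\<delta> 0 c' = A' + PD \<eta> c' * ?x" by (simp_all add: A_def A'_def)
  have W: "A \<in> ?W" "A' \<in> ?W" "PD \<eta> c \<in> ?W" "PD \<eta> c' \<in> ?W"
    using delta_PD(1,2)[OF \<eta> zero_lt_m] c unfolding A_def A'_def by auto
  have cW: "c \<in> ?W" "c' \<in> ?W" using Y_Suc_subset_shift[OF \<eta> zero_lt_m] c by auto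
  show "PD \<eta> (c + c') = PD \<eta> c + PD \<eta> c'"
  proof (rule PD_eqI[OF \<eta>])
    show "\<delta> 0 (c + c') = (A + A') + (PD \<eta> c + PD \<eta> c') * ?x"
      using eq by (simp add: delta_add[OF zero_lt_m] algebra_simps)
  qed (use W cl(3) in auto)
  show "PD \<eta> (c * c') = PD \<eta> c * c' + c * PD \<eta> c'"
  proof (rule PD_eqI[OF \<eta>])
    show "\<delta> 0 (c * c') = (A * c' + c * A') + (PD \<eta> c * c' + c * PD \<eta> c') * ?x"
      using eq by (simp add: delta_mult[OF zero_lt_m] algebra_simps)
  qed (use W cW cl(3,4) in auto)
qed

lemma PD_zero_algebraic:
  assumes \<eta>: "\<eta> \<in> V" and T: "\<And>y. y \<in> T \<Longrightarrow> y \<in> Y (Suc (rk \<eta>)) \<and> PD \<eta> y = 0"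
    and w: "w \<in> Y (Suc (rk \<eta>))" "w \<in> acl T"
  shows "PD \<eta> w = 0"
proof -
  have "T \<subseteq> {z \<in> Y (Suc (rk \<eta>)). PD \<eta> z \<in> {0}}" using T by blast
  then have "w \<in> acl {z \<in> Y (Suc (rk \<eta>)). PD \<eta> z \<in> {0}}" using w(2) acl_mono by blast
  then have "PD \<eta> w \<in> {0}"
    using w(1) by (intro acl_deriv_preimage[OF subfield_Y deriv_PD[OF \<eta>]]) auto
  then show ?thesis by simp
qed

lemma X_algebraic_over_nonconst:
  assumes "\<eta> \<in> V" "c \<in> Y (Suc (rk \<eta>))" "c \<notin> Y (rk \<eta>)"
  shows "X \<eta> \<in> cl (insert c (Y (rk \<eta>)))"
  using acl_of_nonconstant[OF subfield_Y] assms Y_Suc by blast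

text \<open>The elements annihilated by \<open>PD \<eta>\<close> form a field containing
  \<open>Y (rk \<eta>)\<close>. If \<open>c\<close> belonged to it, \<open>X \<eta>\<close> would be
  algebraic over it and hence be annihilated, but its partial derivative is
  \<open>1\<close>.\<close>

lemma PD_nonzero:
  assumes \<eta>: "\<eta> \<in> V" and c: "c \<in> Y (Suc (rk \<eta>))" "c \<notin> Y (rk \<eta>)"
  shows "PD \<eta> c \<noteq> 0"
proof
  assume 0: "PD \<eta> c = 0"
  let ?T = "{z \<in> Y (Suc (rk \<eta>)). PD \<eta> z \<in> {0}}"
  have sT: "is_subfield ?T"
    by (rule subfield_deriv_preimage[OF subfield_Y deriv_PD[OF \<eta>]]) auto
  have "Y (rk \<eta>) \<subseteq> Y (Suc (rk \<eta>))" by (intro Y_mono) simp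
  then have "insert c (Y (rk \<eta>)) \<subseteq> ?T" using 0 c(1) PD_const[OF \<eta>] by auto
  then have "cl (insert c (Y (rk \<eta>))) \<subseteq> acl ?T"
    unfolding cl_def using sT by (intro acl_mono field_gen_least)
  then have "X \<eta> \<in> acl ?T" using X_algebraic_over_nonconst[OF assms] by blast
  moreover have "X \<eta> \<in> Y (Suc (rk \<eta>))" using X_Y[OF \<eta>] by simp
  ultimately have "PD \<eta> (X \<eta>) = 0" using PD_zero_algebraic[OF \<eta>, of ?T] by blast
  then show False using PD_X[OF \<eta>] by simp
qed

text \<open>Repeated differentiation moves the leader along and leaves the separant unchanged, as in
  the classical theory of differential polynomials.\<close>

lemma theta_app_PD:
  assumes \<eta>: "\<eta> \<in> V" and c: "c \<in> Y (Suc (rk \<eta>))" and e: "e \<in> Theta m"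
  shows "theta_app \<delta> m e c \<in> Y (Suc (rk (vadd e \<eta>))) \<and> PD (vadd e \<eta>) (theta_app \<delta> m e c) = PD \<eta> c"
  using e
proof (induction e rule: theta_induct)
  case (shift e i)
  have V: "vadd e \<eta> \<in> V" using V_vadd shift \<eta> by blast
  show ?case unfolding vadd_shift theta_app_shift[OF comm shift.hyps(2)]
    using delta_PD(3,4)[OF V shift.hyps(2)] shift.IH by simp
qed (use c in simp)

lemma theta_app_leader:
  assumes \<eta>: "\<eta> \<in> V" and c: "c \<in> Y (Suc (rk \<eta>))" "c \<notin> Y (rk \<eta>)" and e: "e \<in> Theta m"
  shows "theta_app \<delta> m e c \<in> Y (Suc (rk (vadd e \<eta>)))" "theta_app \<delta> m e c \<notin> Y (rk (vadd e \<eta>))"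
proof -
  show "theta_app \<delta> m e c \<in> Y (Suc (rk (vadd e \<eta>)))" using theta_app_PD[OF \<eta> c(1) e] by blast
  have "PD (vadd e \<eta>) (theta_app \<delta> m e c) \<noteq> 0" using theta_app_PD[OF \<eta> c(1) e] PD_nonzero[OF \<eta> c] by simp
  then show "theta_app \<delta> m e c \<notin> Y (rk (vadd e \<eta>))" using PD_const[OF V_vadd[OF e \<eta>]] by blast
qed

end

subsection \<open>Leaders of the relations over an intermediate field\<close>

locale delta_intermediate = delta_extension +
  fixes G :: "'a set"
  assumes delta_G: "delta_subfield m \<delta> G" and F_G: "F \<subseteq> G" and G_sub: "G \<subseteq> field_gen (F \<union> X ` V)"
begin

definition GY :: "nat \<Rightarrow> 'a set" where
  "GY k = field_gen (G \<union> X ` {\<zeta> \<in> V. rk \<zeta> < k})"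

definition E :: "((nat \<Rightarrow> nat) \<times> nat) set" where
  "E = {\<eta> \<in> V. X \<eta> \<in> acl (GY (rk \<eta>))}"

lemma subfield_G: "is_subfield G"
  using delta_G by (simp add: delta_subfield_def)

lemma subfield_GY [simp, intro]: "is_subfield (GY k)"
  unfolding GY_def by blast

lemma GY_mono: "k \<le> l \<Longrightarrow> GY k \<subseteq> GY l"
  unfolding GY_def by (intro field_gen_mono) auto

lemma G_GY: "G \<subseteq> GY k"
  unfolding GY_def using field_gen_superset[of "G \<union> X ` {\<zeta> \<in> V. rk \<zeta> < k}"] by blast

lemma Y_GY: "Y k \<subseteq> GY k"
  unfolding GY_def Y_def using F_G by (intro field_gen_mono) auto

lemma E_V: "E \<subseteq> V"
  by (auto simp: E_def)

lemma delta_GY: "\<eta> \<in> V \<Longrightarrow> i < m \<Longrightarrow> z \<in> GY (rk \<eta>) \<Longrightarrow> \<delta> i z \<in> GY (rk (vshift i \<eta>))"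
  unfolding GY_def by (rule delta_base[OF delta_G])

text \<open>Differentiating the equation of \<open>X \<eta>\<close> expresses its derivative
  rationally: a proper derivative of a leader lies in the field of \<open>G\<close> and the lower
  derivatives itself.\<close>

lemma E_shift:
  assumes "\<eta> \<in> E" "i < m" shows "vshift i \<eta> \<in> E"
proof -
  have \<eta>: "\<eta> \<in> V" "X \<eta> \<in> acl (GY (rk \<eta>))" using assms by (auto simp: E_def)
  let ?W = "GY (rk (vshift i \<eta>))"
  have XW: "X \<eta> \<in> ?W"
    unfolding GY_def using \<eta>(1) rk_shift[OF \<eta>(1) assms(2)] by (intro field_gen_incl) auto
  have "GY (rk \<eta>) \<subseteq> {z \<in> ?W. \<delta> i z \<in> ?W}"
    using delta_GY[OF \<eta>(1) assms(2)] GY_mono[of "rk \<eta>" "rk (vshift i \<eta>)"] rk_shift[OF \<eta>(1) assms(2)] by auto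
  then have "X \<eta> \<in> acl {z \<in> ?W. \<delta> i z \<in> ?W}" using \<eta>(2) acl_mono by blast
  then have "\<delta> i (X \<eta>) \<in> ?W"
    using XW by (intro acl_deriv_preimage[OF subfield_GY deriv_delta[OF assms(2)]])
      (auto intro: subfield_closed(1-4)[OF subfield_GY])
  then have "X (vshift i \<eta>) \<in> acl ?W" using delta_X[OF assms(2)] acl_superset[OF subfield_GY] by auto
  then show ?thesis using V_shift[OF \<eta>(1) assms(2)] by (simp add: E_def)
qed

section \<open>Counting leaders and non-leaders of bounded order\<close>

definition V_upto :: "nat \<Rightarrow> ((nat \<Rightarrow> nat) \<times> nat) set" where
  "V_upto t = {\<eta> \<in> V. theta_ord m (fst \<eta>) \<le> t}"

definition E_upto :: "nat \<Rightarrow> ((nat \<Rightarrow> nat) \<times> nat) set" where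
  "E_upto t = {\<eta> \<in> E. theta_ord m (fst \<eta>) \<le> t}"

lemma V_upto_eq: "V_upto t = {e \<in> Theta m. theta_ord m e \<le> t} \<times> {..<n}"
  by (auto simp: V_upto_def V_def)

lemma finite_V_upto [simp]: "finite (V_upto t)"
  unfolding V_upto_eq by (intro finite_cartesian_product finite_Theta_ord_le finite_lessThan)

lemma card_V_upto: "card (V_upto t) = n * ((t + m) choose m)"
  unfolding V_upto_eq by (simp add: card_cartesian_product card_Theta_ord_le)

lemma E_upto_sub: "E_upto t \<subseteq> V_upto t"
  using E_V by (auto simp: E_upto_def V_upto_def)

lemma finite_E_upto [simp]: "finite (E_upto t)"
  using E_upto_sub finite_V_upto finite_subset by blast

lemma indep_nonleaders: "indep G (X ` (V - E))"
proof (rule indep_ranked[of rk])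
  show "inj_on rk (V - E)" using rk_inj by (rule inj_on_subset) blast
  fix \<eta> assume \<eta>: "\<eta> \<in> V - E"
  have "cl (G \<union> X ` {\<zeta> \<in> V - E. rk \<zeta> < rk \<eta>}) \<subseteq> acl (GY (rk \<eta>))"
    unfolding GY_def cl_def by (intro acl_mono field_gen_mono) auto
  then show "X \<eta> \<notin> cl (G \<union> X ` {\<zeta> \<in> V - E. rk \<zeta> < rk \<eta>})" using \<eta> by (auto simp: E_def)
qed

lemma card_nonleaders: "card (X ` (V_upto t - E)) + card (E_upto t) = n * ((t + m) choose m)"
proof -
  have "inj_on X (V_upto t - E)" using indep_X(1) by (rule inj_on_subset) (auto simp: V_upto_def)
  then have "card (X ` (V_upto t - E)) = card (V_upto t - E_upto t)"
    unfolding card_image[OF \<open>inj_on X (V_upto t - E)\<close>]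
    by (intro arg_cong[of _ _ card]) (auto simp: E_upto_def V_upto_def)
  also have "\<dots> = card (V_upto t) - card (E_upto t)" by (rule card_Diff_subset[OF finite_E_upto E_upto_sub])
  finally show ?thesis using card_V_upto card_mono[OF finite_V_upto E_upto_sub, of t] by simp
qed

text \<open>The non-leaders of order at most \<open>t\<close> form a transcendence basis. A leader
  is algebraic over \<open>G\<close> and the lower derivatives; because the ranking is orderly,
  these have order at most \<open>t\<close> as well, so the induction on the rank stays inside the
  jets.\<close>

lemma trdeg_jets:
  "trdeg G (field_gen (G \<union> (\<Union>j<n. jet m \<delta> t (u j)))) + card (E_upto t) = n * ((t + m) choose m)"
proof -
  let ?B = "X ` (V_upto t - E)"
  have jets: "(\<Union>j<n. jet m \<delta> t (u j)) = X ` V_upto t"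
  proof (intro equalityI subsetI)
    fix y assume "y \<in> (\<Union>j<n. jet m \<delta> t (u j))"
    then obtain j e where "j < n" "e \<in> Theta m" "theta_ord m e \<le> t" "y = theta_app \<delta> m e (u j)"
      unfolding jet_def by blast
    then show "y \<in> X ` V_upto t" unfolding X_def V_upto_def V_def by (intro image_eqI[of _ _ "(e, j)"]) auto
  next
    fix y assume "y \<in> X ` V_upto t"
    then obtain e j where "e \<in> Theta m" "theta_ord m e \<le> t" "j < n" "y = theta_app \<delta> m e (u j)"
      unfolding X_def V_upto_def V_def by auto
    then show "y \<in> (\<Union>j<n. jet m \<delta> t (u j))" unfolding jet_def by blast
  qed
  have "trdeg G (field_gen (G \<union> X ` V_upto t)) = card ?B"
  proof (rule trdeg_eq_card[OF subfield_G])
    show "finite ?B" by simp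
    show "indep G ?B" using indep_nonleaders by (rule indep_subset) (auto simp: V_upto_def)
    show "?B \<subseteq> field_gen (G \<union> X ` V_upto t)" using field_gen_superset[of "G \<union> X ` V_upto t"] by auto
    have "X \<eta> \<in> cl (G \<union> ?B)" if "\<eta> \<in> V_upto t" for \<eta>
      using that
    proof (induction "rk \<eta>" arbitrary: \<eta> rule: less_induct)
      case less
      show ?case
      proof (cases "\<eta> \<in> E")
        case False
        then show ?thesis using less.prems by (intro cl_incl) auto
      next
        case True
        have \<eta>: "\<eta> \<in> V" "theta_ord m (fst \<eta>) \<le> t" using less.prems by (auto simp: V_upto_def)
        have "X \<zeta> \<in> cl (G \<union> ?B)" if "\<zeta> \<in> V" "rk \<zeta> < rk \<eta>" for \<zeta>
          using less.hyps[of \<zeta>] that ord_le_of_rk[OF that(1) \<eta>(1)] \<eta>(2) by (simp add: V_upto_def)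
        then have "G \<union> X ` {\<zeta> \<in> V. rk \<zeta> < rk \<eta>} \<subseteq> cl (G \<union> ?B)" using cl_superset[of "G \<union> ?B"] by auto
        then have "cl (G \<union> X ` {\<zeta> \<in> V. rk \<zeta> < rk \<eta>}) \<subseteq> cl (G \<union> ?B)" by (rule cl_least)
        then show ?thesis using True unfolding E_def GY_def cl_def by blast
      qed
    qed
    then have "G \<union> X ` V_upto t \<subseteq> cl (G \<union> ?B)" using cl_superset[of "G \<union> ?B"] by auto
    then show "field_gen (G \<union> X ` V_upto t) \<subseteq> cl (G \<union> ?B)" by (intro field_gen_least) auto
  qed
  then show ?thesis unfolding jets using card_nonleaders[of t] by simp
qed

text \<open>By \<open>trdeg_jets\<close> the subtracted binomial has to count the leaders. The
  truncated subtraction \<open>t - s\<close> agrees with the argument of the polynomial once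
  \<open>t \<ge> s\<close>, which suffices for an eventual statement.\<close>

lemma kolchin_polynomial_iff:
  "is_kolchin_polynomial m \<delta> G n u
     (of_nat n * binomial_poly (of_nat m) m - binomial_poly (of_nat m - of_nat s) m) \<longleftrightarrow>
   (\<forall>\<^sub>F t in sequentially. card (E_upto t) = (t - s + m) choose m)"
proof -
  have "poly (of_nat n * binomial_poly (of_nat m) m - binomial_poly (of_nat m - of_nat s) m) (of_nat t) =
      of_nat (trdeg G (field_gen (G \<union> (\<Union>j<n. jet m \<delta> t (u j))))) \<longleftrightarrow>
    card (E_upto t) = (t - s + m) choose m" if "t \<ge> s" for t
  proof -
    have "(of_nat t :: rat) + of_nat m = of_nat (t + m)" "(of_nat t :: rat) + (of_nat m - of_nat s) = of_nat (t - s + m)"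
      using that by (auto simp: of_nat_diff)
    then have "poly (of_nat n * binomial_poly (of_nat m) m - binomial_poly (of_nat m - of_nat s) m) (of_nat t) =
      (of_nat (n * ((t + m) choose m)) :: rat) - of_nat ((t - s + m) choose m)"
      by (simp only: poly_diff poly_mult poly_of_nat poly_binomial_poly binomial_gbinomial of_nat_mult)
    moreover have "of_nat (trdeg G (field_gen (G \<union> (\<Union>j<n. jet m \<delta> t (u j))))) =
      (of_nat (n * ((t + m) choose m)) :: rat) - of_nat (card (E_upto t))"
      using arg_cong[OF trdeg_jets[of t], of "of_nat :: nat \<Rightarrow> rat"] by (simp add: algebra_simps)
    ultimately show ?thesis by auto
  qed
  then have "\<forall>\<^sub>F t in sequentially. (poly (of_nat n * binomial_poly (of_nat m) m - binomial_poly (of_nat m - of_nat s) m) (of_nat t) =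
      of_nat (trdeg G (field_gen (G \<union> (\<Union>j<n. jet m \<delta> t (u j)))))) =
    (card (E_upto t) = (t - s + m) choose m)"
    unfolding eventually_sequentially by blast
  then show ?thesis unfolding is_kolchin_polynomial_def by (rule eventually_subst)
qed

subsection \<open>Necessity\<close>

text \<open>A triangular change of coordinates: at the multiples of the leader of \<open>v\<close>,
  the derivatives of the indeterminates are replaced by those of \<open>v\<close>. The new family is
  again independent and \<open>G\<close> is generated over \<open>F\<close> by some of its members,
  so no other member becomes a leader.\<close>

lemma E_of_generator:
  assumes v: "v \<in> G" "v \<notin> F" and G: "G = field_gen (F \<union> {theta_app \<delta> m e v |e. e \<in> Theta m})"
  obtains \<eta>0 where "\<eta>0 \<in> V" "E = (\<lambda>e. vadd e \<eta>0) ` Theta m"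
proof -
  obtain \<eta>0 where \<eta>0: "\<eta>0 \<in> V" "v \<in> Y (Suc (rk \<eta>0))" "v \<notin> Y (rk \<eta>0)"
    using leader_exists[of v] v G_sub by blast
  define Z where "Z = (\<lambda>e. vadd e \<eta>0) ` Theta m"
  have lead: "theta_app \<delta> m e v \<in> Y (Suc (rk (vadd e \<eta>0)))" "theta_app \<delta> m e v \<notin> Y (rk (vadd e \<eta>0))"
    if "e \<in> Theta m" for e using theta_app_leader[OF \<eta>0 that] by auto
  have ZE: "Z \<subseteq> E"
  proof
    fix \<zeta> assume "\<zeta> \<in> Z"
    then obtain e where e: "e \<in> Theta m" "\<zeta> = vadd e \<eta>0" by (auto simp: Z_def)
    have \<zeta>: "\<zeta> \<in> V" using e V_vadd \<eta>0 by blast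
    have "theta_app \<delta> m e v \<in> G" using theta_app_mem[OF comm delta_G e(1) v(1)] .
    then have "insert (theta_app \<delta> m e v) (Y (rk \<zeta>)) \<subseteq> GY (rk \<zeta>)" using G_GY Y_GY by blast
    then have "cl (insert (theta_app \<delta> m e v) (Y (rk \<zeta>))) \<subseteq> acl (GY (rk \<zeta>))"
      unfolding cl_def by (intro acl_mono field_gen_least) auto
    then show "\<zeta> \<in> E" using X_algebraic_over_nonconst[OF \<zeta>] lead[OF e(1)] e(2) \<zeta> by (auto simp: E_def)
  qed
  define \<epsilon> where "\<epsilon> = inv_into (Theta m) (\<lambda>e. vadd e \<eta>0)"
  have \<epsilon>: "\<epsilon> (vadd e \<eta>0) = e" if "e \<in> Theta m" for e
    unfolding \<epsilon>_def using that by (intro inv_into_f_f) (auto simp: inj_on_def inj_vadd)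
  \<comment> \<open>The new coordinates; each has the same leader as the derivative that it
    replaces.\<close>
  define w where "w \<zeta> = (if \<zeta> \<in> Z then theta_app \<delta> m (\<epsilon> \<zeta>) v else X \<zeta>)" for \<zeta>
  have wZ: "w (vadd e \<eta>0) = theta_app \<delta> m e v" if "e \<in> Theta m" for e
    using that \<epsilon> by (auto simp: w_def Z_def)
  have wY: "w \<zeta> \<in> Y (Suc (rk \<zeta>))" if "\<zeta> \<in> V" for \<zeta>
  proof (cases "\<zeta> \<in> Z")
    case True
    then show ?thesis using wZ lead(1) by (auto simp: Z_def)
  qed (use that X_Y in \<open>simp add: w_def\<close>)
  have Xw: "X \<zeta> \<in> cl (insert (w \<zeta>) (Y (rk \<zeta>)))" if "\<zeta> \<in> V" for \<zeta>
  proof (cases "\<zeta> \<in> Z")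
    case True
    then obtain e where "e \<in> Theta m" "\<zeta> = vadd e \<eta>0" by (auto simp: Z_def)
    then show ?thesis using X_algebraic_over_nonconst[OF that] lead wZ by simp
  qed (auto simp: w_def intro: cl_incl)
  have clY: "cl (Y k) = acl (Y k)" for k by (simp add: cl_def)
  have Yw: "Y k \<subseteq> cl (F \<union> w ` {\<zeta> \<in> V. rk \<zeta> < k})" for k
  proof (induction k)
    case 0
    then show ?case using cl_superset[of F] by (simp add: Y_0)
  next
    case (Suc k)
    let ?C = "cl (F \<union> w ` {\<zeta> \<in> V. rk \<zeta> < Suc k})"
    have "cl (F \<union> w ` {\<zeta> \<in> V. rk \<zeta> < k}) \<subseteq> ?C" by (intro cl_mono) auto
    then have YC: "Y k \<subseteq> ?C" using Suc by blast
    show ?case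
    proof (cases "\<exists>\<zeta>\<in>V. rk \<zeta> = k")
      case True
      then obtain \<zeta> where \<zeta>: "\<zeta> \<in> V" "rk \<zeta> = k" by blast
      have "w \<zeta> \<in> ?C" using \<zeta> by (intro cl_incl) auto
      then have "cl (insert (w \<zeta>) (Y k)) \<subseteq> ?C" using YC by (intro cl_least) auto
      then have "X \<zeta> \<in> ?C" using Xw[OF \<zeta>(1)] \<zeta>(2) by blast
      then have "field_gen (insert (X \<zeta>) (Y k)) \<subseteq> ?C" using YC by (intro field_gen_least) auto
      then show ?thesis using Y_Suc[OF \<zeta>(1)] \<zeta>(2) by simp
    next
      case False
      then have "Y (Suc k) = Y k" by (intro Y_Suc_none) auto
      then show ?thesis using YC by simp
    qed
  qed
  \<comment> \<open>\<open>X \<zeta>\<close> is algebraic over \<open>w \<zeta>\<close> and the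
    lower derivatives, so a coordinate dependent on the lower ones would make
    \<open>X \<zeta>\<close> dependent on them too.\<close>
  have notin: "w \<zeta> \<notin> cl (F \<union> w ` {\<xi> \<in> V. rk \<xi> < rk \<zeta>})" if \<zeta>: "\<zeta> \<in> V" for \<zeta>
  proof
    assume a: "w \<zeta> \<in> cl (F \<union> w ` {\<xi> \<in> V. rk \<xi> < rk \<zeta>})"
    have "w ` {\<xi> \<in> V. rk \<xi> < rk \<zeta>} \<subseteq> Y (rk \<zeta>)"
    proof (rule image_subsetI)
      fix \<xi> assume "\<xi> \<in> {\<xi> \<in> V. rk \<xi> < rk \<zeta>}"
      then show "w \<xi> \<in> Y (rk \<zeta>)" using wY[of \<xi>] Y_mono[of "Suc (rk \<xi>)" "rk \<zeta>"] by auto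
    qed
    then have "F \<union> w ` {\<xi> \<in> V. rk \<xi> < rk \<zeta>} \<subseteq> cl (Y (rk \<zeta>))" using F_Y cl_superset[of "Y (rk \<zeta>)"] by blast
    then have "w \<zeta> \<in> cl (Y (rk \<zeta>))" using a cl_least by blast
    then have "cl (insert (w \<zeta>) (Y (rk \<zeta>))) \<subseteq> cl (Y (rk \<zeta>))"
      using cl_superset[of "Y (rk \<zeta>)"] by (intro cl_least) auto
    then show False using Xw[OF \<zeta>] X_notin_acl_Y[OF \<zeta>] clY by blast
  qed
  have ind: "indep F (w ` V)" "inj_on w V" using indep_ranked[of rk V w F] rk_inj notin by auto
  have "E \<subseteq> Z"
  proof
    fix \<eta> assume \<eta>: "\<eta> \<in> E"
    show "\<eta> \<in> Z"
    proof (rule ccontr)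
      assume nZ: "\<eta> \<notin> Z"
      have \<eta>V: "\<eta> \<in> V" using \<eta> E_V by blast
      have sub: "w ` (V - {\<eta>}) \<subseteq> w ` V - {w \<eta>}" using ind(2) \<eta>V by (auto simp: inj_on_def)
      let ?C = "cl (F \<union> (w ` V - {w \<eta>}))"
      \<comment> \<open>Generators of \<open>G\<close> over \<open>F\<close> are coordinates other
        than \<open>w \<eta>\<close>, and the derivatives below \<open>\<eta>\<close> depend on
        lower coordinates. So \<open>X \<eta> = w \<eta>\<close> would depend on the other
        coordinates.\<close>
      have "theta_app \<delta> m e v \<in> w ` (V - {\<eta>})" if "e \<in> Theta m" for e
        using wZ[OF that] nZ V_vadd[OF that \<eta>0(1)] that unfolding Z_def by (metis Diff_iff image_eqI singletonD)
      then have "F \<union> {theta_app \<delta> m e v |e. e \<in> Theta m} \<subseteq> ?C"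
        using sub cl_superset[of "F \<union> (w ` V - {w \<eta>})"] by blast
      then have "G \<subseteq> ?C" by (subst G) (rule field_gen_least[OF subfield_cl])
      moreover have "X ` {\<zeta> \<in> V. rk \<zeta> < rk \<eta>} \<subseteq> ?C"
      proof -
        have "X ` {\<zeta> \<in> V. rk \<zeta> < rk \<eta>} \<subseteq> Y (rk \<eta>)" using X_Y by blast
        also have "\<dots> \<subseteq> cl (F \<union> w ` {\<zeta> \<in> V. rk \<zeta> < rk \<eta>})" by (rule Yw)
        also have "\<dots> \<subseteq> ?C" using sub by (intro cl_mono) auto
        finally show ?thesis .
      qed
      ultimately have "cl (G \<union> X ` {\<zeta> \<in> V. rk \<zeta> < rk \<eta>}) \<subseteq> ?C" by (intro cl_least) auto
      then have "X \<eta> \<in> ?C" using \<eta> unfolding E_def GY_def cl_def by blast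
      moreover have "w \<eta> = X \<eta>" using nZ by (simp add: w_def)
      ultimately show False using ind(1) \<eta>V unfolding indep_def by auto
    qed
  qed
  then have "E = (\<lambda>e. vadd e \<eta>0) ` Theta m" using ZE unfolding Z_def by blast
  then show ?thesis using that \<eta>0(1) by blast
qed

lemma card_E_upto_of_principal:
  assumes "\<eta>0 \<in> V" "E = (\<lambda>e. vadd e \<eta>0) ` Theta m" "theta_ord m (fst \<eta>0) \<le> t"
  shows "card (E_upto t) = (t - theta_ord m (fst \<eta>0) + m) choose m"
proof -
  have "E_upto t = (\<lambda>e. vadd e \<eta>0) ` {e \<in> Theta m. theta_ord m e \<le> t - theta_ord m (fst \<eta>0)}"
    using assms(3) unfolding E_upto_def assms(2) by (auto simp: theta_ord_vadd)
  moreover have "inj_on (\<lambda>e. vadd e \<eta>0) A" for A by (simp add: inj_on_def inj_vadd)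
  ultimately show ?thesis by (simp add: card_image card_Theta_ord_le)
qed

end

subsection \<open>Composita\<close>

text \<open>The ring \<open>A[B]\<close> for subfields \<open>A\<close> and \<open>B\<close>. As a
  union of finite spans it lets an element be written over a linearly independent part of
  \<open>B\<close>.\<close>

definition compositum_ring :: "'a::field set \<Rightarrow> 'a set \<Rightarrow> 'a set" where
  "compositum_ring A B = \<Union>{lin_span A M (\<lambda>b. b) |M. finite M \<and> M \<subseteq> B}"

lemma compositum_ringI: "finite M \<Longrightarrow> M \<subseteq> B \<Longrightarrow> z \<in> lin_span A M (\<lambda>b. b) \<Longrightarrow> z \<in> compositum_ring A B"
  unfolding compositum_ring_def by blast

lemma compositum_ring_common:
  assumes A: "is_subfield A" and "finite I" "\<And>i. i \<in> I \<Longrightarrow> z i \<in> compositum_ring A B"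
  obtains M where "finite M" "M \<subseteq> B" "\<And>i. i \<in> I \<Longrightarrow> z i \<in> lin_span A M (\<lambda>b. b)"
proof -
  have "\<exists>M. finite M \<and> M \<subseteq> B \<and> z i \<in> lin_span A M (\<lambda>b. b)" if "i \<in> I" for i
    using assms(3)[OF that] unfolding compositum_ring_def by blast
  then obtain M where M: "\<And>i. i \<in> I \<Longrightarrow> finite (M i)" "\<And>i. i \<in> I \<Longrightarrow> M i \<subseteq> B"
    "\<And>i. i \<in> I \<Longrightarrow> z i \<in> lin_span A (M i) (\<lambda>b. b)" by metis
  let ?M = "\<Union>i\<in>I. M i"
  have fin: "finite ?M" using assms(2) M(1) by blast
  show ?thesis
  proof (rule that[OF fin])
    show "?M \<subseteq> B" using M(2) by blast
    show "z i \<in> lin_span A ?M (\<lambda>b. b)" if "i \<in> I" for i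
      using lin_span_trans[OF A order_refl fin M(3)[OF that]] lin_span_base[OF A fin, of _ "\<lambda>b. b"] that by blast
  qed
qed

lemma compositum_ring_closed:
  assumes A: "is_subfield A" and B: "is_subfield B" and ab: "a \<in> compositum_ring A B" "b \<in> compositum_ring A B"
  shows compositum_ring_add: "a + b \<in> compositum_ring A B"
    and compositum_ring_mult: "a * b \<in> compositum_ring A B"
proof -
  obtain M where M: "finite M" "M \<subseteq> B" "\<And>i. i \<in> {a, b} \<Longrightarrow> i \<in> lin_span A M (\<lambda>b. b)"
    using compositum_ring_common[OF A, of "{a, b}" "\<lambda>i. i" B] ab by auto
  show "a + b \<in> compositum_ring A B" using M by (intro compositum_ringI[OF M(1,2)] lin_span_add[OF A]) auto
  have aM: "a \<in> lin_span A M (\<lambda>b. b)" and bM: "b \<in> lin_span A M (\<lambda>b. b)" using M(3) by auto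
  obtain f where f: "\<And>i. i \<in> M \<Longrightarrow> f i \<in> A" "a = (\<Sum>i\<in>M. f i * i)" using lin_spanE[OF aM] by blast
  obtain g where g: "\<And>i. i \<in> M \<Longrightarrow> g i \<in> A" "b = (\<Sum>i\<in>M. g i * i)" using lin_spanE[OF bM] by blast
  let ?P = "(\<lambda>(x, y). x * y) ` (M \<times> M)"
  have finP: "finite ?P" using M(1) by simp
  have "a * b = (\<Sum>i\<in>M. \<Sum>j\<in>M. (f i * g j) * (i * j))"
    unfolding f(2) g(2) sum_product by (intro sum.cong refl) (simp add: algebra_simps)
  also have "\<dots> \<in> lin_span A ?P (\<lambda>b. b)"
  proof (intro lin_span_sum[OF A])
    fix i j assume "i \<in> M" "j \<in> M"
    then have "f i * g j \<in> A" "i * j \<in> lin_span A ?P (\<lambda>b. b)"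
      using subfield_mult[OF A f(1) g(1)] lin_span_base[OF A finP, of "i * j" "\<lambda>b. b"] by auto
    then show "(f i * g j) * (i * j) \<in> lin_span A ?P (\<lambda>b. b)" by (rule lin_span_scale[OF A])
  qed
  finally show "a * b \<in> compositum_ring A B"
    using M(2) subfield_mult[OF B] by (intro compositum_ringI[OF finP]) auto
qed

lemma compositum_ring_left:
  assumes A: "is_subfield A" and B: "is_subfield B" and "a \<in> A" shows "a \<in> compositum_ring A B"
  using lin_span_scale[OF A assms(3) lin_span_base[OF A, of "{1}" 1 "\<lambda>b. b"]] subfield_1[OF B]
  by (intro compositum_ringI[of "{1}"]) auto

lemma compositum_fractions:
  assumes A: "is_subfield A" and B: "is_subfield B" and z: "z \<in> field_gen (A \<union> B)"
  shows "\<exists>p\<in>compositum_ring A B. \<exists>q\<in>compositum_ring A B. q \<noteq> 0 \<and> z = p / q"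
proof -
  let ?S = "compositum_ring A B"
  note inA = compositum_ring_left[OF A B]
  have inB: "b \<in> ?S" if "b \<in> B" for b
    using lin_span_base[OF A, of "{b}" b "\<lambda>b. b"] that by (intro compositum_ringI[of "{b}"]) auto
  have um: "- a \<in> ?S" if "a \<in> ?S" for a
    using compositum_ring_mult[OF A B inA[OF subfield_uminus[OF A subfield_1[OF A]]] that] by simp
  show ?thesis
    by (rule field_gen_fractions[OF inA[OF subfield_1[OF A]] inA[OF subfield_0[OF A]]
          compositum_ring_add[OF A B] compositum_ring_mult[OF A B] um _ z])
      (use inA inB in auto)
qed

subsection \<open>Sufficiency\<close>

locale delta_principal = delta_intermediate +
  fixes \<eta>0 :: "(nat \<Rightarrow> nat) \<times> nat"
  assumes \<eta>0: "\<eta>0 \<in> V" and E_eq: "E = (\<lambda>e. vadd e \<eta>0) ` Theta m"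
begin

text \<open>\<open>Y k0\<close> is the field generated by the derivatives up to and including
  \<open>\<eta>0\<close>, the field called \<open>X\<close> in the overview; here \<open>X\<close>
  denotes the derivatives themselves. The successor is what includes \<open>\<eta>0\<close>.\<close>

definition k0 :: nat where
  "k0 = Suc (rk \<eta>0)"

definition G0 :: "'a set" where
  "G0 = G \<inter> Y k0"

lemma rk_E: "\<eta> \<in> E \<Longrightarrow> rk \<eta>0 \<le> rk \<eta>"
  using rk_vadd_le \<eta>0 unfolding E_eq by blast

lemma \<eta>0_E: "\<eta>0 \<in> E"
  unfolding E_eq using zero_Theta by (intro image_eqI[of _ _ "\<lambda>_. 0"]) auto

lemma subfield_G0: "is_subfield G0"
  unfolding G0_def using subfield_G by (intro subfield_Int) auto

lemma Y_Suc_sub_upto: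
  assumes "\<eta> \<in> V" shows "Y (Suc (rk \<eta>)) \<subseteq> field_gen (F \<union> X ` V_upto (theta_ord m (fst \<eta>)))"
proof -
  have "{\<zeta> \<in> V. rk \<zeta> < Suc (rk \<eta>)} \<subseteq> V_upto (theta_ord m (fst \<eta>))"
    using ord_le_of_rk[OF _ assms] by (auto simp: V_upto_def less_Suc_eq_le)
  then show ?thesis unfolding Y_def by (intro field_gen_mono) auto
qed

text \<open>\<open>Z\<close> stays independent over \<open>F\<close> after adding the non-leaders,
  which are independent over \<open>G\<close>. All of them depend on the derivatives of order at
  most \<open>T\<close>, and the non-leaders leave only as many places as there are leaders.\<close>

lemma card_indep_le:
  assumes "finite Z" "Z \<subseteq> G" "indep F Z" "Z \<subseteq> field_gen (F \<union> X ` V_upto T)"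
  shows "card Z \<le> card (E_upto T)"
proof -
  let ?B = "X ` (V_upto T - E)"
  have B: "indep G ?B" using indep_nonleaders by (rule indep_subset) (auto simp: V_upto_def)
  have "finite ?B" "F \<subseteq> cl G" "Z \<subseteq> cl G" using F_G assms(2) cl_superset[of G] by auto
  note ZB = indep_Un[OF assms(3) B this(2,3,1)]
  have "Z \<union> ?B \<subseteq> cl (F \<union> X ` V_upto T)"
    using assms(4) field_gen_subset_cl[of "F \<union> X ` V_upto T"] cl_superset[of "F \<union> X ` V_upto T"] by blast
  then have "card (Z \<union> ?B) \<le> card (X ` V_upto T)" using assms(1) by (intro steinitz[OF _ _ ZB(1)]) auto
  also have "\<dots> \<le> card (V_upto T)" by (intro card_image_le) simp
  finally show ?thesis
    using card_Un_disjoint[OF assms(1) \<open>finite ?B\<close> ZB(2)] card_nonleaders[of T] card_V_upto[of T] by simp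
qed

text \<open>The heart of the matter. Let \<open>\<eta>\<close> be the common leader of the \<open>c i\<close>. If \<open>\<eta>\<close> does not occur in
  the \<open>f i\<close>, applying \<open>\<partial>/\<partial>\<eta>\<close> gives a relation between the \<open>f i\<close> with coefficients \<open>PD \<eta> (c i)\<close>.
  By counting, there is an operator \<open>\<theta>\<close> such that the \<open>\<theta> (c i)\<close> have transcendence degree 1 over the
  lower derivatives of the \<open>c i\<close>, so these coefficients are proportional to elements of \<open>G\<close>.\<close>

lemma coefficients_mem:
  assumes I: "finite I" and f: "\<And>i. i \<in> I \<Longrightarrow> f i \<in> Y k0" "f0 \<in> Y k0" and c: "\<And>i. i \<in> I \<Longrightarrow> c i \<in> G"
    and rel: "f0 = (\<Sum>i\<in>I. c i * f i)" and ind: "\<not> lin_dep G I f"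
  shows "\<forall>i\<in>I. c i \<in> Y k0"
proof (rule ccontr)
  assume "\<not> ?thesis"
  then have "\<exists>i\<in>I. c i \<notin> Y k0" by blast
  moreover have "c i \<in> field_gen (F \<union> X ` V)" if "i \<in> I" for i using c[OF that] G_sub by blast
  ultimately obtain \<eta> where \<eta>: "\<eta> \<in> V" "k0 \<le> rk \<eta>" "\<And>i. i \<in> I \<Longrightarrow> c i \<in> Y (Suc (rk \<eta>))" "\<exists>i\<in>I. c i \<notin> Y (rk \<eta>)"
    using common_leader[OF I, of c k0] by blast
  obtain i1 where i1: "i1 \<in> I" "c i1 \<notin> Y (rk \<eta>)" using \<eta>(4) by blast
  define s where "s i = PD \<eta> (c i)" for i
  have s1: "s i1 \<noteq> 0" unfolding s_def using PD_nonzero[OF \<eta>(1) \<eta>(3)[OF i1(1)] i1(2)] .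
  have fY: "f i \<in> Y (rk \<eta>)" if "i \<in> I" for i using f(1)[OF that] Y_mono[OF \<eta>(2)] by blast
  have fY': "f i \<in> Y (Suc (rk \<eta>))" if "i \<in> I" for i using fY[OF that] Y_mono[of "rk \<eta>" "Suc (rk \<eta>)"] by auto
  note r = deriv_on_rules[OF subfield_Y deriv_PD[OF \<eta>(1)]]
  \<comment> \<open>\<open>\<eta>\<close> has rank at least \<open>k0\<close>, so the
    \<open>f i\<close> and \<open>f0\<close> are constants for \<open>PD \<eta>\<close> and only the
    coefficients are differentiated. The resulting \<open>s i\<close> need not lie in
    \<open>G\<close>.\<close>
  have "0 = PD \<eta> f0" using PD_const[OF \<eta>(1)] f(2) Y_mono[OF \<eta>(2)] by auto
  also have "\<dots> = (\<Sum>i\<in>I. PD \<eta> (c i * f i))"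
    unfolding rel using \<eta>(3) fY' by (intro r(8) subfield_mult[OF subfield_Y]) auto
  also have "\<dots> = (\<Sum>i\<in>I. s i * f i)"
    using r(2) \<eta>(3) fY' PD_const[OF \<eta>(1) fY] by (intro sum.cong refl) (simp add: s_def)
  finally have srel: "(\<Sum>i\<in>I. s i * f i) = 0" by simp

  define th where "th e i = theta_app \<delta> m e (c i)" for e i
  \<comment> \<open>\<open>F\<close> and the differentiated coefficients whose operators take
    \<open>\<eta>\<close> to a smaller rank than \<open>e\<close> does. The strict inequality keeps
    them in \<open>Y (rk (vadd e \<eta>))\<close>, where \<open>PD (vadd e \<eta>)\<close>
    vanishes.\<close>
  define Low where "Low e = F \<union> {th e' i |e' i. e' \<in> Theta m \<and> i \<in> I \<and> rk (vadd e' \<eta>) < rk (vadd e \<eta>)}" for e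
  have thY: "th e i \<in> Y (Suc (rk (vadd e \<eta>)))" "PD (vadd e \<eta>) (th e i) = s i" if "e \<in> Theta m" "i \<in> I" for e i
    using theta_app_PD[OF \<eta>(1) \<eta>(3)[OF that(2)] that(1)] unfolding th_def s_def by auto
  have thG: "th e i \<in> G" if "e \<in> Theta m" "i \<in> I" for e i
    unfolding th_def using theta_app_mem[OF comm delta_G that(1) c[OF that(2)]] .
  have LowY: "Low e \<subseteq> Y (rk (vadd e \<eta>))" for e
  proof
    fix y assume "y \<in> Low e"
    then consider "y \<in> F" | e' i where "e' \<in> Theta m" "i \<in> I" "rk (vadd e' \<eta>) < rk (vadd e \<eta>)" "y = th e' i"
      unfolding Low_def by blast
    then show "y \<in> Y (rk (vadd e \<eta>))"
    proof cases
      case 2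
      then show ?thesis using thY(1)[of e' i] Y_mono[of "Suc (rk (vadd e' \<eta>))" "rk (vadd e \<eta>)"] by auto
    qed (use F_Y in blast)
  qed
  have LowG: "Low e \<subseteq> G" for e unfolding Low_def using F_G thG by blast
  have th1: "th e i1 \<notin> cl (Low e)" if e: "e \<in> Theta m" for e
  proof
    assume "th e i1 \<in> cl (Low e)"
    moreover have "cl (Low e) \<subseteq> acl (Y (rk (vadd e \<eta>)))"
      unfolding cl_def using LowY by (intro acl_mono field_gen_least) auto
    ultimately have "th e i1 \<in> acl (Y (rk (vadd e \<eta>)))" by blast
    moreover have "Y (rk (vadd e \<eta>)) \<subseteq> Y (Suc (rk (vadd e \<eta>)))" by (intro Y_mono) simp
    ultimately have "PD (vadd e \<eta>) (th e i1) = 0"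
      using PD_const[OF V_vadd[OF e \<eta>(1)]] thY(1)[OF e i1(1)]
      by (intro PD_zero_algebraic[OF V_vadd[OF e \<eta>(1)], of "Y (rk (vadd e \<eta>))"]) auto
    then show False using thY(2)[OF e i1(1)] s1 by simp
  qed

  \<comment> \<open>Otherwise every operator supplies two elements of \<open>G\<close>:
    \<open>th e i1\<close> and one independent of it and of \<open>Low e\<close>. The operators of
    order at most \<open>t\<close> would give twice a full binomial of independent elements of order
    at most \<open>t + r\<close>, too many for \<open>card_indep_le\<close>.\<close>
  have "\<exists>e\<in>Theta m. \<forall>i\<in>I. th e i \<in> cl (insert (th e i1) (Low e))"
  proof (rule ccontr)
    assume "\<not> ?thesis"
    then have "\<exists>i. i \<in> I \<and> th e i \<notin> cl (insert (th e i1) (Low e))" if "e \<in> Theta m" for e using that by blast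
    then obtain ii where ii: "\<And>e. e \<in> Theta m \<Longrightarrow> ii e \<in> I"
      "\<And>e. e \<in> Theta m \<Longrightarrow> th e (ii e) \<notin> cl (insert (th e i1) (Low e))" by metis
    define z where "z p = (if snd p = 0 then th (fst p) i1 else th (fst p) (ii (fst p)))" for p :: "(nat \<Rightarrow> nat) \<times> nat"
    \<comment> \<open>Doubling the ranks makes room for two elements per operator,
      \<open>th e i1\<close> being the lower one.\<close>
    define rr where "rr p = 2 * rk (vadd (fst p) \<eta>) + snd p" for p :: "(nat \<Rightarrow> nat) \<times> nat"
    let ?P = "Theta m \<times> {0, 1::nat}"
    have rkv: "rk (vadd e \<eta>) = rk (vadd e' \<eta>) \<Longrightarrow> e = e'" if "e \<in> Theta m" "e' \<in> Theta m" for e e'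
      using rk_eq[OF V_vadd[OF that(1) \<eta>(1)] V_vadd[OF that(2) \<eta>(1)]] inj_vadd by blast
    have inj: "inj_on rr ?P"
    proof (rule inj_onI)
      fix p q assume pq: "p \<in> ?P" "q \<in> ?P" "rr p = rr q"
      then have "rk (vadd (fst p) \<eta>) = rk (vadd (fst q) \<eta>)" "snd p = snd q" by (auto simp: rr_def) presburger+
      then show "p = q" using rkv pq by (auto simp: prod_eq_iff)
    qed
    have low: "z q \<in> (if snd p = 0 then Low (fst p) else insert (th (fst p) i1) (Low (fst p)))"
      if "p \<in> ?P" "q \<in> ?P" "rr q < rr p" for p q
    proof (cases "rk (vadd (fst q) \<eta>) < rk (vadd (fst p) \<eta>)")
      case True
      have "\<exists>i\<in>I. z q = th (fst q) i" using i1 ii(1) that(2) unfolding z_def by auto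
      then have "z q \<in> Low (fst p)" using True that(2) unfolding Low_def by auto
      then show ?thesis by simp
    next
      case False
      then have *: "rk (vadd (fst q) \<eta>) = rk (vadd (fst p) \<eta>)" "snd q = 0" "snd p = 1" using that by (auto simp: rr_def)
      then have "fst q = fst p" using rkv[of "fst q" "fst p"] that by auto
      then show ?thesis using * by (simp add: z_def)
    qed
    have zn: "z p \<notin> cl (F \<union> z ` {q \<in> ?P. rr q < rr p})" if p: "p \<in> ?P" for p
    proof (cases "snd p = 0")
      case True
      then have "F \<union> z ` {q \<in> ?P. rr q < rr p} \<subseteq> Low (fst p)" using low[OF p] unfolding Low_def by auto
      then have "cl (F \<union> z ` {q \<in> ?P. rr q < rr p}) \<subseteq> cl (Low (fst p))" by (rule cl_mono)
      moreover have "z p \<notin> cl (Low (fst p))" using th1[of "fst p"] p True by (auto simp: z_def)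
      ultimately show ?thesis by blast
    next
      case False
      have "F \<union> z ` {q \<in> ?P. rr q < rr p} \<subseteq> insert (th (fst p) i1) (Low (fst p))"
        using low[OF p] False unfolding Low_def by auto
      then have "cl (F \<union> z ` {q \<in> ?P. rr q < rr p}) \<subseteq> cl (insert (th (fst p) i1) (Low (fst p)))" by (rule cl_mono)
      moreover have "z p \<notin> cl (insert (th (fst p) i1) (Low (fst p)))" using ii(2)[of "fst p"] p False by (auto simp: z_def)
      ultimately show ?thesis by blast
    qed
    have zind: "indep F (z ` ?P)" "inj_on z ?P" using indep_ranked[OF inj zn] by auto
    define r where "r = theta_ord m (fst \<eta>)"
    have "2 * ((t + m) choose m) \<le> (t + r + m) choose m" for t
    proof -
      let ?Pt = "{e \<in> Theta m. theta_ord m e \<le> t} \<times> {0, 1::nat}"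
      have sub: "?Pt \<subseteq> ?P" by auto
      have fin: "finite ?Pt" using finite_Theta_ord_le by blast
      have zG: "z p \<in> G" if "p \<in> ?P" for p using that thG i1 ii(1) unfolding z_def by auto
      have zY: "z p \<in> field_gen (F \<union> X ` V_upto (t + r))" if p: "p \<in> ?Pt" for p
      proof -
        have "fst p \<in> Theta m" using p by auto
        then have "z p \<in> Y (Suc (rk (vadd (fst p) \<eta>)))" using thY(1) i1 ii(1) unfolding z_def by auto
        then have "z p \<in> field_gen (F \<union> X ` V_upto (theta_ord m (fst (vadd (fst p) \<eta>))))"
          using Y_Suc_sub_upto[OF V_vadd[OF \<open>fst p \<in> Theta m\<close> \<eta>(1)]] by blast
        moreover have "V_upto (theta_ord m (fst (vadd (fst p) \<eta>))) \<subseteq> V_upto (t + r)"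
          using p by (auto simp: V_upto_def theta_ord_vadd r_def)
        then have "field_gen (F \<union> X ` V_upto (theta_ord m (fst (vadd (fst p) \<eta>)))) \<subseteq> field_gen (F \<union> X ` V_upto (t + r))"
          by (intro field_gen_mono) auto
        ultimately show ?thesis by blast
      qed
      have "card (z ` ?Pt) \<le> card (E_upto (t + r))"
        using fin zG zY sub indep_subset[OF zind(1), of "z ` ?Pt"]
        by (intro card_indep_le) (auto intro: image_mono)
      moreover have "card (z ` ?Pt) = 2 * ((t + m) choose m)"
        using card_image[OF inj_on_subset[OF zind(2) sub]] by (simp add: card_cartesian_product card_Theta_ord_le)
      moreover have "theta_ord m (fst \<eta>0) \<le> r"
        unfolding r_def using ord_le_of_rk[OF \<eta>0 \<eta>(1)] \<eta>(2) by (simp add: k0_def)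
      then have "card (E_upto (t + r)) = (t + r - theta_ord m (fst \<eta>0) + m) choose m"
        by (intro card_E_upto_of_principal[OF \<eta>0 E_eq]) simp
      moreover have "(t + r - theta_ord m (fst \<eta>0) + m) choose m \<le> (t + r + m) choose m"
        by (intro binomial_right_mono) simp
      ultimately show ?thesis by simp
    qed
    moreover obtain t where "(t + r + m) choose m < 2 * ((t + m) choose m)"
      using binomial_eventually_less_double[of r m] unfolding eventually_sequentially by blast
    ultimately show False by (metis not_less)
  qed
  then obtain e where e: "e \<in> Theta m" "\<And>i. i \<in> I \<Longrightarrow> th e i \<in> cl (insert (th e i1) (Low e))" by blast
  define \<zeta> where "\<zeta> = vadd e \<eta>"
  have \<zeta>: "\<zeta> \<in> V" unfolding \<zeta>_def using V_vadd[OF e(1) \<eta>(1)] .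
  define A where "A = G \<inter> Y (Suc (rk \<zeta>))"
  \<comment> \<open>The line over \<open>G\<close> through \<open>s i1\<close>. The elements of
    \<open>A\<close> with \<open>PD \<zeta>\<close> on this line form a field that is relatively
    algebraically closed in \<open>A\<close>; it contains \<open>th e i1\<close> and
    \<open>Low e\<close>, hence all \<open>th e i\<close>, whose partial derivatives are the
    \<open>s i\<close>.\<close>
  define M where "M = (\<lambda>g. s i1 * g) ` G"
  have A: "is_subfield A" unfolding A_def using subfield_G by (intro subfield_Int) auto
  have dA: "deriv_on A (PD \<zeta>)" using deriv_PD[OF \<zeta>] by (rule deriv_on_subset) (auto simp: A_def)
  have M: "0 \<in> M" "\<And>a b. a \<in> M \<Longrightarrow> b \<in> M \<Longrightarrow> a + b \<in> M" "\<And>a b. a \<in> A \<Longrightarrow> b \<in> M \<Longrightarrow> a * b \<in> M"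
  proof -
    show "0 \<in> M" unfolding M_def using subfield_0[OF subfield_G] by (intro image_eqI[of _ _ 0]) auto
    show "a + b \<in> M" if ab: "a \<in> M" "b \<in> M" for a b
    proof -
      obtain g h where "a = s i1 * g" "b = s i1 * h" "g \<in> G" "h \<in> G" using ab unfolding M_def by blast
      then show ?thesis unfolding M_def
        by (intro image_eqI[of _ _ "g + h"]) (auto simp: distrib_left subfield_add[OF subfield_G])
    qed
    show "a * b \<in> M" if ab: "a \<in> A" "b \<in> M" for a b
    proof -
      obtain h where "b = s i1 * h" "h \<in> G" using ab(2) unfolding M_def by blast
      then show ?thesis unfolding M_def using ab(1)
        by (intro image_eqI[of _ _ "a * h"]) (auto simp: A_def subfield_mult[OF subfield_G])
    qed
  qed
  let ?T = "{z \<in> A. PD \<zeta> z \<in> M}"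
  have T: "is_subfield ?T" by (rule subfield_deriv_preimage[OF A dA M])
  have "insert (th e i1) (Low e) \<subseteq> ?T"
  proof
    fix y assume "y \<in> insert (th e i1) (Low e)"
    then show "y \<in> ?T"
    proof
      assume y: "y = th e i1"
      have "s i1 \<in> M" unfolding M_def using subfield_1[OF subfield_G] by (intro image_eqI[of _ _ 1]) auto
      then show ?thesis using y thG[OF e(1) i1(1)] thY[OF e(1) i1(1)] by (simp add: A_def \<zeta>_def)
    next
      assume y: "y \<in> Low e"
      then have "y \<in> G" "y \<in> Y (rk \<zeta>)" using LowG LowY unfolding \<zeta>_def by auto
      then show ?thesis using PD_const[OF \<zeta>] M(1) Y_mono[of "rk \<zeta>" "Suc (rk \<zeta>)"] by (auto simp: A_def)
    qed
  qed
  then have "cl (insert (th e i1) (Low e)) \<subseteq> acl ?T" unfolding cl_def using T by (intro acl_mono field_gen_least)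
  then have "PD \<zeta> (th e i) \<in> M" if "i \<in> I" for i
    using e(2)[OF that] thG[OF e(1) that] thY(1)[OF e(1) that]
    by (intro acl_deriv_preimage[OF A dA M]) (auto simp: A_def \<zeta>_def)
  then have "s i \<in> M" if "i \<in> I" for i using thY(2)[OF e(1) that] that unfolding \<zeta>_def by metis
  then have "\<exists>g. g \<in> G \<and> s i = s i1 * g" if "i \<in> I" for i using that unfolding M_def by blast
  then obtain g where g: "\<And>i. i \<in> I \<Longrightarrow> g i \<in> G" "\<And>i. i \<in> I \<Longrightarrow> s i = s i1 * g i" by metis
  \<comment> \<open>Dividing by \<open>s i1\<close> turns the differentiated relation into one with
    coefficients in \<open>G\<close>, against the independence of the \<open>f i\<close>.\<close>
  have "s i1 * (\<Sum>i\<in>I. g i * f i) = (\<Sum>i\<in>I. s i * f i)"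
    unfolding sum_distrib_left using g(2) by (intro sum.cong refl) simp
  then have "(\<Sum>i\<in>I. g i * f i) = 0" using srel s1 by simp
  moreover have "g i1 \<noteq> 0" using g(2)[OF i1(1)] s1 by auto
  ultimately have "lin_dep G I f" unfolding lin_dep_def using g(1) i1(1) by blast
  then show False using ind by blast
qed

text \<open>Some member of the family is a combination over \<open>G\<close> of a maximal
  independent subfamily. \<open>coefficients_mem\<close> puts its coefficients into
  \<open>Y k0\<close>, hence into \<open>G0\<close>.\<close>

lemma linearly_disjoint:
  assumes I: "finite I" "\<And>i. i \<in> I \<Longrightarrow> f i \<in> Y k0" "lin_dep G I f"
  shows "lin_dep G0 I f"
proof -
  obtain J where J: "J \<subseteq> I" "\<not> lin_dep G J f" "\<And>i. i \<in> I \<Longrightarrow> f i \<in> lin_span G J f"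
    using lin_basis_exists[OF subfield_G I(1), of f] by metis
  have finJ: "finite J" using J(1) I(1) finite_subset by blast
  have "J \<noteq> I" using J(2) I(3) by auto
  then obtain i0 where i0: "i0 \<in> I" "i0 \<notin> J" using J(1) by blast
  obtain c where c: "\<And>i. i \<in> J \<Longrightarrow> c i \<in> G" "f i0 = (\<Sum>i\<in>J. c i * f i)" using lin_spanE[OF J(3)[OF i0(1)]] by metis
  have "\<forall>i\<in>J. c i \<in> Y k0"
    using J(1) I(2) i0 by (intro coefficients_mem[OF finJ _ _ c(1) c(2) J(2)]) auto
  then have cG0: "c i \<in> G0" if "i \<in> J" for i using c(1) that by (simp add: G0_def)
  define b where "b i = (if i = i0 then - 1 else c i)" for i
  have "(\<Sum>i\<in>insert i0 J. b i * f i) = - f i0 + (\<Sum>i\<in>J. b i * f i)" using finJ i0(2) by (simp add: b_def)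
  also have "(\<Sum>i\<in>J. b i * f i) = (\<Sum>i\<in>J. c i * f i)" using i0(2) by (intro sum.cong) (auto simp: b_def)
  finally have "(\<Sum>i\<in>insert i0 J. b i * f i) = 0" using c(2) by simp
  moreover have "\<forall>i\<in>insert i0 J. b i \<in> G0" using cG0 subfield_uminus[OF subfield_G0 subfield_1[OF subfield_G0]] by (auto simp: b_def)
  moreover have "b i0 \<noteq> 0" by (simp add: b_def)
  ultimately have "lin_dep G0 (insert i0 J) f" unfolding lin_dep_def by blast
  then show ?thesis using lin_dep_mono[OF _ _ I(1) subfield_G0 order_refl, of "insert i0 J" f] J(1) i0(1) by blast
qed

end

lemma Theta_nonzero_shift:
  assumes "e \<in> Theta m" "e \<noteq> (\<lambda>_. 0)" obtains f i where "f \<in> Theta m" "i < m" "e = shift i f"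
proof -
  have "e = (\<lambda>_. 0) \<or> (\<exists>f i. f \<in> Theta m \<and> i < m \<and> e = shift i f)"
    using assms(1) by (induction e rule: theta_induct) blast+
  then show ?thesis using assms(2) that by blast
qed

context delta_principal
begin

section \<open>The field \<open>G0\<close> and its generator\<close>

lemma GY_compositum: "GY k = field_gen (G \<union> Y k)"
proof -
  let ?S = "X ` {\<zeta> \<in> V. rk \<zeta> < k}"
  have "field_gen (G \<union> Y k) = field_gen (F \<union> ?S \<union> G)"
    unfolding Y_def by (subst Un_commute) (rule field_gen_Un_field_gen)
  also have "F \<union> ?S \<union> G = G \<union> ?S" using F_G by blast
  finally show ?thesis unfolding GY_def by simp
qed

text \<open>The equation of the leader \<open>X \<eta>0\<close>, with denominators cleared, is a
  linear relation over \<open>G\<close> between products of elements of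
  \<open>Y (rk \<eta>0)\<close> and powers of \<open>X \<eta>0\<close>. Linear disjointness replaces
  it by one over \<open>G0\<close>; if \<open>G0\<close> lay in \<open>F\<close>, this would make
  \<open>X \<eta>0\<close> algebraic over the lower derivatives.\<close>

lemma G0_neq_F: "\<not> G0 \<subseteq> F"
proof
  assume G0F: "G0 \<subseteq> F"
  let ?Y = "Y (rk \<eta>0)" and ?x = "X \<eta>0"
  have "?x \<in> acl (GY (rk \<eta>0))" using \<eta>0_E by (simp add: E_def)
  then obtain p where p: "p \<in> polys_over (GY (rk \<eta>0))" "p \<noteq> 0" "poly p ?x = 0"
    unfolding acl_def algebraic_over_iff by blast
  define d where "d = degree p"
  have "\<exists>a\<in>compositum_ring G ?Y. \<exists>b\<in>compositum_ring G ?Y. b \<noteq> 0 \<and> z = a / b" if "z \<in> GY (rk \<eta>0)" for z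
    using that unfolding GY_compositum by (rule compositum_fractions[OF subfield_G subfield_Y])
  then have fr: "\<exists>a\<in>compositum_ring G ?Y. \<exists>b\<in>compositum_ring G ?Y. b \<noteq> 0 \<and> coeff p i = a / b" for i
    using polys_overD[OF p(1)] by blast
  have one: "1 \<in> compositum_ring G ?Y"
    using compositum_ring_left[OF subfield_G subfield_Y subfield_1[OF subfield_G]] .
  obtain a q where a: "\<And>i. i \<in> {..d} \<Longrightarrow> a i \<in> compositum_ring G ?Y" "q \<noteq> 0"
    "\<And>i. i \<in> {..d} \<Longrightarrow> coeff p i = a i / q"
    using common_denominator[OF one compositum_ring_mult[OF subfield_G subfield_Y], of "{..d}" "coeff p"] fr
    by (metis finite_atMost)
  obtain M where M: "finite M" "M \<subseteq> ?Y" "\<And>i. i \<in> {..d} \<Longrightarrow> a i \<in> lin_span G M (\<lambda>b. b)"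
    using compositum_ring_common[OF subfield_G, of "{..d}" a ?Y] a(1) by (metis finite_atMost)
  \<comment> \<open>Independence of \<open>J\<close> over \<open>G\<close> ensures that the equation
    obtained over \<open>G0\<close> is not trivial: vanishing coefficients would be relations
    between the elements of \<open>J\<close>.\<close>
  obtain J where J: "J \<subseteq> M" "\<not> lin_dep G J (\<lambda>b. b)" "\<And>i. i \<in> M \<Longrightarrow> i \<in> lin_span G J (\<lambda>b. b)"
    using lin_basis_exists[OF subfield_G M(1), of "\<lambda>b. b"] by metis
  have finJ: "finite J" using J(1) M(1) finite_subset by blast
  have "a i \<in> lin_span G J (\<lambda>b. b)" if "i \<in> {..d}" for i
    using lin_span_trans[OF subfield_G order_refl finJ M(3)[OF that]] J(3) by blast
  then have "\<exists>g. (\<forall>b\<in>J. g b \<in> G) \<and> a i = (\<Sum>b\<in>J. g b * b)" if "i \<in> {..d}" for i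
    using that unfolding lin_span_def by blast
  then obtain g where g: "\<And>i b. i \<in> {..d} \<Longrightarrow> b \<in> J \<Longrightarrow> g i b \<in> G" "\<And>i. i \<in> {..d} \<Longrightarrow> a i = (\<Sum>b\<in>J. g i b * b)"
    by metis
  define h where "h = (\<lambda>(i, b). b * ?x ^ i)"
  let ?I = "{..d} \<times> J"
  have dbl: "(\<Sum>p\<in>?I. c (fst p) (snd p) * h p) = (\<Sum>i\<le>d. (\<Sum>b\<in>J. c i b * b) * ?x ^ i)" for c :: "nat \<Rightarrow> 'a \<Rightarrow> 'a"
    unfolding h_def by (simp add: sum.cartesian_product[symmetric] case_prod_beta sum_distrib_right mult.assoc)
      (simp add: sum.cartesian_product case_prod_beta)
  have "(\<Sum>p\<in>?I. g (fst p) (snd p) * h p) = (\<Sum>i\<le>d. a i * ?x ^ i)"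
    unfolding dbl using g(2) by (intro sum.cong) auto
  also have "\<dots> = (\<Sum>i\<le>d. q * (coeff p i * ?x ^ i))" using a(2,3) by (intro sum.cong) auto
  also have "\<dots> = q * poly p ?x" by (simp add: poly_altdef d_def sum_distrib_left)
  finally have rel: "(\<Sum>p\<in>?I. g (fst p) (snd p) * h p) = 0" using p(3) by simp
  have "\<exists>p\<in>?I. g (fst p) (snd p) \<noteq> 0"
  proof (rule ccontr)
    assume "\<not> ?thesis"
    then have "a d = 0" using g(2)[of d] by simp
    then have "lead_coeff p = 0" using a(3)[of d] by (simp add: d_def)
    then show False using p(2) by simp
  qed
  then have "lin_dep G ?I h" unfolding lin_dep_def using rel g(1) by (intro exI[of _ "\<lambda>p. g (fst p) (snd p)"]) auto
  moreover have "h p \<in> Y k0" if "p \<in> ?I" for p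
  proof -
    have "snd p \<in> J" using that by auto
    moreover have "?Y \<subseteq> Y k0" by (intro Y_mono) (simp add: k0_def)
    ultimately have "snd p \<in> Y k0" using J(1) M(2) by blast
    moreover have "?x \<in> Y k0" using X_Y[OF \<eta>0] by (simp add: k0_def)
    ultimately show ?thesis unfolding h_def case_prod_beta
      by (intro subfield_mult[OF subfield_Y] subfield_power[OF subfield_Y])
  qed
  ultimately have "lin_dep G0 ?I h" using finJ by (intro linearly_disjoint) auto
  then obtain c where c: "\<forall>p\<in>?I. c p \<in> G0" "\<exists>p\<in>?I. c p \<noteq> 0" "(\<Sum>p\<in>?I. c p * h p) = 0"
    unfolding lin_dep_def by blast
  define r where "r = (\<Sum>i\<le>d. monom (\<Sum>b\<in>J. c (i, b) * b) i)"
  have "r \<in> polys_over ?Y"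
    unfolding r_def
  proof (intro polys_over_sum polys_over_monom subfield_sum subfield_mult subfield_Y)
    fix i b assume "i \<in> {..d}" "b \<in> J"
    then show "c (i, b) \<in> ?Y" "b \<in> ?Y" using c(1) G0F F_Y J(1) M(2) by blast+
  qed
  moreover have "poly r ?x = 0"
    using c(3) dbl[of "\<lambda>i b. c (i, b)"] by (simp add: r_def poly_sum poly_monom)
  ultimately have "r = 0" using acl_not_poly_root[OF X_notin_acl_Y[OF \<eta>0]] by blast
  have z: "(\<Sum>b\<in>J. c (i, b) * b) = 0" if "i \<le> d" for i
  proof -
    have "coeff r i = (\<Sum>b\<in>J. c (i, b) * b)" using that by (simp add: r_def coeff_sum)
    then show ?thesis using \<open>r = 0\<close> by simp
  qed
  obtain i b where ib: "i \<le> d" "b \<in> J" "c (i, b) \<noteq> 0" using c(2) by auto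
  have "\<forall>b\<in>J. c (i, b) \<in> G" using c(1) ib(1) by (auto simp: G0_def)
  then have "lin_dep G J (\<lambda>b. b)" unfolding lin_dep_def using z[OF ib(1)] ib(2,3) by (intro exI[of _ "\<lambda>b. c (i, b)"]) auto
  then show False using J(2) by blast
qed

text \<open>An element of \<open>G\<close> outside \<open>F\<close> makes its own leader an element
  of \<open>E\<close>, and no element of \<open>E\<close> ranks below
  \<open>\<eta>0\<close>.\<close>

lemma G0_leader:
  assumes "z \<in> G0" "z \<notin> F" shows "z \<notin> Y (rk \<eta>0)"
proof
  assume z: "z \<in> Y (rk \<eta>0)"
  have zG: "z \<in> G" using assms(1) by (simp add: G0_def)
  obtain \<eta> where \<eta>: "\<eta> \<in> V" "z \<in> Y (Suc (rk \<eta>))" "z \<notin> Y (rk \<eta>)"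
    using leader_exists[of z] zG G_sub assms(2) by blast
  have "rk \<eta> < rk \<eta>0" using z \<eta>(3) Y_mono[of "rk \<eta>0" "rk \<eta>"] by (meson not_less subsetD)
  have "insert z (Y (rk \<eta>)) \<subseteq> GY (rk \<eta>)" using zG G_GY Y_GY by blast
  then have "cl (insert z (Y (rk \<eta>))) \<subseteq> acl (GY (rk \<eta>))"
    unfolding cl_def by (intro acl_mono field_gen_least) auto
  then have "\<eta> \<in> E" using X_algebraic_over_nonconst[OF \<eta>] \<eta>(1) by (auto simp: E_def)
  then show False using rk_E \<open>rk \<eta> < rk \<eta>0\<close> by fastforce
qed

lemma finite_below: "finite {\<zeta> \<in> V. rk \<zeta> < rk \<eta>0}"
proof (rule finite_subset)
  show "{\<zeta> \<in> V. rk \<zeta> < rk \<eta>0} \<subseteq> V_upto (theta_ord m (fst \<eta>0))"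
    using ord_le_of_rk[OF _ \<eta>0] by (auto simp: V_upto_def)
qed simp

lemma Y_k0: "Y k0 = field_gen (F \<union> insert (X \<eta>0) (X ` {\<zeta> \<in> V. rk \<zeta> < rk \<eta>0}))"
proof -
  have "{\<zeta> \<in> V. rk \<zeta> < k0} = insert \<eta>0 {\<zeta> \<in> V. rk \<zeta> < rk \<eta>0}"
    unfolding k0_def using rk_eq[OF _ \<eta>0] \<eta>0 less_Suc_eq by blast
  then show ?thesis unfolding Y_def by simp
qed

text \<open>The derivatives below \<open>\<eta>0\<close> are non-leaders and so independent over
  \<open>G\<close>. Together with two independent elements of \<open>G0\<close> they would be one
  element more than the generators of \<open>Y k0\<close> allow.\<close>

lemma G0_algebraic:
  assumes v0: "v0 \<in> G0" "v0 \<notin> F" shows "G0 \<subseteq> cl (insert v0 F)"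
proof
  fix z assume z: "z \<in> G0"
  let ?B = "X ` {\<zeta> \<in> V. rk \<zeta> < rk \<eta>0}"
  show "z \<in> cl (insert v0 F)"
  proof (rule ccontr)
    assume nz: "z \<notin> cl (insert v0 F)"
    have "v0 \<notin> cl (F \<union> {})"
    proof
      assume "v0 \<in> cl (F \<union> {})"
      then have "v0 \<in> acl F" using subfield_F by (simp add: cl_def)
      moreover have "v0 \<in> Y (Suc (rk \<eta>0))" using v0 by (simp add: G0_def k0_def)
      ultimately have "PD \<eta>0 v0 = 0" using F_Y PD_const[OF \<eta>0] by (intro PD_zero_algebraic[OF \<eta>0, of F]) auto
      then show False using PD_nonzero[OF \<eta>0] G0_leader[OF v0] v0(1) by (auto simp: G0_def k0_def)
    qed
    then have "indep F {v0}" using indep_insert[of F "{}"] by simp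
    then have i2: "indep F {z, v0}" using indep_insert[of F "{v0}" z] nz by (simp add: insert_commute)
    have "z \<noteq> v0" using nz cl_incl[of v0 "insert v0 F"] by auto
    have iB: "indep G ?B"
      using indep_nonleaders by (rule indep_subset) (use rk_E in fastforce)
    have "F \<subseteq> cl G" "{z, v0} \<subseteq> cl G" using F_G z v0(1) cl_superset[of G] by (auto simp: G0_def)
    note u = indep_Un[OF i2 iB this finite_imageI[OF finite_below]]
    have C: "F \<union> insert (X \<eta>0) ?B \<subseteq> cl (F \<union> insert (X \<eta>0) ?B)" by (rule cl_superset)
    have "{z, v0} \<subseteq> Y k0" using z v0(1) by (auto simp: G0_def)
    then have "{z, v0} \<union> ?B \<subseteq> cl (F \<union> insert (X \<eta>0) ?B)"
      using field_gen_subset_cl[of "F \<union> insert (X \<eta>0) ?B"] C unfolding Y_k0 by blast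
    then have "card ({z, v0} \<union> ?B) \<le> card (insert (X \<eta>0) ?B)"
      using finite_below by (intro steinitz[OF _ _ u(1)]) auto
    moreover have "card ({z, v0} \<union> ?B) = 2 + card ?B"
      using card_Un_disjoint[OF _ finite_imageI[OF finite_below] u(2)] \<open>z \<noteq> v0\<close> by simp
    moreover have "card (insert (X \<eta>0) ?B) \<le> Suc (card ?B)" by (rule card_insert_le_m1) simp_all
    ultimately show False by simp
  qed
qed

text \<open>In Gordan's theorem \<open>X \<eta>0\<close> is the distinguished variable and
  \<open>PD \<eta>0\<close> the derivation. The lower derivatives are the variables to be
  specialised.\<close>

lemma G0_simple: obtains v where "v \<in> G0" "G0 = field_gen (insert v F)"
proof -
  obtain v0 where v0: "v0 \<in> G0" "v0 \<notin> F" using G0_neq_F by blast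
  let ?B = "{\<zeta> \<in> V. rk \<zeta> < rk \<eta>0}"
  have "\<exists>w\<in>G0. G0 = field_gen (insert w F)"
  proof (rule gordan[OF subfield_F, of "X ` ?B" "X \<eta>0" "PD \<eta>0"])
    show "finite (X ` ?B)" using finite_below by simp
    show "indep F (insert (X \<eta>0) (X ` ?B))" using indep_X(2) by (rule indep_subset) (use \<eta>0 in auto)
    show "X \<eta>0 \<notin> X ` ?B"
    proof
      assume "X \<eta>0 \<in> X ` ?B"
      then obtain \<zeta> where "\<zeta> \<in> V" "rk \<zeta> < rk \<eta>0" "X \<eta>0 = X \<zeta>" by blast
      then show False using inj_onD[OF indep_X(1), of \<eta>0 \<zeta>] \<eta>0 by auto
    qed
    show "deriv_on (field_gen (F \<union> insert (X \<eta>0) (X ` ?B))) (PD \<eta>0)"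
      using deriv_PD[OF \<eta>0] unfolding Y_k0[symmetric] k0_def .
    show "PD \<eta>0 y = 0" if "y \<in> F \<union> X ` ?B" for y
      using that F_Y X_Y by (intro PD_const[OF \<eta>0]) auto
    show "PD \<eta>0 (X \<eta>0) = 1" by (rule PD_X[OF \<eta>0])
    show "is_subfield G0" by (rule subfield_G0)
    show "F \<subseteq> G0" unfolding G0_def using F_G F_Y by blast
    show "G0 \<subseteq> field_gen (F \<union> insert (X \<eta>0) (X ` ?B))" unfolding Y_k0[symmetric] G0_def by blast
    show "v0 \<in> G0" by fact
    show "PD \<eta>0 v0 \<noteq> 0" using PD_nonzero[OF \<eta>0] G0_leader[OF v0] v0(1) by (simp add: G0_def k0_def)
    show "G0 \<subseteq> cl (insert v0 F)" by (rule G0_algebraic[OF v0])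
  qed
  then show ?thesis using that by blast
qed

text \<open>With \<open>K = F\<langle>v\<rangle>\<close>, all derivatives are rational over
  \<open>K\<close>, \<open>Y k0\<close> and the non-leaders. For an element of \<open>G\<close> the
  non-leaders can be removed, and a comparison of coefficients with respect to elements of
  \<open>Y k0\<close> independent over \<open>G\<close> then eliminates \<open>Y k0\<close>.\<close>

theorem G_generated: "\<exists>v\<in>G. G = field_gen (F \<union> {theta_app \<delta> m e v |e. e \<in> Theta m})"
proof -
  obtain v where v: "v \<in> G0" "G0 = field_gen (insert v F)" using G0_simple by blast
  have vF: "v \<notin> F"
  proof
    assume "v \<in> F"
    then have "G0 = F" using v(2) subfield_F by (simp add: insert_absorb)
    then show False using G0_neq_F by simp
  qed
  have vG: "v \<in> G" and vY: "v \<in> Y (Suc (rk \<eta>0))" using v(1) by (auto simp: G0_def k0_def)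
  have vL: "v \<notin> Y (rk \<eta>0)" using G0_leader[OF v(1) vF] .
  define K where "K = field_gen (F \<union> {theta_app \<delta> m e v |e. e \<in> Theta m})"
  have K: "is_subfield K" "F \<subseteq> K" "\<And>e. e \<in> Theta m \<Longrightarrow> theta_app \<delta> m e v \<in> K"
    unfolding K_def using field_gen_superset[of "F \<union> {theta_app \<delta> m e v |e. e \<in> Theta m}"] by auto
  have KG: "K \<subseteq> G"
    unfolding K_def using F_G theta_app_mem[OF comm delta_G _ vG] by (intro field_gen_least[OF subfield_G]) auto
  have "v \<in> K" using K(3)[OF zero_Theta] by simp
  then have G0K: "G0 \<subseteq> K" unfolding v(2) using K by (intro field_gen_least) auto

  \<comment> \<open>Only non-leaders are adjoined beyond \<open>Y k0\<close>; leaders above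
    \<open>\<eta>0\<close> will turn out to be rational over these fields.\<close>
  define W where "W k = field_gen (K \<union> Y k0 \<union> X ` {\<zeta> \<in> V - E. rk \<zeta> < k})" for k
  have W: "is_subfield (W k)" "K \<subseteq> W k" "Y k0 \<subseteq> W k" for k
    unfolding W_def using field_gen_superset[of "K \<union> Y k0 \<union> X ` {\<zeta> \<in> V - E. rk \<zeta> < k}"] by auto
  have Wmono: "W k \<subseteq> W l" if "k \<le> l" for k l unfolding W_def using that by (intro field_gen_mono) auto
  have XW: "X \<eta> \<in> W (Suc (rk \<eta>))" if "\<eta> \<in> V" for \<eta>
    using that
  proof (induction "rk \<eta>" arbitrary: \<eta> rule: less_induct)
    case less
    consider "rk \<eta> \<le> rk \<eta>0" | "\<eta> \<notin> E" | "\<eta> \<in> E" "rk \<eta>0 < rk \<eta>" by linarith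
    then show ?case
    proof cases
      case 1
      then show ?thesis using X_Y[OF less.prems, of k0] W(3) by (auto simp: k0_def)
    next
      case 2
      then show ?thesis unfolding W_def using less.prems by (intro field_gen_incl) auto
    next
      case 3
      obtain e where e: "e \<in> Theta m" "\<eta> = vadd e \<eta>0" using 3(1) E_eq by blast
      have "e \<noteq> (\<lambda>_. 0)" using e(2) 3(2) by auto
      then obtain f i where fi: "f \<in> Theta m" "i < m" "e = shift i f" using Theta_nonzero_shift[OF e(1)] by blast
      define \<zeta> c where "\<zeta> = vadd f \<eta>0" and "c = theta_app \<delta> m f v"
      have \<zeta>: "\<zeta> \<in> V" "vshift i \<zeta> = \<eta>" using fi e V_vadd \<eta>0 by (auto simp: \<zeta>_def vadd_shift)
      have c: "c \<in> Y (Suc (rk \<zeta>))" "PD \<zeta> c = PD \<eta>0 v" using theta_app_PD[OF \<eta>0 vY fi(1)] unfolding c_def \<zeta>_def by auto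
      have c0: "PD \<zeta> c \<noteq> 0" using c(2) PD_nonzero[OF \<eta>0 vY vL] by simp
      have dc: "\<delta> i c \<in> K" using K(3)[OF e(1)] theta_app_shift[OF comm fi(2)] unfolding c_def fi(3) by simp
      note d = delta_PD(1,2)[OF \<zeta>(1) fi(2) c(1), unfolded \<zeta>(2)]
      have "X \<zeta>' \<in> W (rk \<eta>)" if "\<zeta>' \<in> V" "rk \<zeta>' < rk \<eta>" for \<zeta>'
        using less.hyps[OF that(2,1)] Wmono[of "Suc (rk \<zeta>')" "rk \<eta>"] that(2) by auto
      then have "Y (rk \<eta>) \<subseteq> W (rk \<eta>)" unfolding Y_def using K(2) W(2) by (intro field_gen_least[OF W(1)]) blast
      then have "PD \<zeta> c \<in> W (rk \<eta>)" "\<delta> i c - PD \<zeta> c * X \<eta> \<in> W (rk \<eta>)" "\<delta> i c \<in> W (rk \<eta>)"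
        using d dc W(2) by auto
      \<comment> \<open>The derivative \<open>\<delta> i c\<close> of \<open>v\<close> is linear in
        its leader \<open>X \<eta>\<close> with the non-zero separant of \<open>v\<close> as
        coefficient, so \<open>X \<eta>\<close> can be solved for.\<close>
      then have "(\<delta> i c - (\<delta> i c - PD \<zeta> c * X \<eta>)) / PD \<zeta> c \<in> W (rk \<eta>)"
        using subfield_divide[OF W(1) subfield_diff[OF W(1)]] by blast
      then have "X \<eta> \<in> W (rk \<eta>)" using c0 by simp
      then show ?thesis using Wmono[of "rk \<eta>" "Suc (rk \<eta>)"] by auto
    qed
  qed
  have YW: "Y k \<subseteq> W k" for k
    unfolding Y_def
  proof (rule field_gen_least[OF W(1)])
    have "X \<zeta> \<in> W k" if "\<zeta> \<in> V" "rk \<zeta> < k" for \<zeta>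
      using XW[OF that(1)] Wmono[of "Suc (rk \<zeta>)" k] that(2) by auto
    then show "F \<union> X ` {\<zeta> \<in> V. rk \<zeta> < k} \<subseteq> W k" using K(2) W(2) by blast
  qed
  \<comment> \<open>From rank \<open>k0\<close> on, \<open>W k\<close> lies in \<open>GY k\<close>,
    over which a non-leader of rank \<open>k\<close> is transcendental; as \<open>g\<close> lies in
    \<open>G\<close>, the non-leader can be removed. Those of smaller rank already belong to
    \<open>Y k0\<close>.\<close>
  have desc: "g \<in> W 0" if "g \<in> G" "g \<in> W k" for g k
    using that(2)
  proof (induction k)
    case (Suc k)
    have "g \<in> W k"
    proof (cases "\<exists>\<zeta>\<in>V - E. rk \<zeta> = k")
      case False
      then have "{\<zeta> \<in> V - E. rk \<zeta> < Suc k} = {\<zeta> \<in> V - E. rk \<zeta> < k}" by (auto simp: less_Suc_eq)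
      then show ?thesis using Suc.prems unfolding W_def by simp
    next
      case True
      then obtain \<zeta> where \<zeta>: "\<zeta> \<in> V - E" "rk \<zeta> = k" by blast
      have "{\<xi> \<in> V - E. rk \<xi> < Suc k} = insert \<zeta> {\<xi> \<in> V - E. rk \<xi> < k}"
        using \<zeta> rk_eq[of _ \<zeta>] less_Suc_eq by blast
      then have WS: "W (Suc k) = field_gen (insert (X \<zeta>) (W k))"
        unfolding W_def using field_gen_Un_field_gen[of "K \<union> Y k0 \<union> X ` {\<xi> \<in> V - E. rk \<xi> < k}" "{X \<zeta>}"] by simp
      show ?thesis
      proof (cases "k < k0")
        case True
        then have "X \<zeta> \<in> W k" using X_Y[of \<zeta> k0] \<zeta> W(3) by auto
        then have "W (Suc k) = W k" unfolding WS using W(1) by (simp add: insert_absorb)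
        then show ?thesis using Suc.prems by simp
      next
        case False
        have "Y k0 \<subseteq> GY k" using Y_mono[of k0 k] Y_GY[of k] False by auto
        moreover have "X ` {\<zeta> \<in> V - E. rk \<zeta> < k} \<subseteq> GY k"
          unfolding GY_def using field_gen_superset[of "G \<union> X ` {\<zeta> \<in> V. rk \<zeta> < k}"] by auto
        moreover have "K \<subseteq> GY k" using KG G_GY by blast
        ultimately have "W k \<subseteq> GY k" unfolding W_def by (intro field_gen_least) auto
        moreover have "X \<zeta> \<notin> acl (GY k)" using \<zeta> by (auto simp: E_def)
        ultimately show ?thesis
          using mem_of_transcendental_extension[OF W(1) subfield_GY] G_GY that(1) Suc.prems unfolding WS by blast
      qed
    qed
    then show ?case using Suc.IH by blast
  qed
  have "g \<in> K" if g: "g \<in> G" for g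
  proof -
    obtain k where "g \<in> Y k" using mem_Y_exists[of g] g G_sub by blast
    then have "g \<in> W 0" using desc[OF g] YW by blast
    then have "g \<in> field_gen (K \<union> Y k0)" by (simp add: W_def)
    then obtain p q where pq: "p \<in> compositum_ring K (Y k0)" "q \<in> compositum_ring K (Y k0)" "q \<noteq> 0" "g = p / q"
      using compositum_fractions[OF K(1) subfield_Y] by blast
    obtain M where M: "finite M" "M \<subseteq> Y k0" "\<And>i. i \<in> {p, q} \<Longrightarrow> i \<in> lin_span K M (\<lambda>b. b)"
      using compositum_ring_common[OF K(1), of "{p, q}" "\<lambda>i. i" "Y k0"] pq(1,2) by auto
    \<comment> \<open>A basis over \<open>G0\<close> has two virtues: its coefficients lie in
      \<open>G0\<close> and hence in \<open>K\<close>, and by linear disjointness it stays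
      independent over \<open>G\<close>. Therefore \<open>p = g * q\<close> can be compared
      coefficient by coefficient.\<close>
    obtain J where J: "J \<subseteq> M" "\<not> lin_dep G0 J (\<lambda>b. b)" "\<And>i. i \<in> M \<Longrightarrow> i \<in> lin_span G0 J (\<lambda>b. b)"
      using lin_basis_exists[OF subfield_G0 M(1), of "\<lambda>b. b"] by metis
    have finJ: "finite J" using J(1) M(1) finite_subset by blast
    have JG: "\<not> lin_dep G J (\<lambda>b. b)" using linearly_disjoint[OF finJ, of "\<lambda>b. b"] J(1,2) M(2) by blast
    have "i \<in> lin_span K J (\<lambda>b. b)" if "i \<in> M" for i
      using J(3)[OF that] G0K unfolding lin_span_def by blast
    then have pJ: "p \<in> lin_span K J (\<lambda>b. b)" and qJ: "q \<in> lin_span K J (\<lambda>b. b)"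
      using lin_span_trans[OF K(1) order_refl finJ M(3)] by auto
    obtain a where a: "\<And>i. i \<in> J \<Longrightarrow> a i \<in> K" "p = (\<Sum>i\<in>J. a i * i)" using lin_spanE[OF pJ] by blast
    obtain b where b: "\<And>i. i \<in> J \<Longrightarrow> b i \<in> K" "q = (\<Sum>i\<in>J. b i * i)" using lin_spanE[OF qJ] by blast
    have "(\<Sum>i\<in>J. (a i - g * b i) * i) = p - g * q"
      unfolding a(2) b(2) by (simp add: sum_subtractf sum_distrib_left algebra_simps)
    then have 0: "(\<Sum>i\<in>J. (a i - g * b i) * i) = 0" using pq(3,4) by simp
    have "\<forall>i\<in>J. a i - g * b i \<in> G" using a(1) b(1) KG g by (auto intro!: subfield_diff[OF subfield_G] subfield_mult[OF subfield_G])
    then have eq: "a i = g * b i" if "i \<in> J" for i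
      using JG 0 that unfolding lin_dep_def by (auto dest: spec[of _ "\<lambda>i. a i - g * b i"])
    obtain i where i: "i \<in> J" "b i \<noteq> 0" using pq(3) b(2) by (metis (no_types, lifting) mult_zero_left sum.neutral)
    then have "g = a i / b i" using eq by simp
    then show ?thesis using a(1) b(1) i subfield_divide[OF K(1)] by auto
  qed
  then have "G = K" using KG by blast
  then show ?thesis using vG unfolding K_def by blast
qed

end

theorem corollary3p4:
  fixes \<delta> :: "nat \<Rightarrow> 'a::field_char_0 \<Rightarrow> 'a"
    and F G :: "'a set"
    and u :: "nat \<Rightarrow> 'a"
    and m n :: nat
  assumes "m > 1"
    and "commuting_derivations m \<delta>"
    and "delta_subfield m \<delta> F"
    and "delta_indeterminates m \<delta> F n u"
    and "delta_subfield m \<delta> G"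
    and "F \<subset> G"
    and "G \<subseteq> delta_gen m \<delta> F (u ` {..<n})"
  shows "(\<exists>v\<in>G. G = delta_gen m \<delta> F {v}) \<longleftrightarrow>
    (\<exists>s::nat. is_kolchin_polynomial m \<delta> G n u
       (of_nat n * binomial_poly (of_nat m) m - binomial_poly (of_nat m - of_nat s) m))"
proof -
  obtain rk where rk: "is_ranking m n rk" using ranking_exists by blast
  interpret delta_extension \<delta> m n F u rk
    using assms(1-4) rk by unfold_locales
  have "{theta_app \<delta> m e a |e a. e \<in> Theta m \<and> a \<in> u ` {..<n}} \<subseteq> X ` V"
  proof
    fix y assume "y \<in> {theta_app \<delta> m e a |e a. e \<in> Theta m \<and> a \<in> u ` {..<n}}"
    then obtain e j where "e \<in> Theta m" "j < n" "y = theta_app \<delta> m e (u j)" by blast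
    then show "y \<in> X ` V" unfolding X_def V_def by (intro image_eqI[of _ _ "(e, j)"]) auto
  qed
  then have "delta_gen m \<delta> F (u ` {..<n}) \<subseteq> field_gen (F \<union> X ` V)"
    unfolding delta_gen_def by (intro field_gen_mono) auto
  then interpret delta_intermediate \<delta> m n F u rk G
    using assms(5-7) by unfold_locales auto
  have gen: "delta_gen m \<delta> F {v} = field_gen (F \<union> {theta_app \<delta> m e v |e. e \<in> Theta m})" for v
    unfolding delta_gen_def by simp
  show ?thesis
    unfolding kolchin_polynomial_iff gen
  proof
    assume "\<exists>v\<in>G. G = field_gen (F \<union> {theta_app \<delta> m e v |e. e \<in> Theta m})"
    then obtain v where v: "v \<in> G" "G = field_gen (F \<union> {theta_app \<delta> m e v |e. e \<in> Theta m})" by blast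
    \<comment> \<open>The strict inclusion enters here: an element of \<open>F\<close> would
      generate only \<open>F\<close>, and without a leader outside \<open>F\<close> there would be
      no \<open>\<eta>0\<close>.\<close>
    have "v \<notin> F"
    proof
      assume "v \<in> F"
      then have "F \<union> {theta_app \<delta> m e v |e. e \<in> Theta m} = F" using theta_app_mem[OF assms(2,3)] by blast
      then show False using v(2) subfield_F assms(6) by simp
    qed
    then obtain \<eta>0 where \<eta>0: "\<eta>0 \<in> V" "E = (\<lambda>e. vadd e \<eta>0) ` Theta m" using E_of_generator[OF v(1) _ v(2)] by blast
    show "\<exists>s. \<forall>\<^sub>F t in sequentially. card (E_upto t) = (t - s + m) choose m"
      using card_E_upto_of_principal[OF \<eta>0] unfolding eventually_sequentially by blast
  next
    assume "\<exists>s. \<forall>\<^sub>F t in sequentially. card (E_upto t) = (t - s + m) choose m"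
    then obtain s where s: "\<forall>\<^sub>F t in sequentially. card (E_upto t) = (t - s + m) choose m" by blast
    have "\<exists>a\<in>Theta m. \<exists>j<n. theta_ord m a = s \<and> E = (\<lambda>f. (tadd a f, j)) ` Theta m"
    proof (rule kolchin_principal[OF assms(1)])
      show "E \<subseteq> Theta m \<times> {..<n}" using E_V by (simp add: V_def)
      show "(shift i e, j) \<in> E" if "(e, j) \<in> E" "i < m" for e j i
        using E_shift[OF that] by (simp add: vshift_def)
      show "\<forall>\<^sub>F t in sequentially. card {\<eta> \<in> E. theta_ord m (fst \<eta>) \<le> t} = (t - s + m) choose m"
        using s by (simp add: E_upto_def)
    qed
    then obtain a j where aj: "a \<in> Theta m" "j < n" "E = (\<lambda>f. (tadd a f, j)) ` Theta m" by blast
    have "(a, j) \<in> V" using aj by (simp add: V_def)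
    moreover have "E = (\<lambda>e. vadd e (a, j)) ` Theta m" unfolding aj(3) vadd_def by (simp add: tadd_commute)
    ultimately interpret delta_principal \<delta> m n F u rk G "(a, j)"
      by unfold_locales
    show "\<exists>v\<in>G. G = field_gen (F \<union> {theta_app \<delta> m e v |e. e \<in> Theta m})" by (rule G_generated)
  qed
qed

end
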